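(* Let $\mathcal{L} = \mathrm{span}_{\mathbb{R}}(A_1,\ldots,A_d) \subset \mathbb{S}^n$ be a $d$-dimensional linear space of symmetric matrices with distinct eigenvalues. Then the Gibbs variety $\mathrm{GV}(\mathcal{L})$ is irreducible and unirational. Moreover, if $A_1,\ldots,A_d$ have rational entries, then the ideal $J \subset \mathbb{R}[X]$ produced by the implicitization procedure described in the context is the prime ideal of $\mathrm{GV}(\mathcal{L})$.
   Context: $\mathbb{S}^n$ is the space of real symmetric $n\times n$ matrices. The Gibbs variety $\mathrm{GV}(\mathcal{L})$ is the Zariski closure of $\exp(\mathcal{L})$ (image under the matrix exponential) in the space $\mathbb{C}^{\binom{n+1}{2}}$ of complex symmetric matrices. Write $A(y) = y_1A_1+\cdots+y_dA_d$ with $A_1,\ldots,A_d$ linearly independent, and $P_{\mathcal{L}}(\lambda;y) = \det(A(y)-\lambda\cdot \mathrm{id}_n) = c_0(y)+c_1(y)\lambda+\cdots+c_n(y)\lambda^n$. "Distinct eigenvalues" means that $P_{\mathcal{L}}(\lambda;y)$ has $n$ distinct roots $\lambda$ in the algebraic closure $\overline{\mathbb{R}(y)}$. Implicitization procedure (input: linearly independent rational $A_1,\ldots,A_d$). Variables: $y=(y_1,\ldots,y_d)$, $\lambda=(\lambda_1,\ldots,\lambda_n)$, $z=(z_1,\ldots,z_n)$, and the entries $x_{ij}$ ($i\le j$) of a symmetric $n\times n$ matrix $X$. (1) $E_1'$ is the set of the $n$ polynomials $(-1)^i\sigma_{n-i}(\lambda)-c_i(y)$, $i=0,\ldots,n-1$,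 where $\sigma_t$ is the $t$-th elementary symmetric polynomial in $\lambda_1,\ldots,\lambda_n$. (2) $E_1$ is a set of generators of any (arbitrarily chosen) associated prime over $\mathbb{Q}$ of the ideal $\langle E_1'\rangle \subset \mathbb{Q}[y,\lambda]$. (3) $E_2$ is the set of entries of $\phi(y,\lambda,z)-X$, where $\phi(y,\lambda,z)=\sum_{i=1}^n z_i\prod_{j\ne i}\frac{1}{\lambda_i-\lambda_j}(A(y)-\lambda_j\cdot\mathrm{id}_n)$, after clearing denominators; $D$ is the least common denominator that was cleared. (4) $E_3 = \{z^\alpha - z^\beta : \alpha,\beta\in\mathbb{Z}_{\ge 0}^n,\ \sum_i\alpha_i\lambda_i = \sum_j\beta_j\lambda_j\}$, where the linear relations among the roots $\lambda_1,\ldots,\lambda_n$ are those lying in the chosen prime ideal $\langle E_1\rangle$; if the roots are $\mathbb{Q}$-linearly independent, then $E_3=\emptyset$. (5) $I$ is the ideal generated by $E_1\cup E_2\cup E_3$ in $\mathbb{R}[y,\lambda,z,X]$, replaced by its saturation $I:D^\infty$. (6) $J$ is the elimination ideal $I\cap\mathbb{R}[X]$. *)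

theory Defs
  imports
    "HOL-Library.Poly_Mapping"
    "HOL-Library.Countable"
    "HOL-Computational_Algebra.Computational_Algebra"
    "HOL-Algebra.Ideal"
    "HOL-Algebra.Algebraic_Closure_Type"
    "Jordan_Normal_Form.Determinant"
begin

section \<open>Multivariate polynomials\<close>

text \<open>
  Polynomials in variables of type \<open>'v\<close> are finitely supported maps from monomials (exponent
  vectors) to coefficients, with the convolution product of \<^theory>\<open>HOL-Library.Poly_Mapping\<close>.
\<close>

type_synonym ('v, 'a) mpoly = "('v \<Rightarrow>\<^sub>0 nat) \<Rightarrow>\<^sub>0 'a"

definition mconst :: "'a::zero \<Rightarrow> ('v, 'a) mpoly" where
  "mconst c = Poly_Mapping.single 0 c"

definition mvar :: "'v \<Rightarrow> ('v, 'a::zero_neq_one) mpoly" where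
  "mvar v = Poly_Mapping.single (Poly_Mapping.single v 1) 1"

definition mvars :: "('v, 'a::zero) mpoly \<Rightarrow> 'v set" where
  "mvars p = (\<Union>m\<in>Poly_Mapping.keys p. Poly_Mapping.keys m)"

definition meval :: "('v \<Rightarrow> 'a) \<Rightarrow> ('v, 'a::comm_semiring_1) mpoly \<Rightarrow> 'a" where
  "meval a p = (\<Sum>m\<in>Poly_Mapping.keys p.
      Poly_Mapping.lookup p m * (\<Prod>v\<in>Poly_Mapping.keys m. a v ^ Poly_Mapping.lookup m v))"

text \<open>
  The polynomial ring \<open>K[V]\<close>, where \<open>K\<close> is a subring of the coefficient type and \<open>V\<close> a set of
  variables; for instance \<open>\<rat>[V]\<close> is realised inside \<open>\<real>[V]\<close>.
\<close>

definition mpoly_ring :: "'a::comm_ring_1 set \<Rightarrow> 'v set \<Rightarrow> ('v, 'a) mpoly ring" where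
  "mpoly_ring K V =
    \<lparr>carrier = {p. mvars p \<subseteq> V \<and> (\<forall>m. Poly_Mapping.lookup p m \<in> K)},
     monoid.mult = (*), one = 1, ring.zero = 0, add = (+)\<rparr>"

definition associated_prime :: "('a, 'm) ring_scheme \<Rightarrow> 'a set \<Rightarrow> 'a set \<Rightarrow> bool" where
  "associated_prime R I P \<longleftrightarrow>
     primeideal P R \<and> (\<exists>f\<in>carrier R. P = {g \<in> carrier R. g \<otimes>\<^bsub>R\<^esub> f \<in> I})"

text \<open>The saturation \<open>I : D\<^sup>\<infinity>\<close> in \<open>R\<close>.\<close>

definition saturation :: "('a::comm_ring_1, 'm) ring_scheme \<Rightarrow> 'a set \<Rightarrow> 'a \<Rightarrow> 'a set" where
  "saturation R I D = {f \<in> carrier R. \<exists>k::nat. D ^ k * f \<in> I}"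

text \<open>
  \<open>D\<close> is a least common denominator of the fractions in \<open>F\<close>; it is determined up to a unit.
\<close>

definition common_denominator :: "'a::idom fract set \<Rightarrow> 'a \<Rightarrow> bool" where
  "common_denominator F D \<longleftrightarrow> D \<noteq> 0 \<and> (\<forall>f\<in>F. to_fract D * f \<in> range to_fract)"

definition least_common_denominator :: "'a::idom fract set \<Rightarrow> 'a \<Rightarrow> bool" where
  "least_common_denominator F D \<longleftrightarrow>
     common_denominator F D \<and> (\<forall>D'. common_denominator F D' \<longrightarrow> D dvd D')"


section \<open>Variables\<close>

text \<open>
  \<open>Yv i\<close>, \<open>Lv i\<close>, \<open>Zv i\<close>, \<open>Xv k l\<close> stand for \<open>y\<close>, \<open>\<lambda>\<close>, \<open>z\<close>, \<open>x\<close> with indices counted from 0;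
  only \<open>Xv k l\<close> with \<open>k \<le> l\<close> is used.  The linear order is arbitrary: the library needs some
  order on the variables to make the polynomials an integral domain.
\<close>

datatype var = Yv nat | Lv nat | Zv nat | Xv nat nat

instance var :: countable
  by countable_datatype

instantiation var :: linorder
begin

definition less_eq_var :: "var \<Rightarrow> var \<Rightarrow> bool" where
  "less_eq_var v w \<longleftrightarrow> to_nat v \<le> to_nat w"

definition less_var :: "var \<Rightarrow> var \<Rightarrow> bool" where
  "less_var v w \<longleftrightarrow> to_nat v < to_nat w"

instance
  by intro_classes (auto simp: less_eq_var_def less_var_def)

end

type_synonym rpoly = "(var, real) mpoly"

definition yvars :: "nat \<Rightarrow> var set" where "yvars d = Yv ` {..<d}"
definition lvars :: "nat \<Rightarrow> var set" where "lvars n = Lv ` {..<n}"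
definition zvars :: "nat \<Rightarrow> var set" where "zvars n = Zv ` {..<n}"
definition xvars :: "nat \<Rightarrow> var set" where "xvars n = {Xv k l | k l. k \<le> l \<and> l < n}"


section \<open>Zariski topology on the complex symmetric matrices\<close>

definition sym_mats :: "nat \<Rightarrow> 'a mat set" where
  "sym_mats n = {M \<in> carrier_mat n n. transpose_mat M = M}"

definition eval_at_mat :: "complex mat \<Rightarrow> (var, complex) mpoly \<Rightarrow> complex" where
  "eval_at_mat M f = meval (\<lambda>v. case v of Xv k l \<Rightarrow> M $$ (k, l) | _ \<Rightarrow> 0) f"

definition zariski_closed :: "nat \<Rightarrow> complex mat set \<Rightarrow> bool" where
  "zariski_closed n V \<longleftrightarrow>
     (\<exists>F \<subseteq> carrier (mpoly_ring UNIV (xvars n)). V = {M \<in> sym_mats n. \<forall>f\<in>F. eval_at_mat M f = 0})"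

definition zariski_closure :: "nat \<Rightarrow> complex mat set \<Rightarrow> complex mat set" where
  "zariski_closure n S = \<Inter>{V. zariski_closed n V \<and> S \<subseteq> V}"

definition irreducible_variety :: "nat \<Rightarrow> complex mat set \<Rightarrow> bool" where
  "irreducible_variety n V \<longleftrightarrow> zariski_closed n V \<and> V \<noteq> {} \<and>
     (\<forall>V1 V2. zariski_closed n V1 \<and> zariski_closed n V2 \<and> V = V1 \<union> V2 \<longrightarrow> V = V1 \<or> V = V2)"

text \<open>
  \<open>V\<close> is the closure of the image of a rational map from the affine space \<open>\<complex>\<^sup>m\<close>, given by the
  fractions \<open>p k l / q k l\<close> in coordinates \<open>x\<^sub>k\<^sub>l\<close>, \<open>k \<le> l\<close>.
\<close>

definition unirational :: "nat \<Rightarrow> complex mat set \<Rightarrow> bool" where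
  "unirational n V \<longleftrightarrow>
     (\<exists>m. \<exists>p q :: nat \<Rightarrow> nat \<Rightarrow> (nat, complex) mpoly.
        (\<forall>k l. k \<le> l \<and> l < n \<longrightarrow>
           p k l \<in> carrier (mpoly_ring UNIV {..<m}) \<and>
           q k l \<in> carrier (mpoly_ring UNIV {..<m}) \<and> q k l \<noteq> 0) \<and>
        V = zariski_closure n
              {M \<in> sym_mats n. \<exists>t :: nat \<Rightarrow> complex. \<forall>k l. k \<le> l \<and> l < n \<longrightarrow>
                 meval t (q k l) \<noteq> 0 \<and> M $$ (k, l) = meval t (p k l) / meval t (q k l)})"

text \<open>The ideal of \<open>V\<close> in the polynomial ring \<open>\<real>[X]\<close>.\<close>

definition real_ideal_of :: "nat \<Rightarrow> complex mat set \<Rightarrow> rpoly set" where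
  "real_ideal_of n V = {f \<in> carrier (mpoly_ring UNIV (xvars n)).
     \<forall>M\<in>V. eval_at_mat M (Poly_Mapping.map complex_of_real f) = 0}"


section \<open>Linear spaces of symmetric matrices and Gibbs varieties\<close>

definition mat_exp :: "real mat \<Rightarrow> real mat" where
  "mat_exp M = mat (dim_row M) (dim_row M) (\<lambda>(k, l). suminf (\<lambda>r. (M ^\<^sub>m r) $$ (k, l) / fact r))"

definition gibbs_variety :: "nat \<Rightarrow> real mat set \<Rightarrow> complex mat set" where
  "gibbs_variety n L = zariski_closure n ((\<lambda>M. map_mat complex_of_real (mat_exp M)) ` L)"

definition mat_lincomb :: "nat \<Rightarrow> nat \<Rightarrow> (nat \<Rightarrow> real mat) \<Rightarrow> (nat \<Rightarrow> real) \<Rightarrow> real mat" where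
  "mat_lincomb n d A c = mat n n (\<lambda>(k, l). \<Sum>i<d. c i * A i $$ (k, l))"

definition mat_span :: "nat \<Rightarrow> nat \<Rightarrow> (nat \<Rightarrow> real mat) \<Rightarrow> real mat set" where
  "mat_span n d A = range (mat_lincomb n d A)"

definition mat_lin_indep :: "nat \<Rightarrow> nat \<Rightarrow> (nat \<Rightarrow> real mat) \<Rightarrow> bool" where
  "mat_lin_indep n d A \<longleftrightarrow>
     (\<forall>c. mat_lincomb n d A c = 0\<^sub>m n n \<longrightarrow> (\<forall>i<d. c i = 0))"

text \<open>The matrix \<open>A(y)\<close> over \<open>\<real>[y]\<close>.\<close>

definition pencil :: "nat \<Rightarrow> nat \<Rightarrow> (nat \<Rightarrow> real mat) \<Rightarrow> rpoly mat" where
  "pencil n d A = mat n n (\<lambda>(k, l). \<Sum>i<d. mvar (Yv i) * mconst (A i $$ (k, l)))"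

text \<open>
  \<open>P(\<lambda>; y) = det (A(y) - \<lambda> id)\<close>, as a univariate polynomial in \<open>\<lambda>\<close> over \<open>\<real>[y]\<close>.
\<close>

definition pencil_char_poly :: "nat \<Rightarrow> nat \<Rightarrow> (nat \<Rightarrow> real mat) \<Rightarrow> rpoly poly" where
  "pencil_char_poly n d A =
     det (map_mat (\<lambda>a. [:a:]) (pencil n d A) - [:0, 1:] \<cdot>\<^sub>m 1\<^sub>m n)"

text \<open>
  The roots are counted in an algebraic closure of the fraction field of \<^typ>\<open>rpoly\<close>.  This field
  contains \<open>\<real>(y)\<close>, hence an algebraic closure of \<open>\<real>(y)\<close>, in which all the roots lie.
\<close>

definition distinct_eigenvalues :: "nat \<Rightarrow> nat \<Rightarrow> (nat \<Rightarrow> real mat) \<Rightarrow> bool" where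
  "distinct_eigenvalues n d A \<longleftrightarrow>
     card {t :: rpoly fract alg_closure.
        poly (map_poly (\<lambda>c. to_ac (to_fract c)) (pencil_char_poly n d A)) t = 0} = n"


section \<open>The implicitization procedure\<close>

abbreviation Qyl :: "nat \<Rightarrow> nat \<Rightarrow> rpoly ring" where
  "Qyl n d \<equiv> mpoly_ring \<rat> (yvars d \<union> lvars n)"

abbreviation RX :: "nat \<Rightarrow> rpoly ring" where
  "RX n \<equiv> mpoly_ring UNIV (xvars n)"

abbreviation RylzX :: "nat \<Rightarrow> nat \<Rightarrow> rpoly ring" where
  "RylzX n d \<equiv> mpoly_ring UNIV (yvars d \<union> lvars n \<union> zvars n \<union> xvars n)"

definition elem_sym :: "nat \<Rightarrow> nat \<Rightarrow> rpoly" where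
  "elem_sym n t = (\<Sum>S | S \<subseteq> {..<n} \<and> card S = t. \<Prod>i\<in>S. mvar (Lv i))"

definition E1' :: "nat \<Rightarrow> nat \<Rightarrow> (nat \<Rightarrow> real mat) \<Rightarrow> rpoly set" where
  "E1' n d A = (\<lambda>i. (- 1) ^ i * elem_sym n (n - i) - coeff (pencil_char_poly n d A) i) ` {..<n}"

definition \<phi>_factor :: "nat \<Rightarrow> nat \<Rightarrow> (nat \<Rightarrow> real mat) \<Rightarrow> nat \<Rightarrow> nat \<Rightarrow> rpoly fract mat" where
  "\<phi>_factor n d A i j =
     (1 / (to_fract (mvar (Lv i)) - to_fract (mvar (Lv j)))) \<cdot>\<^sub>m
       (map_mat to_fract (pencil n d A) - to_fract (mvar (Lv j)) \<cdot>\<^sub>m 1\<^sub>m n)"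

text \<open>
  The factors of each product commute; they are multiplied in increasing order of \<open>j\<close>.
\<close>

definition \<phi> :: "nat \<Rightarrow> nat \<Rightarrow> (nat \<Rightarrow> real mat) \<Rightarrow> rpoly fract mat" where
  "\<phi> n d A = mat n n (\<lambda>(k, l). \<Sum>i<n. to_fract (mvar (Zv i)) *
     foldr (\<lambda>j M. \<phi>_factor n d A i j * M) (filter (\<lambda>j. j \<noteq> i) [0..<n]) (1\<^sub>m n) $$ (k, l))"

definition X_mat :: "nat \<Rightarrow> rpoly mat" where
  "X_mat n = mat n n (\<lambda>(k, l). mvar (Xv (min k l) (max k l)))"

definition \<phi>_minus_X_entries :: "nat \<Rightarrow> nat \<Rightarrow> (nat \<Rightarrow> real mat) \<Rightarrow> rpoly fract set" where
  "\<phi>_minus_X_entries n d A = elements_mat (\<phi> n d A - map_mat to_fract (X_mat n))"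

definition E2 :: "nat \<Rightarrow> nat \<Rightarrow> (nat \<Rightarrow> real mat) \<Rightarrow> rpoly \<Rightarrow> rpoly set" where
  "E2 n d A D = {p. \<exists>f \<in> \<phi>_minus_X_entries n d A. to_fract p = to_fract D * f}"

text \<open>\<open>P\<close> is the chosen prime ideal of \<open>\<rat>[y, \<lambda>]\<close>.\<close>

definition E3 :: "nat \<Rightarrow> rpoly set \<Rightarrow> rpoly set" where
  "E3 n P = {(\<Prod>i<n. mvar (Zv i) ^ \<alpha> i) - (\<Prod>i<n. mvar (Zv i) ^ \<beta> i) | \<alpha> \<beta> :: nat \<Rightarrow> nat.
     (\<Sum>i<n. of_nat (\<alpha> i) * mvar (Lv i)) - (\<Sum>j<n. of_nat (\<beta> j) * mvar (Lv j)) \<in> P}"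

text \<open>
  \<open>E1\<close> and \<open>D\<close> are an admissible choice of generators in step 2 and of a least common denominator
  in step 3.
\<close>

definition implicitization_choice ::
    "nat \<Rightarrow> nat \<Rightarrow> (nat \<Rightarrow> real mat) \<Rightarrow> rpoly set \<Rightarrow> rpoly \<Rightarrow> bool" where
  "implicitization_choice n d A E1 D \<longleftrightarrow>
     E1 \<subseteq> carrier (Qyl n d) \<and>
     associated_prime (Qyl n d) (Idl\<^bsub>Qyl n d\<^esub> (E1' n d A)) (Idl\<^bsub>Qyl n d\<^esub> E1) \<and>
     least_common_denominator (\<phi>_minus_X_entries n d A) D"

definition ideal_I :: "nat \<Rightarrow> nat \<Rightarrow> (nat \<Rightarrow> real mat) \<Rightarrow> rpoly set \<Rightarrow> rpoly \<Rightarrow> rpoly set" where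
  "ideal_I n d A E1 D = saturation (RylzX n d)
     (Idl\<^bsub>RylzX n d\<^esub> (E1 \<union> E2 n d A D \<union> E3 n (Idl\<^bsub>Qyl n d\<^esub> E1))) D"

definition ideal_J :: "nat \<Rightarrow> nat \<Rightarrow> (nat \<Rightarrow> real mat) \<Rightarrow> rpoly set \<Rightarrow> rpoly \<Rightarrow> rpoly set" where
  "ideal_J n d A E1 D = ideal_I n d A E1 D \<inter> carrier (RX n)"

end

theory Submission
  imports
    Defs
    "Jordan_Normal_Form.Char_Poly"
    "HOL-Analysis.Analysis"
begin

text \<open>
  For symmetric \<open>A(y)\<close> with distinct eigenvalues \<open>\<lambda>\<^sub>i\<close> and spectral projectors \<open>P\<^sub>i\<close>, \<open>exp A(y) = \<Sum> e\<^bsup>\<lambda>\<^sub>i\<^esup> P\<^sub>i\<close>.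
  On the ray through \<open>y\<close> a polynomial \<open>f(exp A(ty))\<close> is an exponential sum in \<open>t\<close>; so \<open>f\<close> vanishes on
  the Gibbs variety if and only if, for generic \<open>y\<close>, \<open>f(\<Sum> z\<^sub>i P\<^sub>i)\<close> lies in the ideal of the binomials
  \<open>z\<^sup>\<alpha> - z\<^sup>\<beta>\<close> given by the integer relations between the \<open>\<lambda>\<^sub>i\<close>.

  A polynomial in \<open>y, \<lambda>\<close> whose value at the real points of \<open>E1'\<close> does not depend on the ordering of the
  eigenvalues is a polynomial in \<open>y\<close> modulo \<open>E1'\<close>.  In particular \<open>E1'\<close> generates the vanishing ideal \<open>I\<close>
  of its real points, over \<open>\<rat>\<close> as well as over \<open>\<real>\<close>, and \<open>P = (I : f0)\<close> consists of the polynomials that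
  vanish where \<open>f0\<close> does not.  With the description above this gives \<open>J\<close>.  Unirationality comes from
  the norm of a torus: products over all orderings of the eigenvalues descend to rational
  functions of \<open>y\<close>.  Irreducibility and primality follow from it.
\<close>

section \<open>Evaluation of multivariate polynomials\<close>

text \<open>No splitting field of the characteristic polynomial is used. The generic matrix is
  replaced by the real points at which the eigenvalues are real and distinct, and the symmetric
  group stands in for an unknown Galois group: relations between the eigenvalues may hold for some
  orderings only, and the prime P singles out a class of orderings. Generic statements therefore
  read "some ordering satisfies", and a polynomial \<open>f0\<close> marks the good ones.

  For fixed eigenvalues with \<open>N * \<lambda>\<^sub>i = \<Sum> \<nu>\<^sub>k\<^sub>i *
  \<lambda>\<^sub>k\<close> the admissible z form a torus, parametrised by the monomials with
  exponents \<open>\<nu>\<^sub>k\<^sub>i\<close> in free weights \<open>w\<^sub>k\<close>. Orderings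
  permute these parametrisations, so over the field \<real>(y) the torus is twisted. This is why a
  norm appears: each ordering gets its own weights, and the product over all orderings is symmetric.

  P is prime over \<rat> only and may generate a non-prime ideal over \<real>, where J is formed.
  The argument over \<real> rests on the colon description of P, which, unlike primality, survives
  the extension of coefficients.\<close>

abbreviation "monval \<equiv> (\<lambda>a m. \<Prod>v\<in>Poly_Mapping.keys m. a v ^ Poly_Mapping.lookup m v)"

text \<open>Substitution along a coefficient map \<open>h\<close>: values at a point, permutations
  of the variables and the passage to complex coefficients are all instances.\<close>

definition mhom :: "('a::comm_ring_1 \<Rightarrow> 'b::comm_ring_1) \<Rightarrow> ('v \<Rightarrow> 'b) \<Rightarrow> ('v, 'a) mpoly \<Rightarrow> 'b" where
  "mhom h a p = (\<Sum>m\<in>Poly_Mapping.keys p. h (Poly_Mapping.lookup p m) * monval a m)"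

lemma meval_eq_mhom: "meval a p = mhom (\<lambda>x. x) a p"
  by (simp add: meval_def mhom_def)

lemma mon_superset:
  assumes "finite S" "Poly_Mapping.keys m \<subseteq> S"
  shows "monval a m = (\<Prod>v\<in>S. a v ^ Poly_Mapping.lookup m v)"
  by (rule prod.mono_neutral_left) (use assms in \<open>auto simp: in_keys_iff\<close>)

lemma mon_add:
  fixes m m' :: "'v \<Rightarrow>\<^sub>0 nat" and a :: "'v \<Rightarrow> 'a::comm_ring_1"
  shows "monval a (m + m') = monval a m * monval a m'"
proof -
  let ?S = "Poly_Mapping.keys m \<union> Poly_Mapping.keys m'"
  have "monval a (m + m') = (\<Prod>v\<in>?S. a v ^ Poly_Mapping.lookup (m + m') v)"
    by (rule mon_superset) (auto simp: keys_add)
  also have "\<dots> = (\<Prod>v\<in>?S. a v ^ Poly_Mapping.lookup m v) * (\<Prod>v\<in>?S. a v ^ Poly_Mapping.lookup m' v)"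
    by (simp add: lookup_add power_add prod.distrib)
  also have "\<dots> = monval a m * monval a m'"
    by (subst (1 2) mon_superset[where S = ?S]) auto
  finally show ?thesis .
qed

lemma poly_mapping_sum_single:
  "p = (\<Sum>m\<in>Poly_Mapping.keys p. Poly_Mapping.single m (Poly_Mapping.lookup p m))"
proof (rule poly_mapping_eqI)
  fix k
  show "Poly_Mapping.lookup p k =
    Poly_Mapping.lookup (\<Sum>m\<in>Poly_Mapping.keys p. Poly_Mapping.single m (Poly_Mapping.lookup p m)) k"
  proof (cases "k \<in> Poly_Mapping.keys p")
    case True
    then show ?thesis by (simp add: lookup_sum lookup_single "when_def" sum.delta)
  next
    case False
    then show ?thesis
      by (auto simp: lookup_sum lookup_single "when_def" in_keys_iff intro!: sum.neutral[symmetric])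
  qed
qed

lemma mult_sum_single:
  fixes p q :: "('v, 'a::comm_ring_1) mpoly"
  shows "p * q = (\<Sum>m\<in>Poly_Mapping.keys p. \<Sum>m'\<in>Poly_Mapping.keys q.
    Poly_Mapping.single (m + m') (Poly_Mapping.lookup p m * Poly_Mapping.lookup q m'))"
  by (subst poly_mapping_sum_single[of p], subst poly_mapping_sum_single[of q])
     (simp add: sum_product mult_single)

context comm_ring_hom
begin

lemma mhom_superset:
  assumes "finite S" "Poly_Mapping.keys p \<subseteq> S"
  shows "mhom hom a p = (\<Sum>m\<in>S. hom (Poly_Mapping.lookup p m) * monval a m)"
  unfolding mhom_def
  by (rule sum.mono_neutral_left) (use assms in \<open>auto simp: in_keys_iff\<close>)

lemma mhom_zero: "mhom hom a 0 = 0"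
  by (simp add: mhom_def)

lemma mhom_add: "mhom hom a (p + q) = mhom hom a p + mhom hom a q"
proof -
  let ?S = "Poly_Mapping.keys p \<union> Poly_Mapping.keys q"
  have k: "Poly_Mapping.keys (p + q) \<subseteq> ?S" by (rule keys_add)
  show ?thesis
    by (subst (1 2 3) mhom_superset[where S = ?S])
       (use k in \<open>auto simp: lookup_add hom_add algebra_simps sum.distrib\<close>)
qed

lemma mhom_sum: "mhom hom a (sum f S) = (\<Sum>x\<in>S. mhom hom a (f x))"
  by (induct S rule: infinite_finite_induct) (auto simp: mhom_add mhom_zero)

lemma mhom_single: "mhom hom a (Poly_Mapping.single m c) = hom c * monval a m"
  by (subst mhom_superset[where S = "{m}"]) auto

lemma mhom_mult: "mhom hom a (p * q) = mhom hom a p * mhom hom a q"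
proof -
  have "mhom hom a (p * q) = (\<Sum>m\<in>Poly_Mapping.keys p. \<Sum>m'\<in>Poly_Mapping.keys q.
     (hom (Poly_Mapping.lookup p m) * monval a m) * (hom (Poly_Mapping.lookup q m') * monval a m'))"
    by (subst mult_sum_single) (simp add: mhom_sum mhom_single hom_mult mon_add ac_simps)
  then show ?thesis
    by (simp add: mhom_def sum_product)
qed

lemma mhom_mconst [simp]: "mhom hom a (mconst c) = hom c"
  by (simp add: mconst_def mhom_single)

lemma mhom_mvar [simp]: "mhom hom a (mvar v) = a v"
  by (simp add: mvar_def mhom_single)

lemma mhom_hom: "comm_ring_hom (mhom hom a)"
proof -
  have "mhom hom a (1 :: ('c, 'a) mpoly) = 1" for a :: "'c \<Rightarrow> 'b"
    using mhom_mconst[of a 1] by (simp add: mconst_def)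
  then show ?thesis
    by unfold_locales (simp_all add: mhom_zero mhom_add mhom_mult)
qed

lemma hom_mhom:
  assumes "comm_ring_hom g"
  shows "g (mhom hom a p) = mhom (\<lambda>c. g (hom c)) (\<lambda>v. g (a v)) p"
proof -
  interpret g: comm_ring_hom g by fact
  show ?thesis by (simp add: mhom_def g.hom_sum g.hom_mult g.hom_prod g.hom_power)
qed

end

lemma comm_ring_hom_id: "comm_ring_hom (\<lambda>x::'a::comm_ring_1. x)"
  by unfold_locales auto

lemma comm_ring_hom_meval: "comm_ring_hom (meval a)"
  using comm_ring_hom.mhom_hom[OF comm_ring_hom_id, of a]
  by (simp add: meval_eq_mhom[abs_def])

interpretation meval: comm_ring_hom "meval a" for a :: "'v \<Rightarrow> 'a::comm_ring_1"
  by (rule comm_ring_hom_meval)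

lemma comm_ring_hom_mconst: "comm_ring_hom (mconst :: 'a::comm_ring_1 \<Rightarrow> ('v, 'a) mpoly)"
  by unfold_locales (auto simp: mconst_def single_add mult_single)

interpretation mconst: comm_ring_hom "mconst :: 'a::comm_ring_1 \<Rightarrow> ('v, 'a) mpoly"
  by (rule comm_ring_hom_mconst)

lemma meval_mconst [simp]: "meval a (mconst c) = (c :: 'a::comm_ring_1)"
  by (simp add: meval_eq_mhom comm_ring_hom.mhom_mconst[OF comm_ring_hom_id])

lemma meval_mvar [simp]: "meval a (mvar v) = (a v :: 'a::comm_ring_1)"
  by (simp add: meval_eq_mhom comm_ring_hom.mhom_mvar[OF comm_ring_hom_id])

lemma single_power: "Poly_Mapping.single v (1::nat) = s \<Longrightarrow>
  Poly_Mapping.single s (1::'a::comm_ring_1) ^ k = Poly_Mapping.single (Poly_Mapping.single v k) 1"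
  by (induct k) (auto simp: mult_single simp flip: single_add)

lemma mon_mvar: "monval (mvar :: 'v \<Rightarrow> ('v, 'a::comm_ring_1) mpoly) m = Poly_Mapping.single m 1"
proof -
  have *: "(\<Prod>v\<in>S. mvar v ^ Poly_Mapping.lookup m v) =
      Poly_Mapping.single (\<Sum>v\<in>S. Poly_Mapping.single v (Poly_Mapping.lookup m v)) (1::'a)"
    if "finite S" for S
    using that
    by (induct S) (auto simp: mvar_def single_power[OF refl, unfolded One_nat_def] mult_single)
  show ?thesis
    by (subst *) (auto simp flip: poly_mapping_sum_single)
qed

lemma mpoly_expand: "p = (\<Sum>m\<in>Poly_Mapping.keys p. mconst (Poly_Mapping.lookup p m) * monval mvar m)"
  for p :: "('v, 'a::comm_ring_1) mpoly"
  by (subst poly_mapping_sum_single[of p]) (simp add: mon_mvar mconst_def mult_single)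

lemma mhom_mconst_mvar: "mhom mconst mvar p = p"
  unfolding mhom_def by (rule mpoly_expand[symmetric])

lemma mhom_cong:
  assumes "\<And>v. v \<in> mvars p \<Longrightarrow> a v = b v"
  shows "mhom h a p = mhom h b p"
  unfolding mhom_def
proof (rule sum.cong[OF refl])
  fix m assume m: "m \<in> Poly_Mapping.keys p"
  have "monval a m = monval b m"
  proof (rule prod.cong[OF refl])
    fix v assume "v \<in> Poly_Mapping.keys m"
    then have "a v = b v" using m assms unfolding mvars_def by blast
    then show "a v ^ Poly_Mapping.lookup m v = b v ^ Poly_Mapping.lookup m v" by simp
  qed
  then show "h (Poly_Mapping.lookup p m) * monval a m = h (Poly_Mapping.lookup p m) * monval b m" by simp
qed

lemma meval_cong: "(\<And>v. v \<in> mvars p \<Longrightarrow> a v = b v) \<Longrightarrow> meval a p = meval b p"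
  for p :: "('v, 'a::comm_ring_1) mpoly"
  unfolding meval_eq_mhom by (rule mhom_cong)

lemma meval_mhom_mconst: "meval a (mhom mconst b p) = meval (\<lambda>v. meval a (b v)) p"
  for p :: "('v, 'a::comm_ring_1) mpoly"
  using mconst.hom_mhom[OF comm_ring_hom_meval, of a b p] meval_mconst[of a]
  by (simp add: meval_eq_mhom)


section \<open>Subrings and ideals\<close>

definition subring_set :: "'a::comm_ring_1 set \<Rightarrow> bool" where
  "subring_set K \<longleftrightarrow> 0 \<in> K \<and> 1 \<in> K \<and> (\<forall>x\<in>K. - x \<in> K) \<and> (\<forall>x\<in>K. \<forall>y\<in>K. x + y \<in> K \<and> x * y \<in> K)"

lemma subring_setD:
  assumes "subring_set K"
  shows "0 \<in> K" "1 \<in> K" "x \<in> K \<Longrightarrow> - x \<in> K" "x \<in> K \<Longrightarrow> y \<in> K \<Longrightarrow> x + y \<in> K"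
    "x \<in> K \<Longrightarrow> y \<in> K \<Longrightarrow> x - y \<in> K" "x \<in> K \<Longrightarrow> y \<in> K \<Longrightarrow> x * y \<in> K" "x \<in> K \<Longrightarrow> x ^ k \<in> K"
    "(\<And>i. i \<in> S \<Longrightarrow> f i \<in> K) \<Longrightarrow> sum f S \<in> K" "(\<And>i. i \<in> S \<Longrightarrow> f i \<in> K) \<Longrightarrow> prod f S \<in> K"
    "of_nat k \<in> K" "of_int i \<in> K"
proof -
  note [simp] = assms[unfolded subring_set_def]
  show "0 \<in> K" "1 \<in> K" "x \<in> K \<Longrightarrow> - x \<in> K" "x \<in> K \<Longrightarrow> y \<in> K \<Longrightarrow> x + y \<in> K" "x \<in> K \<Longrightarrow> y \<in> K \<Longrightarrow> x * y \<in> K"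
    by auto
  then show "x \<in> K \<Longrightarrow> y \<in> K \<Longrightarrow> x - y \<in> K" using assms unfolding subring_set_def by (metis diff_conv_add_uminus)
  show "x \<in> K \<Longrightarrow> x ^ k \<in> K" by (induct k) auto
  show "(\<And>i. i \<in> S \<Longrightarrow> f i \<in> K) \<Longrightarrow> sum f S \<in> K" by (induct S rule: infinite_finite_induct) auto
  show "(\<And>i. i \<in> S \<Longrightarrow> f i \<in> K) \<Longrightarrow> prod f S \<in> K" by (induct S rule: infinite_finite_induct) auto
  show n: "of_nat k \<in> K" for k by (induct k) auto
  show "of_int i \<in> K" by (cases i) (use n in \<open>auto simp del: of_nat_Suc\<close>)
qed

lemma subring_set_UNIV [simp]: "subring_set UNIV"
  by (simp add: subring_set_def)

lemma subring_set_Rats [simp]: "subring_set (\<rat> :: real set)"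
  by (simp add: subring_set_def)

abbreviation mpolys :: "'a::comm_ring_1 set \<Rightarrow> 'v set \<Rightarrow> ('v, 'a) mpoly set" where
  "mpolys K V \<equiv> carrier (mpoly_ring K V)"

lemma mpolys_iff: "p \<in> mpolys K V \<longleftrightarrow> mvars p \<subseteq> V \<and> (\<forall>m. Poly_Mapping.lookup p m \<in> K)"
  by (simp add: mpoly_ring_def)

lemma mpolys_mono: "p \<in> mpolys K V \<Longrightarrow> K \<subseteq> K' \<Longrightarrow> V \<subseteq> V' \<Longrightarrow> p \<in> mpolys K' V'"
  by (auto simp: mpolys_iff)

lemma mvars_add: "mvars (p + q) \<subseteq> mvars p \<union> mvars q"
  using keys_add[of p q] unfolding mvars_def by blast

lemma mvars_mult: "mvars (p * q) \<subseteq> mvars p \<union> mvars q"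
  for p q :: "('v, 'a::comm_ring_1) mpoly"
proof
  fix v assume "v \<in> mvars (p * q)"
  then obtain m where "m \<in> Poly_Mapping.keys (p * q)" and v: "v \<in> Poly_Mapping.keys m"
    by (auto simp: mvars_def)
  then obtain b c where "m = b + c" "b \<in> Poly_Mapping.keys p" "c \<in> Poly_Mapping.keys q"
    using keys_mult[of p q] by blast
  with v show "v \<in> mvars p \<union> mvars q"
    using keys_add[of b c] by (auto simp: mvars_def)
qed

lemma mconst_mpolys [simp]: "subring_set K \<Longrightarrow> c \<in> K \<Longrightarrow> mconst c \<in> mpolys K V"
  by (auto simp: mpolys_iff mconst_def mvars_def lookup_single "when_def" subring_setD)

lemma mvar_mpolys [simp]: "subring_set K \<Longrightarrow> v \<in> V \<Longrightarrow> mvar v \<in> mpolys K V"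
  by (auto simp: mpolys_iff mvar_def mvars_def lookup_single "when_def" subring_setD)

lemma subring_set_mpolys [simp]:
  assumes "subring_set K"
  shows "subring_set (mpolys K V)"
  unfolding subring_set_def
proof (intro conjI ballI)
  show "0 \<in> mpolys K V" using assms by (simp add: mpolys_iff mvars_def subring_setD)
  show "1 \<in> mpolys K V" using mconst_mpolys[OF assms, of 1] assms by (simp add: subring_setD)
next
  fix x assume "x \<in> mpolys K V"
  then show "- x \<in> mpolys K V" using assms by (simp add: mpolys_iff mvars_def subring_setD)
next
  fix x y assume x: "x \<in> mpolys K V" and y: "y \<in> mpolys K V"
  then show "x + y \<in> mpolys K V"
    using mvars_add[of x y] assms by (auto simp: mpolys_iff lookup_add subring_setD)
  have "Poly_Mapping.lookup (x * y) m \<in> K" for m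
    unfolding mult_sum_single[of x y] lookup_sum lookup_single
    by (intro subring_setD(8)[OF assms])
       (use x y assms in \<open>auto simp: mpolys_iff "when_def" subring_setD\<close>)
  then show "x * y \<in> mpolys K V"
    using mvars_mult[of x y] x y by (auto simp: mpolys_iff)
qed

lemmas mpolys_closed = subring_setD[OF subring_set_mpolys]

lemma mpolys_induct [consumes 2, case_names const var add mult]:
  assumes p: "p \<in> mpolys K V" and K: "subring_set K"
    and const: "\<And>c. c \<in> K \<Longrightarrow> Q (mconst c)"
    and var: "\<And>v. v \<in> V \<Longrightarrow> Q (mvar v)"
    and add: "\<And>p q. p \<in> mpolys K V \<Longrightarrow> q \<in> mpolys K V \<Longrightarrow> Q p \<Longrightarrow> Q q \<Longrightarrow> Q (p + q)"
    and mult: "\<And>p q. p \<in> mpolys K V \<Longrightarrow> q \<in> mpolys K V \<Longrightarrow> Q p \<Longrightarrow> Q q \<Longrightarrow> Q (p * q)"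
  shows "Q p"
proof -
  let ?Q = "\<lambda>p. p \<in> mpolys K V \<and> Q p"
  have 0: "?Q 0" using const[of 0] K by (simp add: mpolys_closed subring_setD)
  have 1: "?Q 1" using const[of 1] K by (simp add: mpolys_closed subring_setD)
  have sum: "?Q (sum f S)" if "\<And>i. i \<in> S \<Longrightarrow> ?Q (f i)" for f :: "('a \<Rightarrow>\<^sub>0 nat) \<Rightarrow> _" and S
    using that by (induct S rule: infinite_finite_induct) (auto simp: 0 add mpolys_closed[OF K])
  have power: "?Q (x ^ k)" if "?Q x" for x k
    using that by (induct k) (auto simp: 1 mult mpolys_closed[OF K])
  have prod: "?Q (prod f S)" if "\<And>i. i \<in> S \<Longrightarrow> ?Q (f i)" for f :: "'a \<Rightarrow> _" and S
    using that by (induct S rule: infinite_finite_induct) (auto simp: 1 mult mpolys_closed[OF K])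
  have "?Q (\<Sum>m\<in>Poly_Mapping.keys p. mconst (Poly_Mapping.lookup p m) * monval mvar m)"
  proof (rule sum)
    fix m assume m: "m \<in> Poly_Mapping.keys p"
    have "?Q (monval mvar m)"
      by (intro prod power) (use m p K var in \<open>auto simp: mpolys_iff[of p] mvars_def\<close>)
    moreover have "?Q (mconst (Poly_Mapping.lookup p m))"
      using p K const by (auto simp: mpolys_iff[of p])
    ultimately show "?Q (mconst (Poly_Mapping.lookup p m) * monval mvar m)"
      using mult K by (auto simp: mpolys_closed)
  qed
  then show ?thesis by (simp flip: mpoly_expand)
qed

lemma mhom_mpolys:
  assumes p: "p \<in> mpolys K V" and K: "subring_set K" and S: "subring_set S"
    and h: "comm_ring_hom h" "\<And>c. c \<in> K \<Longrightarrow> h c \<in> S" and a: "\<And>v. v \<in> V \<Longrightarrow> a v \<in> S"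
  shows "mhom h a p \<in> S"
proof -
  interpret h: comm_ring_hom h by fact
  show ?thesis using p K
    by (induct rule: mpolys_induct) (auto simp: h a S subring_setD h.mhom_add h.mhom_mult)
qed

text \<open>\<open>Z\<close> is arbitrary because complex polynomials will be tested at real
  parameters only. One variable is treated at a time, by a univariate polynomial with infinitely
  many zeros.\<close>

lemma meval_zero_imp_zero:
  fixes p :: "('v, 'a::idom) mpoly"
  assumes Z: "infinite Z" and p: "\<And>a. range a \<subseteq> Z \<Longrightarrow> meval a p = 0"
  shows "p = 0"
proof -
  obtain z0 where z0: "z0 \<in> Z" using Z by (metis ex_in_conv finite.emptyI)
  \<comment> \<open>An indexed family of exponents in place of a polynomial: removing the variable
    \<open>w\<close> leaves the indices with one fixed power of \<open>w\<close>, and these are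
    still separated by the other variables.\<close>
  have main: "\<forall>i\<in>M. c i = 0"
    if "finite V" "finite M" "\<And>i j. i \<in> M \<Longrightarrow> j \<in> M \<Longrightarrow> (\<forall>v\<in>V. e i v = e j v) \<Longrightarrow> i = j"
      "\<And>a. range a \<subseteq> Z \<Longrightarrow> (\<Sum>i\<in>M. c i * (\<Prod>v\<in>V. a v ^ e i v)) = 0"
    for V :: "'v set" and M :: "('v \<Rightarrow>\<^sub>0 nat) set" and e :: "_ \<Rightarrow> 'v \<Rightarrow> nat" and c :: "_ \<Rightarrow> 'a"
    using that
  proof (induct V arbitrary: M c rule: finite_induct)
    case empty
    show ?case
    proof
      fix i assume i: "i \<in> M"
      have "M = {i}" using empty(2) i by auto
      moreover have "(\<Sum>i\<in>M. c i * (\<Prod>v\<in>{}. z0 ^ e i v)) = 0"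
        using empty(3)[of "\<lambda>_. z0"] z0 by auto
      ultimately show "c i = 0" by simp
    qed
  next
    case (insert w V)
    show ?case
    proof
      fix i0 assume i0: "i0 \<in> M"
      let ?M = "{i\<in>M. e i w = e i0 w}"
      have "\<forall>i\<in>?M. c i = 0"
      proof (rule insert.hyps(3))
        show "finite ?M" using insert.prems(1) by simp
        show "i = j" if "i \<in> ?M" "j \<in> ?M" "\<forall>v\<in>V. e i v = e j v" for i j
          using that insert.prems(2)[of i j] by auto
        fix a :: "'v \<Rightarrow> 'a" assume a: "range a \<subseteq> Z"
        define P where "P = (\<Sum>i\<in>M. Polynomial.monom (c i * (\<Prod>v\<in>V. a v ^ e i v)) (e i w))"
        have "poly P t = 0" if t: "t \<in> Z" for t
        proof -
          have "(\<Sum>i\<in>M. c i * (\<Prod>v\<in>insert w V. (a(w := t)) v ^ e i v)) = 0"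
            by (rule insert.prems(3)) (use a t in auto)
          moreover have "(\<Prod>v\<in>V. (a(w := t)) v ^ e i v) = (\<Prod>v\<in>V. a v ^ e i v)" for i
            by (rule prod.cong) (use insert.hyps(2) in auto)
          ultimately show ?thesis
            using insert.hyps(1,2) by (simp add: P_def poly_sum poly_monom ac_simps)
        qed
        then have "P = 0"
          using poly_roots_finite[of P] Z by (metis (mono_tags, lifting) finite_subset mem_Collect_eq subsetI)
        then have "coeff P (e i0 w) = 0" by simp
        then have "(\<Sum>i\<in>M. if e i w = e i0 w then c i * (\<Prod>v\<in>V. a v ^ e i v) else 0) = 0"
          by (simp add: P_def coeff_sum)
        then show "(\<Sum>i\<in>?M. c i * (\<Prod>v\<in>V. a v ^ e i v)) = 0"
          by (simp add: sum.inter_filter insert.prems(1))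
      qed
      then show "c i0 = 0" using i0 by simp
    qed
  qed
  have "finite (mvars p)" by (simp add: mvars_def)
  have "\<forall>m\<in>Poly_Mapping.keys p. Poly_Mapping.lookup p m = 0"
  proof (rule main[where V = "mvars p" and e = Poly_Mapping.lookup])
    show "finite (mvars p)" by fact
    show "m = m'" if mm: "m \<in> Poly_Mapping.keys p" "m' \<in> Poly_Mapping.keys p"
      "\<forall>v\<in>mvars p. Poly_Mapping.lookup m v = Poly_Mapping.lookup m' v" for m m'
    proof (rule poly_mapping_eqI)
      fix v
      show "Poly_Mapping.lookup m v = Poly_Mapping.lookup m' v"
      proof (cases "v \<in> mvars p")
        case False
        with mm(1,2) show ?thesis by (auto simp: mvars_def in_keys_iff)
      qed (use mm(3) in auto)
    qed
    fix a :: "'v \<Rightarrow> 'a" assume "range a \<subseteq> Z"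
    then have "meval a p = 0" by (rule p)
    moreover have "monval a m = (\<Prod>v\<in>mvars p. a v ^ Poly_Mapping.lookup m v)"
      if "m \<in> Poly_Mapping.keys p" for m
      by (rule mon_superset) (use that \<open>finite (mvars p)\<close> in \<open>auto simp: mvars_def\<close>)
    ultimately show "(\<Sum>m\<in>Poly_Mapping.keys p. Poly_Mapping.lookup p m *
        (\<Prod>v\<in>mvars p. a v ^ Poly_Mapping.lookup m v)) = 0"
      by (simp add: meval_def cong: sum.cong)
  qed simp
  then show ?thesis by (intro poly_mapping_eqI) (auto simp: in_keys_iff)
qed

text \<open>The rings over \<rat> and over \<real> are subsets \<open>S\<close> of one type, so a
  generated ideal is built with multipliers from \<open>S\<close>, one product at a time.
  Homomorphisms and \<rat>-linear coefficient maps then pass through it by induction.\<close>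

inductive_set idl :: "'a::comm_ring_1 set \<Rightarrow> 'a set \<Rightarrow> 'a set" for S E where
  zero: "0 \<in> idl S E"
| step: "x \<in> idl S E \<Longrightarrow> r \<in> S \<Longrightarrow> e \<in> E \<Longrightarrow> x + r * e \<in> idl S E"

text \<open>\<open>I\<close> may reach beyond \<open>S\<close>: an ideal of a larger ring counts as
  a submodule over \<open>S\<close>, which is how ideals of \<rat>[y, \<lambda>] are compared with
  ideals in all variables.\<close>

definition ideal_set :: "'a::comm_ring_1 set \<Rightarrow> 'a set \<Rightarrow> bool" where
  "ideal_set S I \<longleftrightarrow> 0 \<in> I \<and> (\<forall>x\<in>I. \<forall>y\<in>I. x + y \<in> I) \<and> (\<forall>r\<in>S. \<forall>x\<in>I. r * x \<in> I)"

lemma ideal_setD: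
  assumes "ideal_set S I"
  shows "0 \<in> I" "x \<in> I \<Longrightarrow> y \<in> I \<Longrightarrow> x + y \<in> I" "r \<in> S \<Longrightarrow> x \<in> I \<Longrightarrow> r * x \<in> I"
    "x \<in> I \<Longrightarrow> r \<in> S \<Longrightarrow> x * r \<in> I"
    "(\<And>i. i \<in> T \<Longrightarrow> f i \<in> I) \<Longrightarrow> sum f T \<in> I"
proof -
  show *: "0 \<in> I" "x \<in> I \<Longrightarrow> y \<in> I \<Longrightarrow> x + y \<in> I" "r \<in> S \<Longrightarrow> x \<in> I \<Longrightarrow> r * x \<in> I" for x y
    using assms by (auto simp: ideal_set_def)
  then show "x \<in> I \<Longrightarrow> r \<in> S \<Longrightarrow> x * r \<in> I" by (metis mult.commute)
  show "(\<And>i. i \<in> T \<Longrightarrow> f i \<in> I) \<Longrightarrow> sum f T \<in> I"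
    using * by (induct T rule: infinite_finite_induct) auto
qed

lemma ideal_set_diff:
  assumes "ideal_set S I" "subring_set S" "x \<in> I" "y \<in> I"
  shows "- x \<in> I" "x - y \<in> I"
proof -
  have *: "- x \<in> I" if "x \<in> I" for x
    using ideal_setD(3)[OF assms(1), of "- 1" x] subring_setD(2,3)[OF assms(2)] that by simp
  then show "- x \<in> I" using assms by simp
  show "x - y \<in> I" using ideal_setD(2)[OF assms(1,3) *[OF assms(4)]] by simp
qed

lemma idl_ideal_set:
  assumes S: "subring_set S"
  shows "ideal_set S (idl S E)"
proof -
  have "x + y \<in> idl S E" if "x \<in> idl S E" "y \<in> idl S E" for x y
    using that(2,1)
  proof (induct)
    case (step y r e)
    then show ?case using idl.step[of "x + y" S E r e] by (simp add: add.assoc)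
  qed simp
  moreover have "s * x \<in> idl S E" if "x \<in> idl S E" "s \<in> S" for x s
    using that
  proof (induct)
    case (step x r e)
    then show ?case using idl.step[of "s * x" S E "s * r" e] S
      by (simp add: algebra_simps subring_setD)
  qed (simp add: idl.zero)
  ultimately show ?thesis by (auto simp: ideal_set_def idl.zero)
qed

lemma idl_incl: "subring_set S \<Longrightarrow> e \<in> E \<Longrightarrow> e \<in> idl S E"
  using idl.step[of 0 S E 1 e] by (simp add: idl.zero subring_setD)

lemma idl_least: "ideal_set S I \<Longrightarrow> E \<subseteq> I \<Longrightarrow> x \<in> idl S E \<Longrightarrow> x \<in> I"
  by (erule idl.induct) (auto dest: ideal_setD)

lemma idl_subset: "subring_set S \<Longrightarrow> E \<subseteq> S \<Longrightarrow> x \<in> idl S E \<Longrightarrow> x \<in> S"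
  by (erule idl.induct) (auto simp: subring_setD)

lemma idl_hom_zero:
  assumes "comm_ring_hom g" "\<And>e. e \<in> E \<Longrightarrow> g e = 0" "x \<in> idl S E"
  shows "g x = 0"
proof -
  interpret g: comm_ring_hom g by fact
  show ?thesis using assms(3) by induct (auto simp: assms(2) g.hom_add g.hom_mult)
qed

lemma mpoly_ring_simps [simp]:
  "x \<otimes>\<^bsub>mpoly_ring K V\<^esub> y = x * y" "x \<oplus>\<^bsub>mpoly_ring K V\<^esub> y = x + y"
  "\<zero>\<^bsub>mpoly_ring K V\<^esub> = 0" "\<one>\<^bsub>mpoly_ring K V\<^esub> = 1"
  by (simp_all add: mpoly_ring_def)

lemma cring_mpoly_ring:
  assumes K: "subring_set K"
  shows "cring (mpoly_ring K V)"
proof (rule cringI)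
  show "abelian_group (mpoly_ring K V)"
  proof (rule abelian_groupI)
    fix x assume x: "x \<in> mpolys K V"
    show "\<exists>y\<in>mpolys K V. y \<oplus>\<^bsub>mpoly_ring K V\<^esub> x = \<zero>\<^bsub>mpoly_ring K V\<^esub>"
      by (rule bexI[of _ "- x"]) (use x K in \<open>auto simp: mpolys_closed\<close>)
  qed (auto simp: mpolys_closed[OF K] ac_simps)
  show "Group.comm_monoid (mpoly_ring K V)"
    by (rule Group.comm_monoidI) (auto simp: mpolys_closed[OF K] ac_simps)
qed (auto simp: algebra_simps)

lemma ideal_mpoly_ring_iff:
  assumes K: "subring_set K"
  shows "ideal I (mpoly_ring K V) \<longleftrightarrow> I \<subseteq> mpolys K V \<and> ideal_set (mpolys K V) I"
proof
  interpret cring "mpoly_ring K V" by (rule cring_mpoly_ring[OF K])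
  assume "ideal I (mpoly_ring K V)"
  then interpret I: ideal I "mpoly_ring K V" .
  show "I \<subseteq> mpolys K V \<and> ideal_set (mpolys K V) I"
    using I.a_closed I.I_l_closed I.a_subset I.zero_closed
    by (auto simp: ideal_set_def)
next
  interpret cring "mpoly_ring K V" by (rule cring_mpoly_ring[OF K])
  assume I: "I \<subseteq> mpolys K V \<and> ideal_set (mpolys K V) I"
  note S = subring_set_mpolys[OF K, of V]
  have inv: "\<ominus>\<^bsub>mpoly_ring K V\<^esub> a = - a" if "a \<in> mpolys K V" for a
    using that by (intro minus_equality) (auto simp: mpolys_closed[OF K])
  show "ideal I (mpoly_ring K V)"
  proof (rule idealI)
    show "ring (mpoly_ring K V)" by (rule ring_axioms)
    have neg: "- a \<in> I" if "a \<in> I" for a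
      using ideal_set_diff(1)[OF _ S that that] I by auto
    show "subgroup I (add_monoid (mpoly_ring K V))"
    proof (rule group.subgroupI)
      show "Group.group (add_monoid (mpoly_ring K V))" by (rule add.is_group)
      show "inv\<^bsub>add_monoid (mpoly_ring K V)\<^esub> a \<in> I" if "a \<in> I" for a
        using inv[of a] that I neg[OF that] by (auto simp: a_inv_def)
    qed (use I ideal_setD(1)[of _ I] in \<open>auto simp: ideal_set_def\<close>)
  qed (use I ideal_setD(3,4)[of "mpolys K V" I] in auto)
qed

lemma genideal_mpoly_ring:
  assumes K: "subring_set K" and E: "E \<subseteq> mpolys K V"
  shows "Idl\<^bsub>mpoly_ring K V\<^esub> E = idl (mpolys K V) E"
proof -
  note S = subring_set_mpolys[OF K, of V]
  have "ideal (idl (mpolys K V) E) (mpoly_ring K V)"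
    using idl_subset[OF S E] idl_ideal_set[OF S] by (auto simp: ideal_mpoly_ring_iff[OF K])
  then have "Idl\<^bsub>mpoly_ring K V\<^esub> E \<subseteq> idl (mpolys K V) E"
    unfolding genideal_def using idl_incl[OF S] by auto
  moreover have "idl (mpolys K V) E \<subseteq> I" if "ideal I (mpoly_ring K V)" "E \<subseteq> I" for I
    using idl_least[of _ I E] that by (auto simp: ideal_mpoly_ring_iff[OF K])
  ultimately show ?thesis unfolding genideal_def by auto
qed

section \<open>Families of polynomials with real roots\<close>

interpretation mp_meval: map_poly_comm_ring_hom "meval a" for a :: "'v \<Rightarrow> 'a::comm_ring_1" ..

section \<open>Univariate polynomials with coefficients in a subring or an ideal\<close>

lemma poly_map_meval: "meval a (poly p x) = poly (map_poly (meval a) p) (meval a x)"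
  for a :: "'v \<Rightarrow> 'a::comm_ring_1"
  by simp

lemma poly_coeff_in:
  assumes S: "subring_set S" and p: "\<And>k. coeff p k \<in> S" and x: "x \<in> S"
  shows "poly p x \<in> S"
  unfolding poly_altdef using assms by (auto intro!: subring_setD)

lemma poly_in_ideal:
  assumes S: "subring_set S" and I: "ideal_set S I" and p: "\<And>k. coeff p k \<in> I" and x: "x \<in> S"
  shows "poly p x \<in> I"
  unfolding poly_altdef
  by (intro ideal_setD(5)[OF I] ideal_setD(4)[OF I p] subring_setD(7)[OF S x])

lemma coeff_mult_in:
  assumes S: "subring_set S" and p: "\<And>k. coeff p k \<in> S" and q: "\<And>k. coeff q k \<in> S"
  shows "coeff (p * q) k \<in> S"
  unfolding coeff_mult using assms by (auto intro!: subring_setD)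

lemma coeff_prod_in:
  assumes S: "subring_set S" and p: "\<And>i k. i \<in> T \<Longrightarrow> coeff (p i) k \<in> S"
  shows "coeff (prod p T) k \<in> S"
  using p
proof (induct T arbitrary: k rule: infinite_finite_induct)
  case (insert x F)
  then show ?case using coeff_mult_in[OF S, of "p x" "prod p F"] by simp
qed (auto simp: S subring_setD coeff_1)

text \<open>Meant for coefficients of a polynomial: they vanish from some index on, and each is
  controlled by the next one.\<close>

lemma descending_induct:
  assumes "\<And>k. Q (Suc k) \<Longrightarrow> Q k" "\<And>k. k \<ge> N \<Longrightarrow> Q k"
  shows "Q (k::nat)"
proof -
  have "Q (N - j)" for j
  proof (induct j)
    case (Suc j)
    then show ?case using assms(1)[of "N - Suc j"] by (cases "j < N") (auto simp: Suc_diff_Suc)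
  qed (use assms(2) in auto)
  from this[of "N - k"] show ?thesis using assms(2)[of k] by (cases "k \<le> N") auto
qed

lemma coeff_synthetic_div:
  fixes p :: "'a::comm_ring_1 poly"
  shows "coeff (synthetic_div p c) k = coeff p (Suc k) + c * coeff (synthetic_div p c) (Suc k)"
  using arg_cong[OF synthetic_div_correct[of p c], of "\<lambda>q. coeff q (Suc k)"] by simp

lemma synthetic_div_coeff_in:
  assumes S: "subring_set S" and p: "\<And>k. coeff p k \<in> S" and c: "c \<in> S"
  shows "coeff (synthetic_div p c) k \<in> S"
proof (rule descending_induct[where N = "Suc (degree (synthetic_div p c))"])
  fix k assume "coeff (synthetic_div p c) (Suc k) \<in> S"
  then show "coeff (synthetic_div p c) k \<in> S"
    by (subst coeff_synthetic_div) (use S p c in \<open>auto intro!: subring_setD\<close>)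
qed (use S in \<open>auto simp: coeff_eq_0 subring_setD\<close>)

text \<open>The divisor is monic, so no coefficient is inverted and quotient and remainder stay over
  \<open>S\<close>. The induction lowers a bound on the degree by cancelling the term of index
  \<open>N\<close>.\<close>

lemma monic_division:
  fixes C p :: "'a::comm_ring_1 poly"
  assumes S: "subring_set S" and C: "\<And>k. coeff C k \<in> S" "degree C = m" "coeff C m = 1"
    and p: "\<And>k. coeff p k \<in> S" "\<And>k. k \<ge> N \<Longrightarrow> coeff p k = 0"
  shows "\<exists>q r. p = q * C + r \<and> (\<forall>k. coeff q k \<in> S) \<and> (\<forall>k. coeff r k \<in> S) \<and> (\<forall>k\<ge>m. coeff r k = 0)"
  using p
proof (induct N arbitrary: p)
  case 0
  then have "p = 0" by (intro poly_eqI) simp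
  then show ?case by (intro exI[of _ 0]) (use S in \<open>auto simp: subring_setD\<close>)
next
  case (Suc N)
  show ?case
  proof (cases "N \<ge> m")
    case True
    define M where "M = Polynomial.monom (coeff p N) (N - m)"
    have M: "coeff M k \<in> S" for k using S Suc.prems(1) by (auto simp: M_def subring_setD)
    have 1: "coeff (p - M * C) k \<in> S" for k
      using Suc.prems(1) coeff_mult_in[OF S M C(1)] S by (auto intro!: subring_setD)
    have 2: "coeff (p - M * C) k = 0" if "k \<ge> N" for k
    proof (cases "k = N")
      case True
      then show ?thesis using \<open>N \<ge> m\<close> C(3) by (simp add: M_def coeff_monom_mult)
    next
      case False
      then have "coeff C (k - (N - m)) = 0" using that \<open>N \<ge> m\<close> C(2) by (intro coeff_eq_0) auto
      then show ?thesis using Suc.prems(2)[of k] that False by (simp add: M_def coeff_monom_mult)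
    qed
    obtain q r where "p - M * C = q * C + r" and qr: "\<forall>k. coeff q k \<in> S" "\<forall>k. coeff r k \<in> S" "\<forall>k\<ge>m. coeff r k = 0"
      using Suc.hyps[OF 1 2] by blast
    then have "p = (q + M) * C + r" by (simp add: algebra_simps)
    moreover have "\<forall>k. coeff (q + M) k \<in> S" using qr(1) M S by (auto intro!: subring_setD)
    ultimately show ?thesis using qr by blast
  next
    case False
    then show ?thesis
      by (intro exI[of _ 0] exI[of _ p]) (use S Suc.prems in \<open>auto simp: subring_setD\<close>)
  qed
qed

lemma mpoly_as_poly_in_var:
  assumes K: "subring_set K" and p: "p \<in> mpolys K (insert v V)"
  shows "\<exists>q. (\<forall>k. coeff q k \<in> mpolys K V) \<and> poly q (mvar v) = p"
  using p K
proof (induct rule: mpolys_induct)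
  case (const c)
  then show ?case
    by (intro exI[of _ "[:mconst c:]"]) (auto simp: coeff_pCons K mpolys_closed split: nat.splits)
next
  case (var w)
  show ?case
  proof (cases "w = v")
    case True
    then show ?thesis
      by (intro exI[of _ "[:0, 1:]"]) (auto simp: coeff_pCons K mpolys_closed split: nat.splits)
  next
    case False
    with var show ?thesis
      by (intro exI[of _ "[:mvar w:]"]) (auto simp: coeff_pCons K mpolys_closed split: nat.splits)
  qed
next
  case (add p q)
  then obtain p' q' where "\<forall>k. coeff p' k \<in> mpolys K V" "poly p' (mvar v) = p"
    "\<forall>k. coeff q' k \<in> mpolys K V" "poly q' (mvar v) = q" by blast
  then show ?case
    by (intro exI[of _ "p' + q'"]) (auto simp: mpolys_closed K)
next
  case (mult p q)
  then obtain p' q' where "\<forall>k. coeff p' k \<in> mpolys K V" "poly p' (mvar v) = p"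
    "\<forall>k. coeff q' k \<in> mpolys K V" "poly q' (mvar v) = q" by blast
  then show ?case
    by (intro exI[of _ "p' * q'"]) (auto intro!: coeff_mult_in simp: K)
qed

section \<open>Real points over the locus where \<open>h\<close> is nonzero, and the reordering of
  their eigenvalues\<close>

definition pts :: "nat \<Rightarrow> rpoly poly \<Rightarrow> rpoly \<Rightarrow> (var \<Rightarrow> real) set" where
  "pts n C h = {a. meval a h \<noteq> 0 \<and> inj_on (\<lambda>i. a (Lv i)) {..<n} \<and>
     map_poly (meval a) C = (\<Prod>i<n. [:- a (Lv i), 1:])}"

definition reorder :: "(nat \<Rightarrow> nat) \<Rightarrow> (var \<Rightarrow> 'a) \<Rightarrow> var \<Rightarrow> 'a" where
  "reorder \<sigma> a v = (case v of Lv i \<Rightarrow> a (Lv (\<sigma> i)) | _ \<Rightarrow> a v)"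

lemma reorder_simps [simp]:
  "reorder \<sigma> a (Lv i) = a (Lv (\<sigma> i))" "reorder \<sigma> a (Yv i) = a (Yv i)"
  "reorder \<sigma> a (Zv i) = a (Zv i)" "reorder \<sigma> a (Xv i j) = a (Xv i j)"
  by (simp_all add: reorder_def)

text \<open>Permutations act on points from the right; a product over all orderings of
  \<open>reorder \<tau> a\<close> is therefore reindexed by left multiplication with \<tau>.\<close>

lemma reorder_reorder: "reorder \<sigma> (reorder \<tau> a) = reorder (\<tau> \<circ> \<sigma>) a"
  by (auto simp: reorder_def fun_eq_iff split: var.splits)

lemma reorder_off:
  assumes "\<sigma> permutes {..<n}" "v \<notin> lvars n"
  shows "reorder \<sigma> a v = a v"
proof (cases v)
  case (Lv i)
  then have "i \<notin> {..<n}" using assms(2) by (auto simp: lvars_def)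
  then show ?thesis using Lv permutes_not_in[OF assms(1)] by simp
qed auto

definition reorder_poly :: "(nat \<Rightarrow> nat) \<Rightarrow> rpoly \<Rightarrow> rpoly" where
  "reorder_poly \<sigma> = mhom mconst (reorder \<sigma> mvar)"

lemma meval_reorder_poly: "meval a (reorder_poly \<sigma> p) = meval (reorder \<sigma> a) p"
proof -
  have "(\<lambda>v. meval a (reorder \<sigma> mvar v)) = reorder \<sigma> a"
    by (auto simp: reorder_def fun_eq_iff split: var.splits)
  then show ?thesis by (simp add: reorder_poly_def meval_mhom_mconst)
qed

lemma reorder_poly_mpolys:
  assumes K: "subring_set K" and p: "p \<in> mpolys K (Y \<union> lvars n)"
    and Y: "Y \<inter> lvars n = {}" and \<sigma>: "\<sigma> permutes {..<n}"
  shows "reorder_poly \<sigma> p \<in> mpolys K (Y \<union> lvars n)"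
  unfolding reorder_poly_def
proof (rule mhom_mpolys[OF p K subring_set_mpolys[OF K] comm_ring_hom_mconst])
  fix v assume v: "v \<in> Y \<union> lvars n"
  show "reorder \<sigma> mvar v \<in> mpolys K (Y \<union> lvars n)"
  proof (cases "v \<in> lvars n")
    case True
    then obtain i where "v = Lv i" "i \<in> {..<n}" by (auto simp: lvars_def)
    then have "reorder \<sigma> mvar v = (mvar (Lv (\<sigma> i)) :: rpoly)" "\<sigma> i \<in> {..<n}"
      using permutes_in_image[OF \<sigma>, of i] by auto
    moreover have "(mvar (Lv (\<sigma> i)) :: rpoly) \<in> mpolys K (Y \<union> lvars n)" if "\<sigma> i \<in> {..<n}"
      by (rule mvar_mpolys[OF K]) (use that in \<open>auto simp: lvars_def\<close>)
    ultimately show ?thesis by simp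
  next
    case False
    then show ?thesis using v K by (simp add: reorder_off[OF \<sigma>])
  qed
qed (auto simp: K)

lemma prod_linear_roots:
  "poly (\<Prod>i\<in>S. [:- l i, 1:]) x = (\<Prod>i\<in>S. x - l i)" for x :: "'a::comm_ring_1"
  by (simp add: poly_prod)

lemma coeff_linear_in: "subring_set S \<Longrightarrow> x \<in> S \<Longrightarrow> coeff [:- x, 1:] k \<in> S"
  by (auto simp: coeff_pCons subring_setD split: nat.splits)

text \<open>\<open>C\<close> stands for the characteristic polynomial. \<open>K\<close> is \<rat> or
  \<real>, and \<open>Y\<close> consists of y alone or of y with extra parameters. The polynomial
  \<open>h\<close> only selects the points used as tests; so it may have real coefficients in both
  cases, and further factors can be multiplied to it.\<close>

locale root_family =
  fixes K :: "real set" and Y :: "var set" and n :: nat and C :: "rpoly poly" and h :: rpoly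
  assumes K: "subring_set K"
    and Y: "Y \<inter> lvars n = {}"
    and C_coeff: "coeff C k \<in> mpolys K Y"
    and C_monic: "degree C = n" "coeff C n = 1"
    and h_nonzero: "h \<noteq> 0" and h_vars: "mvars h \<inter> lvars n = {}"
    and roots: "meval a h \<noteq> 0 \<Longrightarrow> \<exists>l. inj_on l {..<n} \<and> map_poly (meval a) C = (\<Prod>i<n. [:- l i, 1:])"
begin

abbreviation "points \<equiv> pts n C h"
abbreviation "Syl \<equiv> mpolys K (Y \<union> lvars n)"

lemma meval_agree:
  assumes "p \<in> mpolys K' V" "V \<inter> lvars n = {}" "\<And>v. v \<notin> lvars n \<Longrightarrow> a v = b v"
  shows "meval a p = meval b p"
  by (rule meval_cong) (use assms in \<open>auto simp: mpolys_iff\<close>)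

lemma C_agree:
  assumes "\<And>v. v \<notin> lvars n \<Longrightarrow> a v = b v"
  shows "map_poly (meval a) C = map_poly (meval b) C"
  by (rule poly_eqI) (use meval_agree[OF C_coeff Y assms] in simp)

lemma h_agree:
  assumes "\<And>v. v \<notin> lvars n \<Longrightarrow> a v = b v"
  shows "meval a h = meval b h"
  by (rule meval_cong) (use assms h_vars in auto)

lemma reorder_points:
  assumes a: "a \<in> points" and \<sigma>: "\<sigma> permutes {..<n}"
  shows "reorder \<sigma> a \<in> points"
proof -
  note off = reorder_off[OF \<sigma>, of _ a]
  have "inj_on ((\<lambda>i. a (Lv i)) \<circ> \<sigma>) {..<n}"
    by (rule comp_inj_on) (use a \<sigma> in \<open>auto simp: pts_def permutes_image intro: permutes_inj_on\<close>)
  moreover have "(\<Prod>i<n. [:- a (Lv (\<sigma> i)), 1:]) = (\<Prod>i<n. [:- a (Lv i), 1:])"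
    by (rule prod.permute[OF \<sigma>, unfolded comp_def, symmetric])
  ultimately show ?thesis
    using a h_agree[of "reorder \<sigma> a" a] C_agree[of "reorder \<sigma> a" a] off
    by (auto simp: pts_def comp_def)
qed

text \<open>Both points list the roots of one and the same polynomial without repetition.\<close>

lemma points_agree_reorder:
  assumes a: "a \<in> points" and b: "b \<in> points" and off: "\<And>v. v \<notin> lvars n \<Longrightarrow> a v = b v"
  shows "\<exists>\<sigma>. \<sigma> permutes {..<n} \<and> b = reorder \<sigma> a"
proof -
  let ?l = "\<lambda>i. a (Lv i)" and ?m = "\<lambda>i. b (Lv i)"
  have eq: "(\<Prod>i<n. [:- ?l i, 1:]) = (\<Prod>i<n. [:- ?m i, 1:])"
    using a b C_agree[OF off] by (auto simp: pts_def)
  have rt: "poly (\<Prod>i<n. [:- l i, 1:]) x = 0 \<longleftrightarrow> x \<in> l ` {..<n}" for l and x :: real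
    by (auto simp: prod_linear_roots)
  have im: "?l ` {..<n} = ?m ` {..<n}"
    using rt[of ?l] rt[of ?m] eq by auto
  have inj: "inj_on ?l {..<n}" "inj_on ?m {..<n}" using a b by (auto simp: pts_def)
  define \<sigma> where "\<sigma> = (\<lambda>i. if i < n then the_inv_into {..<n} ?l (?m i) else i)"
  have bij: "bij_betw (\<lambda>i. the_inv_into {..<n} ?l (?m i)) {..<n} {..<n}"
    using bij_betw_trans[of ?m "{..<n}" "?m ` {..<n}" "the_inv_into {..<n} ?l" "{..<n}"]
      bij_betw_the_inv_into[of ?l "{..<n}" "?l ` {..<n}"] inj im
    by (simp add: bij_betw_def comp_def)
  have "bij_betw \<sigma> {..<n} {..<n}"
    using bij by (rule bij_betw_cong[THEN iffD1, rotated]) (auto simp: \<sigma>_def)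
  then have p: "\<sigma> permutes {..<n}"
    by (rule bij_imp_permutes) (auto simp: \<sigma>_def)
  have l\<sigma>: "?l (\<sigma> i) = ?m i" if "i < n" for i
    using that f_the_inv_into_f[OF inj(1), of "?m i"] im by (auto simp: \<sigma>_def)
  have "b v = reorder \<sigma> a v" for v
  proof (cases "v \<in> lvars n")
    case True
    then show ?thesis using l\<sigma> by (auto simp: lvars_def)
  next
    case False
    then show ?thesis using off by (simp add: reorder_off[OF p])
  qed
  with p show ?thesis by blast
qed

lemma ex_point:
  assumes "meval a h \<noteq> 0"
  shows "\<exists>b\<in>points. \<forall>v. v \<notin> lvars n \<longrightarrow> b v = a v"
proof -
  obtain l where l: "inj_on l {..<n}" "map_poly (meval a) C = (\<Prod>i<n. [:- l i, 1:])"
    using roots[OF assms] by blast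
  define b where "b v = (case v of Lv i \<Rightarrow> if i < n then l i else a v | _ \<Rightarrow> a v)" for v
  have off: "b v = a v" if "v \<notin> lvars n" for v
    using that by (auto simp: b_def lvars_def split: var.splits)
  have bl: "b (Lv i) = l i" if "i < n" for i using that by (simp add: b_def)
  have "inj_on (\<lambda>i. b (Lv i)) {..<n} = inj_on l {..<n}"
    by (rule inj_on_cong) (simp add: bl)
  then have "b \<in> points"
    using l assms h_agree[OF off] C_agree[OF off] by (simp add: pts_def bl)
  with off show ?thesis by blast
qed

text \<open>Every assignment with \<open>h\<close> nonzero becomes a point after a change of the
  \<lambda>-coordinates, which \<open>c\<close> does not see; so \<open>c * h\<close> vanishes
  everywhere.\<close>

lemma zero_if_vanishing:
  assumes c: "c \<in> mpolys K' V" "V \<inter> lvars n = {}" and v: "\<And>a. a \<in> points \<Longrightarrow> meval a c = 0"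
  shows "c = 0"
proof -
  have "meval a (c * h) = 0" for a
  proof (cases "meval a h = 0")
    case False
    then obtain b where b: "b \<in> points" "\<forall>v. v \<notin> lvars n \<longrightarrow> b v = a v" using ex_point by blast
    have "meval a c = meval b c" by (rule meval_agree[OF c]) (use b in auto)
    then show ?thesis using v[OF b(1)] by (simp add: meval.hom_mult)
  qed (simp add: meval.hom_mult)
  then have "c * h = 0" by (intro meval_zero_imp_zero[where Z = UNIV]) (auto simp: infinite_UNIV_char_0)
  then show ?thesis using h_nonzero by simp
qed

text \<open>The Cauchy modules of \<open>C\<close>: successive quotients by the linear factors of
  the first roots, with the remainders discarded. Each is monic, and their values at the next root
  form a triangular system for the roots.\<close>

fun Cdiv :: "nat \<Rightarrow> rpoly poly" where
  "Cdiv 0 = C"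
| "Cdiv (Suc i) = synthetic_div (Cdiv i) (mvar (Lv i))"

lemma lvars_mono: "i \<le> j \<Longrightarrow> lvars i \<subseteq> lvars j"
  by (auto simp: lvars_def)

lemma Cdiv_coeff: "coeff (Cdiv i) k \<in> mpolys K (Y \<union> lvars i)"
proof (induct i arbitrary: k)
  case 0
  then show ?case using C_coeff by (simp add: lvars_def)
next
  case (Suc i)
  have "Y \<union> lvars i \<subseteq> Y \<union> lvars (Suc i)" using lvars_mono[of i "Suc i"] by auto
  from mpolys_mono[OF Suc subset_refl this]
  have "coeff (Cdiv i) k \<in> mpolys K (Y \<union> lvars (Suc i))" for k .
  moreover have "mvar (Lv i) \<in> mpolys K (Y \<union> lvars (Suc i))"
    by (rule mvar_mpolys[OF K]) (simp add: lvars_def)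
  ultimately show ?case
    unfolding Cdiv.simps by (intro synthetic_div_coeff_in subring_set_mpolys K) auto
qed

lemma Cdiv_monic: "i \<le> n \<Longrightarrow> degree (Cdiv i) = n - i \<and> coeff (Cdiv i) (n - i) = 1"
proof (induct i)
  case 0
  then show ?case using C_monic by simp
next
  case (Suc i)
  have d: "degree (Cdiv (Suc i)) = n - Suc i" using Suc by (simp add: degree_synthetic_div)
  have 1: "coeff (Cdiv (Suc i)) (n - Suc i) = coeff (Cdiv i) (Suc (n - Suc i))
      + mvar (Lv i) * coeff (Cdiv (Suc i)) (Suc (n - Suc i))"
    by (simp only: Cdiv.simps) (rule coeff_synthetic_div)
  have 2: "coeff (Cdiv (Suc i)) (Suc (n - Suc i)) = 0" by (rule coeff_eq_0) (simp only: d)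
  have 3: "Suc (n - Suc i) = n - i" using Suc.prems by simp
  have "coeff (Cdiv (Suc i)) (n - Suc i) = coeff (Cdiv i) (n - i)"
    unfolding 1 2 unfolding 3 by simp
  with Suc d show ?case by (simp del: Cdiv.simps)
qed

text \<open>Two ideals are put for \<open>I\<close>. The vanishing ideal of the points yields
  \<open>symmetric_value\<close>; the ideal generated by \<open>E1'\<close> satisfies the same
  assumptions, and \<open>vanishing_in_ideal\<close> then shows that it is the whole vanishing
  ideal.\<close>

context
  fixes I
  assumes I: "ideal_set Syl I"
    and gens: "coeff ((\<Prod>i<n. [:- mvar (Lv i), 1:]) - C) k \<in> I"
    and van: "x \<in> I \<Longrightarrow> a \<in> points \<Longrightarrow> meval a x = 0"
begin

text \<open>Modulo \<open>I\<close> the polynomial \<open>C\<close> is the product of all linear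
  factors, and division by a monic linear factor respects the congruence: the discarded remainder,
  \<open>Cdiv i\<close> evaluated at the next root, lies in \<open>I\<close> itself.\<close>

lemma Cdiv_diff: "i \<le> n \<Longrightarrow> coeff (Cdiv i - (\<Prod>j\<in>{i..<n}. [:- mvar (Lv j), 1:])) k \<in> I"
proof (induct i arbitrary: k)
  case 0
  have "C - (\<Prod>j\<in>{0..<n}. [:- mvar (Lv j), 1:]) = - ((\<Prod>i<n. [:- mvar (Lv i), 1:]) - C)"
    by (simp add: atLeast0LessThan)
  then show ?case using ideal_set_diff(1)[OF I subring_set_mpolys[OF K] gens[of k] gens[of k]]
    by (simp only: Cdiv.simps coeff_minus)
next
  case (Suc i)
  let ?c = "mvar (Lv i) :: rpoly" and ?P = "\<lambda>i. \<Prod>j\<in>{i..<n}. [:- mvar (Lv j) :: rpoly, 1:]"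
  let ?\<Delta> = "\<lambda>i. Cdiv i - ?P i"
  have S: "subring_set Syl" by (simp add: K)
  have c: "?c \<in> Syl" using Suc.prems K by (auto simp: lvars_def)
  have Pi: "?P i = [:- ?c, 1:] * ?P (Suc i)"
    using Suc.prems by (subst prod.atLeast_Suc_lessThan) auto
  have IH: "coeff (?\<Delta> i) k \<in> I" for k using Suc by simp
  have "poly (?\<Delta> i) ?c \<in> I" by (rule poly_in_ideal[OF S I IH c])
  then have Cc: "poly (Cdiv i) ?c \<in> I" by (simp add: Pi)
  have E0: "[:- ?c, 1:] * Cdiv (Suc i) = Cdiv i - [:poly (Cdiv i) ?c:]"
    unfolding eq_diff_eq Cdiv.simps by (rule synthetic_div_correct')
  have E: "[:- ?c, 1:] * ?\<Delta> (Suc i) = ?\<Delta> i - [:poly (Cdiv i) ?c:]"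
    by (simp only: Pi right_diff_distrib E0 diff_diff_eq add.commute)
  \<comment> \<open>The linear factor is cancelled in \<open>E\<close> from the top: comparing
    coefficients of index \<open>Suc k\<close> expresses coefficient \<open>k\<close> by coefficient
    \<open>Suc k\<close>.\<close>
  show ?case
  proof (rule descending_induct[where N = "Suc (degree (?\<Delta> (Suc i)))"])
    fix k assume k: "coeff (?\<Delta> (Suc i)) (Suc k) \<in> I"
    have "coeff ([:- ?c, 1:] * ?\<Delta> (Suc i)) (Suc k) = coeff (?\<Delta> i) (Suc k)"
      unfolding E by (simp add: coeff_pCons)
    then have "coeff (?\<Delta> (Suc i)) k = coeff (?\<Delta> i) (Suc k) + ?c * coeff (?\<Delta> (Suc i)) (Suc k)"
      by (simp add: algebra_simps)
    then show "coeff (?\<Delta> (Suc i)) k \<in> I"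
      using IH[of "Suc k"] k c by (auto intro!: ideal_setD(2,3)[OF I] simp del: Cdiv.simps coeff_diff)
  next
    fix k assume "k \<ge> Suc (degree (?\<Delta> (Suc i)))"
    then show "coeff (?\<Delta> (Suc i)) k \<in> I" using ideal_setD(1)[OF I] by (subst coeff_eq_0) auto
  qed
qed

lemma Cdiv_root: assumes "i < n" shows "poly (Cdiv i) (mvar (Lv i)) \<in> I"
proof -
  let ?c = "mvar (Lv i) :: rpoly" and ?P = "\<Prod>j\<in>{i..<n}. [:- mvar (Lv j) :: rpoly, 1:]"
  have S: "subring_set Syl" by (simp add: K)
  have c: "?c \<in> Syl" using assms K by (auto simp: lvars_def)
  have "poly (Cdiv i - ?P) ?c \<in> I"
    by (rule poly_in_ideal[OF S I _ c]) (use Cdiv_diff[of i] assms in simp)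
  moreover have "poly ?P ?c = 0" using assms by (auto simp: prod_linear_roots)
  ultimately show ?thesis by simp
qed

text \<open>Induction on the number \<open>i\<close> of roots involved. Division by
  \<open>Cdiv i\<close> leaves a remainder \<open>r\<close> of degree below n - i in the root of
  index \<open>i\<close>. Exchanging this root with a later one changes neither the value of
  \<open>p\<close> nor the coefficients of \<open>r\<close>, so at each point \<open>r\<close> takes
  the value of \<open>p\<close> at n - i distinct places and is constant. Its higher coefficients
  thus vanish at all points, and the constant one is symmetric with one root fewer.\<close>

lemma symmetric_in_base_aux:
  assumes "i \<le> n" "p \<in> mpolys K (Y \<union> lvars i)"
    and "\<And>a b. a \<in> points \<Longrightarrow> b \<in> points \<Longrightarrow> (\<And>v. v \<notin> lvars n \<Longrightarrow> a v = b v) \<Longrightarrow> meval a p = meval b p"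
  shows "\<exists>c\<in>mpolys K Y. p - c \<in> I"
  using assms
proof (induct i arbitrary: p)
  case 0
  then show ?case using ideal_setD(1)[OF I] by (intro bexI[of _ p]) (auto simp: lvars_def)
next
  case (Suc i)
  let ?S = "mpolys K (Y \<union> lvars i)" and ?x = "mvar (Lv i) :: rpoly"
  have i: "i < n" using Suc.prems by simp
  have S: "subring_set ?S" by (simp add: K)
  have S_sub: "q \<in> ?S \<Longrightarrow> q \<in> Syl" for q
    using mpolys_mono[of q K "Y \<union> lvars i" K "Y \<union> lvars n"] lvars_mono[of i n] i by auto
  have "Y \<union> lvars (Suc i) = insert (Lv i) (Y \<union> lvars i)" by (auto simp: lvars_def lessThan_Suc)
  then obtain pp where pp: "\<And>k. coeff pp k \<in> ?S" "poly pp ?x = p"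
    using mpoly_as_poly_in_var[OF K, of p "Lv i" "Y \<union> lvars i"] Suc.prems(2) by auto
  obtain q r where qr: "pp = q * Cdiv i + r" "\<forall>k. coeff q k \<in> ?S" "\<forall>k. coeff r k \<in> ?S"
      "\<forall>k\<ge>n - i. coeff r k = 0"
    using monic_division[of ?S "Cdiv i" "n - i" pp "Suc (degree pp)", OF S Cdiv_coeff] Cdiv_monic[of i] i pp(1)
    by (auto simp: coeff_eq_0)
  have qx: "poly q ?x \<in> Syl"
    using qr(2) S_sub i K by (intro poly_coeff_in) (auto simp: lvars_def)
  have pI: "p - poly r ?x \<in> I"
    using ideal_setD(3)[OF I qx Cdiv_root[OF i]] by (simp add: qr(1) flip: pp(2))
  have val: "poly (map_poly (meval a) r) (a (Lv j)) = meval a p" if a: "a \<in> points" and j: "i \<le> j" "j < n" for a j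
  proof -
    let ?\<tau> = "Transposition.transpose i j"
    have \<tau>: "?\<tau> permutes {..<n}" using j by (intro permutes_swap_id) auto
    let ?b = "reorder ?\<tau> a"
    have b: "?b \<in> points" by (rule reorder_points[OF a \<tau>])
    have "meval ?b p = meval a p"
      by (rule Suc.prems(3)[OF b a]) (simp add: reorder_off[OF \<tau>])
    moreover have "meval ?b p = meval ?b (poly r ?x)"
      using van[OF pI b] by (simp add: meval.hom_minus)
    moreover have "meval ?b (coeff r k) = meval a (coeff r k)" for k
    proof (rule meval_cong)
      fix v assume "v \<in> mvars (coeff r k)"
      then have "v \<in> Y \<union> lvars i" using qr(3) by (auto simp: mpolys_iff)
      then show "?b v = a v"
      proof
        assume "v \<in> Y"
        then show ?thesis using Y by (intro reorder_off[OF \<tau>]) auto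
      next
        assume "v \<in> lvars i"
        then show ?thesis using j by (auto simp: lvars_def Transposition.transpose_def)
      qed
    qed
    then have "map_poly (meval ?b) r = map_poly (meval a) r" by (intro poly_eqI) simp
    ultimately show ?thesis using poly_map_meval[of ?b r ?x] by simp
  qed
  have cr: "coeff (map_poly (meval a) r) k = (if k = 0 then meval a p else 0)" if a: "a \<in> points" for a k
  proof -
    let ?R = "map_poly (meval a) r - [:meval a p:]"
    have "?R = 0"
    proof (rule ccontr)
      assume ne: "?R \<noteq> 0"
      have inj: "inj_on (\<lambda>j. a (Lv j)) {i..<n}" using a by (auto simp: pts_def inj_on_def)
      have "card ((\<lambda>j. a (Lv j)) ` {i..<n}) \<le> card {x. poly ?R x = 0}"
        by (rule card_mono) (use poly_roots_finite[OF ne] val[OF a] in auto)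
      also have "\<dots> \<le> degree ?R" by (rule card_poly_roots_bound[OF ne])
      also have "\<dots> < n - i"
      proof (rule degree_lessI)
        show "\<forall>k\<ge>n - i. coeff ?R k = 0" using qr(4) i by (auto simp: coeff_pCons split: nat.splits)
      qed (use ne in auto)
      finally show False by (simp add: card_image[OF inj])
    qed
    then have "map_poly (meval a) r = [:meval a p:]" by simp
    then show ?thesis by (simp add: coeff_pCons split: nat.splits)
  qed
  \<comment> \<open>A coefficient that vanishes at all points is symmetric, so the induction
    hypothesis makes it congruent to some \<open>c\<close> over \<open>Y\<close>, and such a
    \<open>c\<close> is zero.\<close>
  have high: "coeff r k \<in> I" if k: "k > 0" for k
  proof -
    have v: "meval a (coeff r k) = 0" if "a \<in> points" for a using cr[OF that, of k] k by simp
    have "\<exists>c\<in>mpolys K Y. coeff r k - c \<in> I"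
      by (rule Suc.hyps) (use i qr(3) v in auto)
    then obtain c where c: "c \<in> mpolys K Y" "coeff r k - c \<in> I" by blast
    have "c = 0"
    proof (rule zero_if_vanishing[OF c(1) Y])
      fix a assume a: "a \<in> points"
      show "meval a c = 0" using v[OF a] van[OF c(2) a] by (simp add: meval.hom_minus)
    qed
    with c show ?thesis by simp
  qed
  have "\<exists>c\<in>mpolys K Y. coeff r 0 - c \<in> I"
  proof (rule Suc.hyps)
    fix a b assume ab: "a \<in> points" "b \<in> points" "\<And>v. v \<notin> lvars n \<Longrightarrow> a v = b v"
    show "meval a (coeff r 0) = meval b (coeff r 0)"
      using cr[OF ab(1), of 0] cr[OF ab(2), of 0] Suc.prems(3)[OF ab] by simp
  qed (use i qr(3) in auto)
  then obtain c where c: "c \<in> mpolys K Y" "coeff r 0 - c \<in> I" by blast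
  have "poly r ?x = (\<Sum>k\<le>degree r. coeff r k * ?x ^ k)" by (rule poly_altdef)
  also have "\<dots> = coeff r 0 + (\<Sum>k\<in>{..degree r} - {0}. coeff r k * ?x ^ k)"
    by (subst sum.remove[of _ 0]) auto
  finally have r: "poly r ?x - coeff r 0 = (\<Sum>k\<in>{..degree r} - {0}. coeff r k * ?x ^ k)" by simp
  have "(\<Sum>k\<in>{..degree r} - {0}. coeff r k * ?x ^ k) \<in> I"
  proof (rule ideal_setD(5)[OF I])
    fix k assume "k \<in> {..degree r} - {0}"
    then have "coeff r k \<in> I" by (intro high) auto
    moreover have "?x ^ k \<in> Syl"
      by (intro mpolys_closed(7)[OF K] mvar_mpolys[OF K]) (use i in \<open>auto simp: lvars_def\<close>)
    ultimately show "coeff r k * ?x ^ k \<in> I" by (rule ideal_setD(4)[OF I])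
  qed
  then have "poly r ?x - coeff r 0 \<in> I" by (simp only: r)
  from ideal_setD(2)[OF I ideal_setD(2)[OF I pI this] c(2)] have "p - c \<in> I" by simp
  with c(1) show ?case by blast
qed

lemma vanishing_in_ideal:
  assumes p: "p \<in> Syl" "\<And>a. a \<in> points \<Longrightarrow> meval a p = 0"
  shows "p \<in> I"
proof -
  obtain c where c: "c \<in> mpolys K Y" "p - c \<in> I"
    using symmetric_in_base_aux[of n p] p by auto
  have "c = 0"
    by (rule zero_if_vanishing[OF c(1) Y]) (use p(2) van[OF c(2)] in \<open>simp add: meval.hom_minus\<close>)
  with c(2) show ?thesis by simp
qed

end

section \<open>Descent of symmetric functions and norms\<close>

lemma generators_vanish:
  assumes "a \<in> points"
  shows "meval a (coeff ((\<Prod>i<n. [:- mvar (Lv i), 1:]) - C) k) = 0"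
proof -
  have "map_poly (meval a) (\<Prod>i<n. [:- mvar (Lv i), 1:]) = (\<Prod>i<n. [:- a (Lv i), 1:])"
    by (simp add: mp_meval.hom_prod meval.map_poly_pCons_hom meval.hom_uminus)
  then have "map_poly (meval a) ((\<Prod>i<n. [:- mvar (Lv i), 1:]) - C) = 0"
    using assms by (simp add: mp_meval.hom_minus pts_def)
  from arg_cong[OF this, of "\<lambda>q. coeff q k"] show ?thesis by simp
qed

lemma generators_in_ring: "coeff ((\<Prod>i<n. [:- mvar (Lv i), 1:]) - C) k \<in> Syl"
proof -
  have "coeff (\<Prod>i<n. [:- mvar (Lv i) :: rpoly, 1:]) k \<in> Syl"
    by (intro coeff_prod_in coeff_linear_in subring_set_mpolys K mvar_mpolys[OF K]) (auto simp: lvars_def)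
  moreover have "coeff C k \<in> Syl" by (rule mpolys_mono[OF C_coeff]) auto
  ultimately show ?thesis using mpolys_closed(5)[OF K] by simp
qed

lemma symmetric_value:
  assumes p: "p \<in> Syl"
    and sym: "\<And>a \<sigma>. a \<in> points \<Longrightarrow> \<sigma> permutes {..<n} \<Longrightarrow> meval (reorder \<sigma> a) p = meval a p"
  shows "\<exists>c\<in>mpolys K Y. \<forall>a\<in>points. meval a c = meval a p"
proof -
  let ?I = "{x \<in> Syl. \<forall>a\<in>points. meval a x = 0}"
  have I: "ideal_set Syl ?I"
    by (auto simp: ideal_set_def K mpolys_closed meval.hom_add meval.hom_mult)
  have gens: "coeff ((\<Prod>i<n. [:- mvar (Lv i), 1:]) - C) k \<in> ?I" for k
    using generators_vanish generators_in_ring by auto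
  have "\<exists>c\<in>mpolys K Y. p - c \<in> ?I"
  proof (rule symmetric_in_base_aux[OF I gens _ order_refl p])
    fix a b assume "a \<in> points" "b \<in> points" "\<And>v. v \<notin> lvars n \<Longrightarrow> a v = b v"
    then show "meval a p = meval b p" using points_agree_reorder[of a b] sym[of a] by auto
  qed auto
  then show ?thesis by (fastforce simp: meval.hom_minus)
qed

text \<open>The resolvent of \<open>p\<close>: its roots are the values of \<open>p\<close> at all
  orderings, so its coefficients are symmetric and descend to \<open>Y\<close>. The agreement of
  \<open>N\<close> with \<open>Q\<close> is one of values at the points.\<close>

lemma norm_poly:
  assumes p: "p \<in> Syl"
  shows "\<exists>N. (\<forall>k. coeff N k \<in> mpolys K Y) \<and>
    (\<forall>a\<in>points. map_poly (meval a) N = (\<Prod>\<sigma> | \<sigma> permutes {..<n}. [:- meval (reorder \<sigma> a) p, 1:]))"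
proof -
  let ?G = "{\<sigma>. \<sigma> permutes {..<n}}"
  define Q where "Q = (\<Prod>\<sigma>\<in>?G. [:- reorder_poly \<sigma> p, 1:])"
  have Qa: "map_poly (meval a) Q = (\<Prod>\<sigma>\<in>?G. [:- meval (reorder \<sigma> a) p, 1:])" for a
    by (simp add: Q_def mp_meval.hom_prod meval.map_poly_pCons_hom meval.hom_uminus meval_reorder_poly)
  have Qin: "coeff Q k \<in> Syl" for k
    unfolding Q_def
    by (intro coeff_prod_in coeff_linear_in subring_set_mpolys K reorder_poly_mpolys p Y) auto
  have sym: "map_poly (meval (reorder \<tau> a)) Q = map_poly (meval a) Q" if \<tau>: "\<tau> permutes {..<n}" for \<tau> a
  proof -
    have "(\<Prod>\<sigma>\<in>?G. [:- meval (reorder (\<tau> \<circ> \<sigma>) a) p, 1:]) = (\<Prod>\<sigma>\<in>?G. [:- meval (reorder \<sigma> a) p, 1:])"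
      by (rule prod.reindex_bij_witness[of _ "\<lambda>\<sigma>. inv_into UNIV \<tau> \<circ> \<sigma>" "\<lambda>\<sigma>. \<tau> \<circ> \<sigma>"])
         (use \<tau> in \<open>auto simp: permutes_compose permutes_inv o_assoc permutes_inv_o\<close>)
    then show ?thesis by (simp add: Qa reorder_reorder)
  qed
  have "\<exists>c\<in>mpolys K Y. \<forall>a\<in>points. meval a c = meval a (coeff Q k)" for k
    by (rule symmetric_value[OF Qin]) (use sym arg_cong[where f = "\<lambda>q. coeff q k"] in fastforce)
  then obtain c where c: "\<And>k. c k \<in> mpolys K Y" "\<And>k a. a \<in> points \<Longrightarrow> meval a (c k) = meval a (coeff Q k)"
    by metis
  define N where "N = (\<Sum>k\<le>degree Q. Polynomial.monom (c k) k)"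
  have N: "coeff N k = (if k \<le> degree Q then c k else 0)" for k
    by (simp add: N_def coeff_sum)
  show ?thesis
  proof (intro exI[of _ N] conjI allI ballI)
    show "coeff N k \<in> mpolys K Y" for k using c(1) K by (simp add: N mpolys_closed)
    fix a assume "a \<in> points"
    then have "map_poly (meval a) N = map_poly (meval a) Q"
      by (intro poly_eqI) (simp add: N c(2) coeff_eq_0)
    then show "map_poly (meval a) N = (\<Prod>\<sigma>\<in>?G. [:- meval (reorder \<sigma> a) p, 1:])" by (simp add: Qa)
  qed
qed

lemma refine:
  assumes g: "g \<noteq> 0" "mvars g \<inter> lvars n = {}"
  shows "root_family K Y n C (h * g)"
proof
  show "mvars (h * g) \<inter> lvars n = {}" using mvars_mult[of h g] h_vars g(2) by blast
  show "\<exists>l. inj_on l {..<n} \<and> map_poly (meval a) C = (\<Prod>i<n. [:- l i, 1:])"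
    if "meval a (h * g) \<noteq> 0" for a
    using that by (intro roots) (simp add: meval.hom_mult)
qed (use K Y C_coeff C_monic h_nonzero g in auto)

lemma pts_refine: "pts n C (h * g) = {a \<in> points. meval a g \<noteq> 0}"
  by (auto simp: pts_def meval.hom_mult)

end

section \<open>Polynomial functions of a matrix, entrywise\<close>

text \<open>The entry \<open>(s, t)\<close> of the matrix \<open>p(A)\<close>, as a linear
  functional of \<open>p\<close>.\<close>

definition ent :: "'a::comm_ring_1 mat \<Rightarrow> nat \<Rightarrow> nat \<Rightarrow> 'a poly \<Rightarrow> 'a" where
  "ent A s t p = (\<Sum>r\<le>degree p. coeff p r * (A ^\<^sub>m r) $$ (s, t))"

lemma ent_superset: "degree p \<le> N \<Longrightarrow> ent A s t p = (\<Sum>r\<le>N. coeff p r * (A ^\<^sub>m r) $$ (s, t))"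
  unfolding ent_def by (rule sum.mono_neutral_left) (auto simp: coeff_eq_0)

lemma ent_add: "ent A s t (p + q) = ent A s t p + ent A s t q"
proof -
  let ?N = "max (degree p) (degree q)"
  have "degree (p + q) \<le> ?N" by (rule degree_add_le_max)
  then show ?thesis by (simp add: ent_superset[where N = ?N] algebra_simps sum.distrib)
qed

lemma ent_smult: "ent A s t (smult c p) = c * ent A s t p"
  by (subst ent_superset[where N = "degree p"])
     (auto simp: ent_def degree_smult_le sum_distrib_left algebra_simps)

lemma ent_0 [simp]: "ent A s t 0 = 0"
  by (simp add: ent_def)

lemma ent_diff: "ent A s t (p - q) = ent A s t p - ent A s t q"
  using ent_add[of A s t "p - q" q] by simp

lemma ent_sum: "ent A s t (sum f S) = (\<Sum>i\<in>S. ent A s t (f i))"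
  by (induct S rule: infinite_finite_induct) (auto simp: ent_add)

lemma ent_monom: "ent A s t (Polynomial.monom c r) = c * (A ^\<^sub>m r) $$ (s, t)"
  by (subst ent_superset[where N = r]) (auto simp: degree_monom_le if_distrib[of "\<lambda>x. x * _"] cong: if_cong)

lemma ent_const: "A \<in> carrier_mat n n \<Longrightarrow> s < n \<Longrightarrow> t < n \<Longrightarrow> ent A s t [:c:] = (if s = t then c else 0)"
  by (auto simp: ent_def)

lemma mat_mult_entry:
  "A \<in> carrier_mat n n \<Longrightarrow> B \<in> carrier_mat n n \<Longrightarrow> s < n \<Longrightarrow> t < n \<Longrightarrow>
    (A * B) $$ (s, t) = (\<Sum>k<n. A $$ (s, k) * B $$ (k, t))"
  by (simp add: scalar_prod_def atLeast0LessThan)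

lemma ent_pCons_0:
  assumes A: "A \<in> carrier_mat n n" and st: "s < n" "t < n"
  shows "ent A s t (pCons 0 p) = (\<Sum>k<n. ent A s k p * A $$ (k, t))"
proof -
  have "ent A s t (pCons 0 p) = (\<Sum>r\<le>Suc (degree p). coeff (pCons 0 p) r * (A ^\<^sub>m r) $$ (s, t))"
    by (rule ent_superset) (simp add: degree_pCons_le)
  also have "\<dots> = (\<Sum>r\<le>degree p. coeff p r * (A ^\<^sub>m Suc r) $$ (s, t))"
    by (simp only: sum.atMost_Suc_shift) simp
  also have "\<dots> = (\<Sum>r\<le>degree p. \<Sum>k<n. coeff p r * (A ^\<^sub>m r) $$ (s, k) * A $$ (k, t))"
    by (simp add: mat_mult_entry[of _ n] A st sum_distrib_left mult.assoc del: index_mult_mat)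
  also have "\<dots> = (\<Sum>k<n. ent A s k p * A $$ (k, t))"
    by (subst sum.swap) (simp add: ent_def sum_distrib_right)
  finally show ?thesis .
qed

text \<open>
  Cayley--Hamilton: apply \<open>ent A s\<close> to the entries of the \<open>t\<close>-th column of the identity
  \<open>(x - A) adj (x - A) = \<chi> id\<close>.
\<close>

lemma ent_char_poly:
  fixes A :: "'a::comm_ring_1 mat"
  assumes A: "A \<in> carrier_mat n n" and st: "s < n" "t < n"
  shows "ent A s t (char_poly A) = 0"
proof -
  let ?M = "char_poly_matrix A" and ?B = "adj_mat (char_poly_matrix A)"
  have M: "?M \<in> carrier_mat n n" using A by simp
  note B = adj_mat[OF M]
  have Mik: "?M $$ (i, k) = (if i = k then [:0, 1:] else 0) - [:A $$ (i, k):]" if "i < n" "k < n" for i k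
    using A that by (auto simp: char_poly_matrix_def)
  have e: "(\<Sum>k<n. ?M $$ (i, k) * ?B $$ (k, t)) = (if i = t then char_poly A else 0)" if "i < n" for i
    using arg_cong[OF B(2), of "\<lambda>N. N $$ (i, t)"] mat_mult_entry[OF M B(1) that st(2)] that st M
    by (simp add: char_poly_def)
  have e': "pCons 0 (?B $$ (i, t)) - (\<Sum>k<n. smult (A $$ (i, k)) (?B $$ (k, t)))
      = (if i = t then char_poly A else 0)" if i: "i < n" for i
  proof -
    have "(\<Sum>k<n. ?M $$ (i, k) * ?B $$ (k, t)) = (\<Sum>k<n. (if i = k then pCons 0 (?B $$ (k, t)) else 0)
         - smult (A $$ (i, k)) (?B $$ (k, t)))"
      by (rule sum.cong) (auto simp: Mik i algebra_simps)
    also have "\<dots> = pCons 0 (?B $$ (i, t)) - (\<Sum>k<n. smult (A $$ (i, k)) (?B $$ (k, t)))"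
      using i by (simp add: sum_subtractf)
    finally show ?thesis using e[OF i] by simp
  qed
  have "(\<Sum>i<n. ent A s i (if i = t then char_poly A else 0)) =
     (\<Sum>i<n. ent A s i (pCons 0 (?B $$ (i, t)) - (\<Sum>k<n. smult (A $$ (i, k)) (?B $$ (k, t)))))"
    by (rule sum.cong) (auto simp: e')
  also have "\<dots> = (\<Sum>i<n. (\<Sum>k<n. ent A s k (?B $$ (i, t)) * A $$ (k, i))) -
     (\<Sum>i<n. \<Sum>k<n. A $$ (i, k) * ent A s i (?B $$ (k, t)))"
    using A st by (simp add: ent_diff ent_sum ent_smult ent_pCons_0[OF A] sum_subtractf)
  also have "\<dots> = 0"
    by (subst sum.swap) (simp add: mult.commute)
  moreover have "(\<Sum>i<n. ent A s i (if i = t then char_poly A else 0)) = ent A s t (char_poly A)"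
    using st by (subst sum.remove[of _ t]) auto
  ultimately show ?thesis by simp
qed

lemma ent_char_poly_mult:
  fixes A :: "'a::comm_ring_1 mat"
  assumes A: "A \<in> carrier_mat n n" and s: "s < n" and t: "t < n"
  shows "ent A s t (q * char_poly A) = 0"
  using t
proof (induct q arbitrary: t)
  case (pCons a q)
  have "pCons a q * char_poly A = smult a (char_poly A) + pCons 0 (q * char_poly A)" by simp
  then show ?case
    using pCons by (simp add: ent_add ent_smult ent_char_poly[OF A s] ent_pCons_0[OF A s])
qed simp

section \<open>Lagrange interpolation and spectral projectors\<close>

definition lag :: "nat \<Rightarrow> (nat \<Rightarrow> 'a::comm_ring_1) \<Rightarrow> nat \<Rightarrow> 'a poly" where
  "lag n l i = (\<Prod>j\<in>{..<n} - {i}. [:- l j, 1:])"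

definition lagden :: "nat \<Rightarrow> (nat \<Rightarrow> 'a::comm_ring_1) \<Rightarrow> nat \<Rightarrow> 'a" where
  "lagden n l i = (\<Prod>j\<in>{..<n} - {i}. l i - l j)"

text \<open>An entry of the spectral projector of \<open>l i\<close>, which is the coefficient of
  \<open>z\<^sub>i\<close> in \<open>\<phi>\<close>.\<close>

definition proj :: "nat \<Rightarrow> 'a::field mat \<Rightarrow> (nat \<Rightarrow> 'a) \<Rightarrow> nat \<Rightarrow> nat \<Rightarrow> nat \<Rightarrow> 'a" where
  "proj n A l i s t = ent A s t (lag n l i) / lagden n l i"

lemma lagden_nonzero: "inj_on l {..<n} \<Longrightarrow> i < n \<Longrightarrow> lagden n l i \<noteq> (0::'a::idom)"
  by (auto simp: lagden_def inj_on_def)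

lemma poly_lag: "poly (lag n l i) (l j) = (if i = j then lagden n l i else 0)" if "j < n" for l :: "nat \<Rightarrow> 'a::idom"
  using that by (auto simp: lag_def lagden_def prod_linear_roots)

lemma degree_lag: "i < n \<Longrightarrow> degree (lag n l i) < n" for l :: "nat \<Rightarrow> 'a::idom"
proof -
  assume i: "i < n"
  have "degree (lag n l i) \<le> (\<Sum>j\<in>{..<n} - {i}. degree [:- l j, 1:])"
    unfolding lag_def by (rule degree_prod_sum_le[unfolded comp_def]) simp
  also have "\<dots> = n - 1" using i by simp
  finally show ?thesis using i by simp
qed

text \<open>By Cayley--Hamilton only the remainder of \<open>p\<close> modulo the characteristic
  polynomial counts, and this remainder equals the Lagrange interpolant \<open>L\<close> of
  \<open>p\<close> at the n eigenvalues.\<close>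

lemma ent_spectral:
  fixes A :: "'a::field_gcd mat"
  assumes A: "A \<in> carrier_mat n n" and l: "inj_on l {..<n}" "char_poly A = (\<Prod>i<n. [:- l i, 1:])"
    and st: "s < n" "t < n"
  shows "ent A s t p = (\<Sum>i<n. poly p (l i) * proj n A l i s t)"
proof -
  let ?C = "char_poly A"
  have C: "degree ?C = n" "?C \<noteq> 0" using degree_monic_char_poly[OF A] by auto
  define r where "r = p mod ?C"
  have p: "p = p div ?C * ?C + r" by (simp add: r_def)
  have Cl: "poly ?C (l i) = 0" if "i < n" for i
    using that by (auto simp: l(2) prod_linear_roots)
  have rl: "poly r (l i) = poly p (l i)" if "i < n" for i
    using Cl[OF that] by (subst p) simp
  define L where "L = (\<Sum>i<n. smult (poly p (l i) / lagden n l i) (lag n l i))"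
  have "r - L = 0"
  proof (rule ccontr)
    assume ne: "r - L \<noteq> 0"
    have "poly (r - L) (l j) = 0" if j: "j < n" for j
    proof -
      have "poly L (l j) = (\<Sum>i<n. if i = j then poly p (l j) else 0)"
        unfolding L_def poly_sum
        by (rule sum.cong) (use j lagden_nonzero[OF l(1)] in \<open>auto simp: poly_lag[OF j]\<close>)
      then show ?thesis using j rl by simp
    qed
    then have "card (l ` {..<n}) \<le> card {x. poly (r - L) x = 0}"
      by (intro card_mono poly_roots_finite[OF ne]) auto
    also have "\<dots> \<le> degree (r - L)" by (rule card_poly_roots_bound[OF ne])
    also have "\<dots> < n"
    proof (rule degree_lessI)
      have "coeff r k = 0" if "k \<ge> n" for k
      proof (cases "r = 0")
        case False
        then have "degree r < degree ?C" unfolding r_def using C(2) by (intro degree_mod_less') auto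
        then show ?thesis using that C(1) by (intro coeff_eq_0) simp
      qed simp
      moreover have "coeff L k = 0" if "k \<ge> n" for k
      proof -
        have "coeff (lag n l i) k = 0" if "i < n" for i
          using degree_lag[OF that, of l] \<open>k \<ge> n\<close> by (intro coeff_eq_0) simp
        then show ?thesis unfolding L_def coeff_sum by simp
      qed
      ultimately show "\<forall>k\<ge>n. coeff (r - L) k = 0" by simp
    qed (use ne in auto)
    finally show False by (simp add: card_image[OF l(1)])
  qed
  then have r: "r = L" by simp
  have "ent A s t p = ent A s t r"
    by (subst p) (simp add: ent_add ent_char_poly_mult[OF A st])
  also have "\<dots> = (\<Sum>i<n. poly p (l i) * proj n A l i s t)"
    by (simp add: r L_def ent_sum ent_smult proj_def)
  finally show ?thesis .
qed

lemma pow_smult_mat: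
  fixes A :: "'a::comm_ring_1 mat"
  assumes A: "A \<in> carrier_mat n n"
  shows "(c \<cdot>\<^sub>m A) ^\<^sub>m r = c ^ r \<cdot>\<^sub>m (A ^\<^sub>m r)"
proof (induct r)
  case (Suc r)
  have "(c ^ r \<cdot>\<^sub>m A ^\<^sub>m r) * (c \<cdot>\<^sub>m A) = c ^ Suc r \<cdot>\<^sub>m (A ^\<^sub>m r * A)"
    using A pow_carrier_mat[OF A, of r]
    by (intro eq_matI) (auto simp: scalar_prod_def sum_distrib_left ac_simps)
  then show ?case using Suc by simp
qed (use A in auto)

lemma mat_exp_smult_spectral:
  fixes A :: "real mat"
  assumes A: "A \<in> carrier_mat n n" and l: "inj_on l {..<n}" "char_poly A = (\<Prod>i<n. [:- l i, 1:])"
    and st: "s < n" "t < n"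
  shows "mat_exp (c \<cdot>\<^sub>m A) $$ (s, t) = (\<Sum>i<n. exp (c * l i) * proj n A l i s t)"
proof -
  have p: "(A ^\<^sub>m r) $$ (s, t) = (\<Sum>i<n. l i ^ r * proj n A l i s t)" for r
    using ent_spectral[OF A l st, of "Polynomial.monom 1 r"] by (simp add: ent_monom poly_monom)
  have "(\<lambda>r. \<Sum>i<n. ((c * l i) ^ r /\<^sub>R fact r) * proj n A l i s t) sums (\<Sum>i<n. exp (c * l i) * proj n A l i s t)"
    by (intro sums_sum sums_mult2 exp_converges)
  moreover have "((c \<cdot>\<^sub>m A) ^\<^sub>m r) $$ (s, t) / fact r = (\<Sum>i<n. ((c * l i) ^ r /\<^sub>R fact r) * proj n A l i s t)" for r
  proof -
    have "((c \<cdot>\<^sub>m A) ^\<^sub>m r) $$ (s, t) = c ^ r * (\<Sum>i<n. l i ^ r * proj n A l i s t)"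
      using A st pow_carrier_mat[OF A, of r] by (simp add: pow_smult_mat p)
    then show ?thesis
      by (simp add: sum_distrib_left sum_divide_distrib power_mult_distrib field_simps)
  qed
  ultimately show ?thesis using A st by (simp add: mat_exp_def sums_iff)
qed

section \<open>Continuity of the exponential along lines\<close>

lemma mat_lincomb_carrier [simp]: "mat_lincomb n d A c \<in> carrier_mat n n"
  by (simp add: mat_lincomb_def)

lemma mat_lincomb_smult: "mat_lincomb n d A (\<lambda>i. c * y i) = c \<cdot>\<^sub>m mat_lincomb n d A y"
  by (rule eq_matI) (auto simp: mat_lincomb_def sum_distrib_left ac_simps)

text \<open>Supplies the exponential series of \<open>n * B\<close> as a majorant for the
  exponential of a matrix.\<close>

lemma pow_entry_bound:
  fixes M :: "real mat"
  assumes M: "M \<in> carrier_mat n n" and B: "B \<ge> 0" "\<And>s t. s < n \<Longrightarrow> t < n \<Longrightarrow> \<bar>M $$ (s, t)\<bar> \<le> B"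
    and st: "s < n" "t < n"
  shows "\<bar>(M ^\<^sub>m r) $$ (s, t)\<bar> \<le> (n * B) ^ r"
  using st
proof (induct r arbitrary: t)
  case 0
  then show ?case using M by auto
next
  case (Suc r)
  have "\<bar>(M ^\<^sub>m Suc r) $$ (s, t)\<bar> = \<bar>\<Sum>k<n. (M ^\<^sub>m r) $$ (s, k) * M $$ (k, t)\<bar>"
    using mat_mult_entry[of "M ^\<^sub>m r" n M s t] M Suc.prems by simp
  also have "\<dots> \<le> (\<Sum>k<n. (n * B) ^ r * B)"
    by (rule order_trans[OF sum_abs], rule sum_mono)
       (use Suc B in \<open>auto simp: abs_mult intro!: mult_mono\<close>)
  also have "\<dots> = (n * B) ^ Suc r" by simp
  finally show ?case .
qed

text \<open>The majorant is uniform as long as the entries are bounded, hence on compact balls, and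
  the balls exhaust the line.\<close>

lemma continuous_mat_exp:
  fixes M :: "real \<Rightarrow> real mat"
  assumes M: "\<And>x. M x \<in> carrier_mat n n"
    and cont: "\<And>s t. s < n \<Longrightarrow> t < n \<Longrightarrow> continuous_on UNIV (\<lambda>x. M x $$ (s, t))"
    and st: "s < n" "t < n"
  shows "continuous_on UNIV (\<lambda>x. mat_exp (M x) $$ (s, t))"
proof -
  have pc: "continuous_on UNIV (\<lambda>x. (M x ^\<^sub>m r) $$ (s, t))" if "t < n" for r t
    using that
  proof (induct r arbitrary: t)
    case 0
    have "(\<lambda>x. (M x ^\<^sub>m 0) $$ (s, t)) = (\<lambda>x. if s = t then 1 else 0)"
      using carrier_matD(1)[OF M] 0 st by auto
    then show ?case by (simp only: continuous_on_const)
  next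
    case (Suc r)
    have eq: "(\<lambda>x. (M x ^\<^sub>m Suc r) $$ (s, t)) = (\<lambda>x. \<Sum>k<n. (M x ^\<^sub>m r) $$ (s, k) * M x $$ (k, t))"
      using mat_mult_entry[of "M _ ^\<^sub>m r" n "M _" s t] M Suc.prems st by auto
    show ?case
      unfolding eq by (intro continuous_intros Suc.hyps cont) (use Suc.prems in auto)
  qed
  have "continuous_on (cball 0 R) (\<lambda>x. mat_exp (M x) $$ (s, t))" for R
  proof -
    have "\<exists>B. \<forall>x\<in>cball 0 R. \<bar>M x $$ (s, t)\<bar> \<le> B" if "s < n" "t < n" for s t
    proof -
      have "compact ((\<lambda>x. M x $$ (s, t)) ` cball 0 R)"
        by (intro compact_continuous_image continuous_on_subset[OF cont] that) auto
      then have "bounded ((\<lambda>x. M x $$ (s, t)) ` cball 0 R)" by (rule compact_imp_bounded)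
      then show ?thesis by (auto simp: bounded_iff)
    qed
    then obtain B' where B': "\<And>s t x. s < n \<Longrightarrow> t < n \<Longrightarrow> x \<in> cball 0 R \<Longrightarrow> \<bar>M x $$ (s, t)\<bar> \<le> B' s t"
      by metis
    define B where "B = (\<Sum>s<n. \<Sum>t<n. \<bar>B' s t\<bar>)"
    have B: "\<bar>M x $$ (s, t)\<bar> \<le> B" if "s < n" "t < n" "x \<in> cball 0 R" for s t x
    proof -
      have "\<bar>M x $$ (s, t)\<bar> \<le> \<bar>B' s t\<bar>" using B'[OF that] by simp
      also have "\<dots> \<le> (\<Sum>t<n. \<bar>B' s t\<bar>)" by (rule member_le_sum) (use that in auto)
      also have "\<dots> \<le> B" unfolding B_def by (rule member_le_sum) (use that in \<open>auto intro: sum_nonneg\<close>)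
      finally show ?thesis .
    qed
    have B0: "B \<ge> 0" by (simp add: B_def sum_nonneg)
    have "uniform_limit (cball 0 R) (\<lambda>N x. \<Sum>r<N. (M x ^\<^sub>m r) $$ (s, t) / fact r)
        (\<lambda>x. suminf (\<lambda>r. (M x ^\<^sub>m r) $$ (s, t) / fact r)) sequentially"
    proof (rule Weierstrass_m_test)
      fix r :: nat and x :: real assume x: "x \<in> cball 0 R"
      show "norm ((M x ^\<^sub>m r) $$ (s, t) / fact r) \<le> (n * B) ^ r /\<^sub>R fact r"
        using pow_entry_bound[OF M[of x] B0 B[OF _ _ x] st, of r]
        by (simp add: divide_simps)
    qed (rule summable_exp_generic)
    then have c: "continuous_on (cball 0 R) (\<lambda>x. suminf (\<lambda>r. (M x ^\<^sub>m r) $$ (s, t) / fact r))"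
      by (rule uniform_limit_theorem[rotated])
         (auto intro!: always_eventually continuous_intros continuous_on_subset[OF pc] st)
    have eq: "(\<lambda>x. mat_exp (M x) $$ (s, t)) = (\<lambda>x. suminf (\<lambda>r. (M x ^\<^sub>m r) $$ (s, t) / fact r))"
      using carrier_matD(1)[OF M] st by (auto simp: mat_exp_def)
    show ?thesis unfolding eq by (rule c)
  qed
  then have "continuous_on (\<Union>R. ball 0 R) (\<lambda>x. mat_exp (M x) $$ (s, t))"
    by (intro continuous_on_open_UN) (auto intro: continuous_on_subset[OF _ ball_subset_cball])
  moreover have "(\<Union>R. ball (0::real) R) = UNIV"
    by (auto simp: gt_ex)
  ultimately show ?thesis by simp
qed

lemma continuous_on_meval:
  fixes a :: "real \<Rightarrow> 'v \<Rightarrow> complex"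
  assumes "\<And>v. v \<in> mvars p \<Longrightarrow> continuous_on UNIV (\<lambda>x. a x v)"
  shows "continuous_on UNIV (\<lambda>x. meval (a x) p)"
  unfolding meval_def using assms
  by (intro continuous_intros) (auto simp: mvars_def)

lemma zero_off_finite:
  fixes F :: "real \<Rightarrow> complex"
  assumes "continuous_on UNIV F" "finite S" "\<And>x. x \<notin> S \<Longrightarrow> F x = 0"
  shows "F x = 0"
proof -
  have "closed {x. F x = 0}"
    using continuous_closed_vimage[of "{0}" F] assms(1)
    by (simp add: continuous_on_eq_continuous_within vimage_def)
  moreover have "closure (- S) = UNIV"
    using empty_interior_finite[OF assms(2)] by (simp add: closure_complement)
  ultimately have "UNIV \<subseteq> {x. F x = 0}"
    using assms(3) closure_minimal[of "- S" "{x. F x = 0}"] by auto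
  then show ?thesis by auto
qed

definition cmat :: "real mat \<Rightarrow> complex mat" where "cmat M = map_mat complex_of_real M"

text \<open>Connect an arbitrary \<open>y\<close> by a line to a point where \<open>g\<close> does not vanish.\<close>

lemma vanishing_extends:
  fixes g :: rpoly
  assumes g: "g \<noteq> 0" and f: "f \<in> mpolys UNIV (xvars n)"
    and van: "\<And>a. meval a g \<noteq> 0 \<Longrightarrow> eval_at_mat (cmat (mat_exp (mat_lincomb n d A (\<lambda>i. a (Yv i))))) f = 0"
  shows "eval_at_mat (cmat (mat_exp (mat_lincomb n d A y))) f = 0"
proof -
  obtain b where b: "meval b g \<noteq> 0"
    using meval_zero_imp_zero[of "UNIV :: real set" g] g by (auto simp: infinite_UNIV_char_0)
  define a where "a x v = (1 - x) * (case v of Yv i \<Rightarrow> y i | _ \<Rightarrow> b v) + x * b v" for x :: real and v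
  define F where "F x = eval_at_mat (cmat (mat_exp (mat_lincomb n d A (\<lambda>i. a x (Yv i))))) f" for x
  define q where "q = mhom (\<lambda>c. [:c:]) (\<lambda>v. [:(case v of Yv i \<Rightarrow> y i | _ \<Rightarrow> b v), b v - (case v of Yv i \<Rightarrow> y i | _ \<Rightarrow> b v):]) g"
  have "comm_ring_hom (\<lambda>c::real. [:c:])" by unfold_locales auto
  moreover have "comm_ring_hom (\<lambda>p::real poly. poly p x)" for x by unfold_locales auto
  ultimately have q: "poly q x = meval (a x) g" for x
    unfolding q_def meval_eq_mhom
    by (subst comm_ring_hom.hom_mhom[where g = "\<lambda>p. poly p x"]) (auto simp: a_def[abs_def] algebra_simps)
  have "a 1 = b" by (auto simp: a_def)
  then have "q \<noteq> 0" using q[of 1] b by auto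
  have "F 0 = 0"
  proof (rule zero_off_finite)
    show "finite {x. poly q x = 0}" by (rule poly_roots_finite[OF \<open>q \<noteq> 0\<close>])
    show "F x = 0" if "x \<notin> {x. poly q x = 0}" for x
      using that van[of "a x"] by (simp add: F_def q)
    show "continuous_on UNIV F"
      unfolding F_def eval_at_mat_def
    proof (rule continuous_on_meval)
      fix v assume "v \<in> mvars f"
      then have "v \<in> xvars n" using f by (auto simp: mpolys_iff)
      then obtain k l where v: "v = Xv k l" "k < n" "l < n" by (auto simp: xvars_def)
      have "continuous_on UNIV (\<lambda>x. mat_exp (mat_lincomb n d A (\<lambda>i. a x (Yv i))) $$ (k, l))"
        by (rule continuous_mat_exp) (auto simp: v mat_lincomb_def a_def intro!: continuous_intros)
      moreover have "mat_exp (mat_lincomb n d A z) \<in> carrier_mat n n" for z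
        by (simp add: mat_exp_def mat_lincomb_def)
      ultimately show "continuous_on UNIV (\<lambda>x. case v of Xv k l \<Rightarrow>
          cmat (mat_exp (mat_lincomb n d A (\<lambda>i. a x (Yv i)))) $$ (k, l) | _ \<Rightarrow> 0)"
        using v by (simp add: cmat_def carrier_matD[of _ n n] continuous_on_of_real)
    qed
  qed
  then show ?thesis by (simp add: F_def a_def)
qed

text \<open>A Vandermonde argument. By linearity, vanishing at all times \<open>k\<close> gives the
  same with a polynomial \<open>p\<close> evaluated at the distinct numbers
  \<open>exp \<mu>\<close>; the polynomial chosen vanishes at all of them but one.\<close>

lemma exp_linear_independent:
  fixes c :: "real \<Rightarrow> complex"
  assumes "finite M" "\<And>k::nat. (\<Sum>\<mu>\<in>M. c \<mu> * of_real (exp (k * \<mu>))) = 0" "\<mu>0 \<in> M"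
  shows "c \<mu>0 = 0"
proof -
  define e where "e = (\<lambda>\<mu>::real. complex_of_real (exp \<mu>))"
  have inj: "e \<mu> = e \<nu> \<Longrightarrow> \<mu> = \<nu>" for \<mu> \<nu> by (simp add: e_def)
  have *: "(\<Sum>\<mu>\<in>M. c \<mu> * poly p (e \<mu>)) = 0" for p
  proof -
    have "(\<Sum>\<mu>\<in>M. c \<mu> * poly p (e \<mu>)) = (\<Sum>\<mu>\<in>M. \<Sum>k\<le>degree p. coeff p k * (c \<mu> * e \<mu> ^ k))"
      by (simp add: poly_altdef sum_distrib_left algebra_simps)
    also have "\<dots> = (\<Sum>k\<le>degree p. coeff p k * (\<Sum>\<mu>\<in>M. c \<mu> * e \<mu> ^ k))"
      by (subst sum.swap) (simp add: sum_distrib_left)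
    also have "\<dots> = 0"
      using assms(2) by (intro sum.neutral) (auto simp: e_def exp_of_nat_mult)
    finally show ?thesis .
  qed
  have "(\<Sum>\<mu>\<in>M. c \<mu> * (\<Prod>\<nu>\<in>M - {\<mu>0}. e \<mu> - e \<nu>)) = 0"
    using *[of "\<Prod>\<nu>\<in>M - {\<mu>0}. [:- e \<nu>, 1:]"] by (simp add: prod_linear_roots)
  moreover have "(\<Sum>\<mu>\<in>M. c \<mu> * (\<Prod>\<nu>\<in>M - {\<mu>0}. e \<mu> - e \<nu>)) = c \<mu>0 * (\<Prod>\<nu>\<in>M - {\<mu>0}. e \<mu>0 - e \<nu>)"
  proof -
    have "(\<Prod>\<nu>\<in>M - {\<mu>0}. e \<mu> - e \<nu>) = 0" if "\<mu> \<in> M - {\<mu>0}" for \<mu>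
      using that assms(1) by (intro prod_zero) auto
    then show ?thesis using assms(1,3) by (subst sum.remove[of _ \<mu>0]) (auto intro!: sum.neutral)
  qed
  ultimately show ?thesis using assms(1) inj by auto
qed

section \<open>Distinct eigenvalues\<close>

interpretation to_fract: inj_idom_hom to_fract
  by unfold_locales auto

interpretation mp_to_fract: map_poly_comm_ring_hom to_fract ..

interpretation mp_of_real: map_poly_comm_ring_hom complex_of_real ..

lemma map_poly_to_fract_inject: "map_poly to_fract p = map_poly to_fract q \<Longrightarrow> p = q"
  by (simp add: poly_eq_iff)

lemma fract_poly_clear_denominators:
  fixes q :: "'a::idom fract poly"
  shows "\<exists>e q'. e \<noteq> 0 \<and> smult (to_fract e) q = map_poly to_fract q'"
proof (induct q)
  case 0
  show ?case by (intro exI[of _ 1] exI[of _ 0]) simp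
next
  case (pCons c q)
  then obtain e q' where e: "e \<noteq> 0" "smult (to_fract e) q = map_poly to_fract q'" by blast
  obtain a b where ab: "c = to_fract a / to_fract b" "b \<noteq> 0"
    by (cases c) (auto simp: Fract_conv_to_fract)
  have "smult (to_fract (b * e)) (pCons c q) = map_poly to_fract (pCons (e * a) (smult b q'))"
    using ab e by (simp add: to_fract.map_poly_pCons_hom to_fract.map_poly_hom_smult flip: e(2))
  with e(1) ab(2) show ?case by (metis mult_eq_0_iff)
qed

lemma poly_pderiv_linear_factor: "poly (pderiv ([:- t, 1:] * q)) t = poly q t" for t :: "'a::idom"
  by (simp add: pderiv_mult pderiv_pCons del: mult_pCons_left)

text \<open>Turns the count of roots in an algebraic closure into an identity over the base ring,
  which survives every specialisation: where \<open>h\<close> is nonzero, the specialised polynomial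
  has no multiple root.\<close>

lemma separable_bezout:
  fixes P :: "'a::idom poly"
  assumes P: "degree P = n" "coeff P n = 1"
    and card: "card {t. poly (map_poly (\<lambda>c. to_ac (to_fract c)) P) t = 0} = n"
  shows "\<exists>u v h. h \<noteq> 0 \<and> u * P + v * pderiv P = [:h:]"
proof (cases "n = 0")
  case True
  then have "P = [:1:]" using P by (metis degree_0_id monom_0 monom_eq_iff degree_eq_zeroE coeff_pCons_0)
  then show ?thesis by (intro exI[of _ 1] exI[of _ 0] exI[of _ 1]) simp
next
  case False
  interpret ac: inj_idom_hom "to_ac :: 'a fract \<Rightarrow> _" by unfold_locales auto
  interpret mac: map_poly_comm_ring_hom "to_ac :: 'a fract \<Rightarrow> _" ..
  interpret e: inj_idom_hom "\<lambda>c::'a. to_ac (to_fract c)" by unfold_locales auto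
  let ?Q = "map_poly to_fract P" and ?R = "map_poly (\<lambda>c. to_ac (to_fract c)) P"
  have RQ: "map_poly to_ac ?Q = ?R" by (intro poly_eqI) (simp add: coeff_map_poly)
  have R: "degree ?R = n" "coeff ?R n = 1" using P by auto
  \<comment> \<open>A double root \<open>t\<close> leaves a cofactor \<open>r\<close> of degree n -
    2, hence at most n - 1 roots in all.\<close>
  have simple: "poly (pderiv ?R) t \<noteq> 0" if t: "poly ?R t = 0" for t
  proof
    assume t': "poly (pderiv ?R) t = 0"
    obtain q where q: "?R = [:- t, 1:] * q" using t by (auto simp: poly_eq_0_iff_dvd)
    have "poly q t = 0" using t' unfolding q poly_pderiv_linear_factor .
    then obtain r where r: "q = [:- t, 1:] * r" by (auto simp: poly_eq_0_iff_dvd)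
    have nz: "?R \<noteq> 0" using R by auto
    then have "r \<noteq> 0" using q r by auto
    then have "degree ?R = 2 + degree r" unfolding q r by (simp add: degree_mult_eq del: mult_pCons_left)
    have "{x. poly ?R x = 0} \<subseteq> insert t {x. poly r x = 0}" unfolding q r by auto
    then have "card {x. poly ?R x = 0} \<le> card (insert t {x. poly r x = 0})"
      by (intro card_mono) (auto simp: poly_roots_finite[OF \<open>r \<noteq> 0\<close>])
    also have "\<dots> \<le> Suc (card {x. poly r x = 0})" by (rule card_insert_le_m1) auto
    also have "\<dots> \<le> Suc (degree r)" using card_poly_roots_bound[OF \<open>r \<noteq> 0\<close>] by simp
    finally show False using card R \<open>degree ?R = 2 + degree r\<close> by simp
  qed
  define J where "J = {u * ?Q + v * pderiv ?Q | u v. True}"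
  have QJ: "?Q \<in> J" unfolding J_def by (rule CollectI, rule exI[of _ 1], rule exI[of _ 0]) simp
  have Q'J: "pderiv ?Q \<in> J" unfolding J_def by (rule CollectI, rule exI[of _ 0], rule exI[of _ 1]) simp
  have Q0: "?Q \<noteq> 0" using P by auto
  \<comment> \<open>An element of minimal degree generates the ideal of the polynomial and its
    derivative; a root of it would be a common root of both.\<close>
  obtain g where g: "g \<in> J" "g \<noteq> 0" and min: "\<And>g'. g' \<in> J \<Longrightarrow> g' \<noteq> 0 \<Longrightarrow> degree g \<le> degree g'"
    using ex_has_least_nat[of "\<lambda>g. g \<in> J \<and> g \<noteq> 0" ?Q degree] QJ Q0 by blast
  obtain u v where uv: "g = u * ?Q + v * pderiv ?Q" using g(1) by (auto simp: J_def)
  have dvd: "g dvd p" if p: "p \<in> J" for p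
  proof -
    obtain u' v' where p': "p = u' * ?Q + v' * pderiv ?Q" using p by (auto simp: J_def)
    have "p mod g = p - p div g * g" by (simp add: minus_div_mult_eq_mod)
    also have "\<dots> = (u' - p div g * u) * ?Q + (v' - p div g * v) * pderiv ?Q"
      by (subst (1) p', subst (2) uv) (simp add: algebra_simps)
    finally have "p mod g \<in> J" unfolding J_def by blast
    then have "p mod g = 0"
      using min[of "p mod g"] degree_mod_less[OF g(2), of p] by (cases "p mod g = 0") auto
    then show ?thesis by (simp add: dvd_eq_mod_eq_0)
  qed
  have "degree g = 0"
  proof (rule ccontr)
    assume "degree g \<noteq> 0"
    then have "degree (map_poly to_ac g) > 0" by simp
    then obtain t where t: "poly (map_poly to_ac g) t = 0"
      using alg_closed_imp_poly_has_root by blast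
    have root: "poly (map_poly to_ac p) t = 0" if "p \<in> J" for p
    proof -
      have "g dvd p" by (rule dvd) (rule that)
      then obtain k where "p = g * k" by (rule dvdE)
      then show ?thesis using t by (simp add: mac.hom_mult)
    qed
    show False using simple[of t] root[OF QJ] root[OF Q'J] by (simp add: RQ ac.map_poly_pderiv)
  qed
  then obtain c where c: "g = [:c:]" "c \<noteq> 0" using g(2) by (metis degree_eq_zeroE pCons_0_0)
  obtain e1 u' where u': "e1 \<noteq> 0" "smult (to_fract e1) u = map_poly to_fract u'"
    using fract_poly_clear_denominators by blast
  obtain e2 v' where v': "e2 \<noteq> 0" "smult (to_fract e2) v = map_poly to_fract v'"
    using fract_poly_clear_denominators by blast
  obtain a b where ab: "c = to_fract a / to_fract b" "b \<noteq> 0" "a \<noteq> 0"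
    using c(2) by (cases c) (auto simp: Fract_conv_to_fract)
  have "map_poly to_fract (smult (b * e2) u' * P + smult (b * e1) v' * pderiv P)
      = smult (to_fract (b * e1 * e2)) (u * ?Q + v * pderiv ?Q)"
    by (simp add: to_fract.map_poly_hom_add mp_to_fract.hom_mult to_fract.map_poly_hom_smult
        to_fract.map_poly_pderiv smult_add_right ac_simps flip: u'(2) v'(2))
  also have "\<dots> = smult (to_fract (b * e1 * e2)) [:c:]" by (simp only: c flip: uv)
  also have "\<dots> = map_poly to_fract [:a * e1 * e2:]"
    using ab by (simp add: to_fract.map_poly_pCons_hom)
  finally have "smult (b * e2) u' * P + smult (b * e1) v' * pderiv P = [:a * e1 * e2:]"
    by (rule map_poly_to_fract_inject)
  moreover have "a * e1 * e2 \<noteq> 0" using ab u' v' by simp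
  ultimately show ?thesis by blast
qed

section \<open>Real symmetric matrices with separable characteristic polynomial\<close>

lemma symmetric_real_roots:
  fixes M :: "real mat"
  assumes M: "M \<in> carrier_mat n n" and sym: "\<And>s t. s < n \<Longrightarrow> t < n \<Longrightarrow> M $$ (s, t) = M $$ (t, s)"
    and z: "poly (map_poly complex_of_real (char_poly M)) z = 0"
  shows "z \<in> \<real>"
proof -
  let ?M = "map_mat complex_of_real M"
  have M': "?M \<in> carrier_mat n n" using M by simp
  have "poly (char_poly ?M) z = 0" using z by (simp add: of_real_hom.char_poly_hom[OF M])
  then have "eigenvalue ?M z" by (simp add: eigenvalue_root_char_poly[OF M'])
  then obtain v where v: "v \<in> carrier_vec n" "v \<noteq> 0\<^sub>v n" "?M *\<^sub>v v = z \<cdot>\<^sub>v v"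
    using M by (auto simp: eigenvalue_def eigenvector_def)
  have e: "(\<Sum>t<n. of_real (M $$ (s, t)) * v $ t) = z * v $ s" if "s < n" for s
    using arg_cong[OF v(3), of "\<lambda>w :: complex Matrix.vec. w $ s"] that v(1) M by (simp add: scalar_prod_def atLeast0LessThan)
  \<comment> \<open>\<open>z * N\<close> is the Hermitian form of \<open>M\<close> at the
    eigenvector, hence real, and \<open>N\<close> is a positive real number.\<close>
  define N where "N = (\<Sum>s<n. cnj (v $ s) * v $ s)"
  have zN: "z * N = (\<Sum>s<n. \<Sum>t<n. cnj (v $ s) * of_real (M $$ (s, t)) * v $ t)"
    unfolding N_def sum_distrib_left
  proof (rule sum.cong[OF refl])
    fix s assume "s \<in> {..<n}"
    then show "z * (cnj (v $ s) * v $ s) = (\<Sum>t<n. cnj (v $ s) * of_real (M $$ (s, t)) * v $ t)"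
      using e[of s] by (simp add: mult.assoc flip: sum_distrib_left)
  qed
  have "cnj (z * N) = (\<Sum>s<n. \<Sum>t<n. cnj (v $ t) * of_real (M $$ (s, t)) * v $ s)"
    unfolding zN by (simp add: ac_simps)
  also have "\<dots> = z * N"
    unfolding zN by (subst sum.swap) (intro sum.cong refl, use sym in auto)
  finally have 1: "cnj (z * N) = z * N" .
  have N: "N = of_real (\<Sum>s<n. (cmod (v $ s))\<^sup>2)"
    unfolding N_def by (simp add: complex_norm_square mult.commute del: of_real_power)
  have "\<exists>s<n. v $ s \<noteq> 0" using v(1,2) by (metis eq_vecI carrier_vecD index_zero_vec)
  then obtain s where s: "s < n" "v $ s \<noteq> 0" by blast
  have "(cmod (v $ s))\<^sup>2 \<le> (\<Sum>s<n. (cmod (v $ s))\<^sup>2)" by (rule member_le_sum) (use s in auto)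
  then have "N \<noteq> 0" using s N by (auto simp: of_real_eq_0_iff simp del: of_real_sum of_real_power)
  moreover have "cnj N = N" unfolding N by simp
  ultimately have "cnj z = z" using 1 by simp
  then show ?thesis by (simp add: complex_is_Real_iff complex_eq_iff)
qed

text \<open>Symmetry makes the roots real, and a repeated root would make both terms of the Bezout
  identity vanish.\<close>

lemma symmetric_separable_splits:
  fixes M :: "real mat"
  assumes M: "M \<in> carrier_mat n n" and sym: "\<And>s t. s < n \<Longrightarrow> t < n \<Longrightarrow> M $$ (s, t) = M $$ (t, s)"
    and sep: "u * char_poly M + v * pderiv (char_poly M) = [:h:]" "h \<noteq> 0"
  shows "\<exists>l. inj_on l {..<n} \<and> char_poly M = (\<Prod>i<n. [:- l i, 1:])"
proof -
  have M': "map_mat complex_of_real M \<in> carrier_mat n n" using M by simp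
  have hom: "char_poly (map_mat complex_of_real M) = map_poly complex_of_real (char_poly M)"
    by (rule of_real_hom.char_poly_hom[OF M])
  obtain as where as: "map_poly complex_of_real (char_poly M) = (\<Prod>a\<leftarrow>as. [:- a, 1:])" "length as = n"
    using char_poly_factorized[OF M'] by (auto simp: hom)
  have real: "as ! i = of_real (Re (as ! i))" if "i < n" for i
  proof -
    have "poly (map_poly complex_of_real (char_poly M)) (as ! i) = 0"
      unfolding as using that as(2) by (auto simp: poly_prod_list prod_list_zero_iff)
    from symmetric_real_roots[OF M sym this] show ?thesis by (simp add: complex_is_Real_iff complex_eq_iff)
  qed
  let ?l = "\<lambda>i. Re (as ! i)"
  have "map_poly complex_of_real (char_poly M) = (\<Prod>i<n. [:- (as ! i), 1:])"
    unfolding as prod.list_conv_set_nth using as(2) by (simp add: atLeast0LessThan)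
  also have "\<dots> = (\<Prod>i<n. map_poly complex_of_real [:- ?l i, 1:])"
    by (rule prod.cong) (auto simp: of_real_hom.map_poly_pCons_hom real[symmetric])
  also have "\<dots> = map_poly complex_of_real (\<Prod>i<n. [:- ?l i, 1:])"
    by (simp add: mp_of_real.hom_prod)
  finally have C: "char_poly M = (\<Prod>i<n. [:- ?l i, 1:])" by (simp add: poly_eq_iff coeff_map_poly)
  have "inj_on ?l {..<n}"
  proof (rule inj_onI, rule ccontr)
    fix i j assume ij: "i \<in> {..<n}" "j \<in> {..<n}" "?l i = ?l j" "i \<noteq> j"
    define q where "q = (\<Prod>k\<in>{..<n} - {i} - {j}. [:- ?l k, 1:])"
    have Cq: "char_poly M = [:- ?l i, 1:] * ([:- ?l i, 1:] * q)"
      unfolding C q_def using ij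
      by (subst prod.remove[of _ i], simp, simp, subst prod.remove[of _ j], auto)
    have "poly (u * char_poly M + v * pderiv (char_poly M)) (?l i) = 0"
      unfolding Cq by (simp only: poly_add poly_mult poly_pderiv_linear_factor) simp
    then show False using sep by simp
  qed
  with C show ?thesis by blast
qed

section \<open>The characteristic polynomial of a pencil\<close>

lemma pencil_carrier [simp]: "pencil n d A \<in> carrier_mat n n"
  by (simp add: pencil_def)

lemma pencil_entry_in:
  assumes K: "subring_set K" and A: "\<And>i. i < d \<Longrightarrow> A i $$ (s, t) \<in> K" and st: "s < n" "t < n"
    and Y: "yvars d \<subseteq> Y"
  shows "pencil n d A $$ (s, t) \<in> mpolys K Y"
proof -
  have "mvar (Yv i) * mconst (A i $$ (s, t)) \<in> mpolys K Y" if "i < d" for i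
    by (intro mpolys_closed(6)[OF K] mvar_mpolys mconst_mpolys K A that)
       (use that Y in \<open>auto simp: yvars_def\<close>)
  then show ?thesis using st by (auto simp: pencil_def intro!: mpolys_closed(8)[OF K])
qed

lemma meval_pencil: "map_mat (meval a) (pencil n d A) = mat_lincomb n d A (\<lambda>i. a (Yv i))"
  by (rule eq_matI) (auto simp: pencil_def mat_lincomb_def meval.hom_sum meval.hom_mult)

lemma meval_char_poly:
  "map_poly (meval a) (char_poly (pencil n d A)) = char_poly (mat_lincomb n d A (\<lambda>i. a (Yv i)))"
  by (simp add: meval_pencil flip: meval.char_poly_hom[OF pencil_carrier])

lemma char_poly_coeff_in:
  assumes S: "subring_set S" and M: "M \<in> carrier_mat n n" "\<And>s t. s < n \<Longrightarrow> t < n \<Longrightarrow> M $$ (s, t) \<in> S"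
  shows "coeff (char_poly M) k \<in> S"
proof -
  have cm: "char_poly_matrix M \<in> carrier_mat n n" using M by simp
  have e: "coeff (char_poly_matrix M $$ (s, t)) k \<in> S" if "s < n" "t < n" for s t k
    using that M S by (auto simp: char_poly_matrix_def coeff_pCons subring_setD split: nat.splits)
  have sg: "coeff (signof p :: 'a poly) k \<in> S" for p k
    using S by (auto simp: sign_def coeff_1 subring_setD)
  show ?thesis
    unfolding char_poly_def det_def'[OF cm] coeff_sum
    by (intro subring_setD(8)[OF S] coeff_mult_in[OF S] sg coeff_prod_in[OF S] e)
       (auto dest: permutes_in_image)
qed

lemma pencil_char_poly_eq:
  "pencil_char_poly n d A = smult ((- 1) ^ n) (char_poly (pencil n d A))"
proof -
  have "map_mat (\<lambda>a. [:a:]) (pencil n d A) - [:0, 1:] \<cdot>\<^sub>m 1\<^sub>m n = (- 1) \<cdot>\<^sub>m char_poly_matrix (pencil n d A)"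
    by (rule eq_matI) (auto simp: char_poly_matrix_def carrier_matD[OF pencil_carrier])
  moreover have "dim_col (char_poly_matrix (pencil n d A)) = n"
    using char_poly_matrix_closed[OF pencil_carrier] by blast
  moreover have "(- 1 :: rpoly poly) ^ n = [:(- 1) ^ n:]"
    by (induct n) (auto simp: one_pCons)
  ultimately show ?thesis by (simp add: pencil_char_poly_def char_poly_def)
qed

text \<open>The Bezout identity arises with all variables at once. Freezing every variable other
  than y at the coordinates of a point \<open>b\<close> where \<open>h0\<close> is nonzero leaves
  the characteristic polynomial unchanged and brings the Bezout constant into \<real>[y].\<close>

lemma ex_discriminant:
  assumes sym: "\<forall>i<d. A i \<in> sym_mats n" and dist: "distinct_eigenvalues n d A"
  shows "\<exists>h :: rpoly. h \<noteq> 0 \<and> mvars h \<subseteq> yvars d \<and> (\<forall>a. meval a h \<noteq> 0 \<longrightarrow>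
    (\<exists>l. inj_on l {..<n} \<and> map_poly (meval a) (char_poly (pencil n d A)) = (\<Prod>i<n. [:- l i, 1:])))"
proof -
  let ?C = "char_poly (pencil n d A)"
  have C: "degree ?C = n" "coeff ?C n = 1" using degree_monic_char_poly[of "pencil n d A" n] by auto
  interpret e: idom_hom "\<lambda>c::rpoly. to_ac (to_fract c)" by unfold_locales auto
  have "poly (map_poly (\<lambda>c. to_ac (to_fract c)) (pencil_char_poly n d A)) t = 0 \<longleftrightarrow>
      poly (map_poly (\<lambda>c. to_ac (to_fract c)) ?C) t = 0" for t
    by (simp add: pencil_char_poly_eq e.map_poly_hom_smult)
  then have "card {t. poly (map_poly (\<lambda>c. to_ac (to_fract c)) ?C) t = 0} = n"
    using dist by (simp add: distinct_eigenvalues_def)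
  from separable_bezout[OF C this] obtain u v h0 where uv: "h0 \<noteq> 0" "u * ?C + v * pderiv ?C = [:h0:]" by blast
  obtain b where b: "meval b h0 \<noteq> 0"
    using meval_zero_imp_zero[of "UNIV :: real set" h0] uv(1) by (auto simp: infinite_UNIV_char_0)
  define \<theta> where "\<theta> v = (if v \<in> yvars d then mvar v else mconst (b v) :: rpoly)" for v
  define s where "s = mhom mconst \<theta>"
  interpret s: comm_ring_hom s unfolding s_def by (rule mconst.mhom_hom)
  interpret s: idom_hom s ..
  interpret ms: map_poly_comm_ring_hom s ..
  have "meval b (s h0) = meval b h0"
    by (simp add: s_def meval_mhom_mconst \<theta>_def if_distrib[of "meval b"] cong: if_cong)
  then have h: "s h0 \<noteq> 0" using b by auto
  have "h0 \<in> mpolys UNIV UNIV" by (simp add: mpolys_iff)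
  then have "s h0 \<in> mpolys UNIV (yvars d)"
    unfolding s_def by (rule mhom_mpolys) (auto simp: \<theta>_def comm_ring_hom_mconst)
  then have hv: "mvars (s h0) \<subseteq> yvars d" by (simp add: mpolys_iff)
  have "s c = c" if "c \<in> mpolys UNIV (yvars d)" for c
  proof -
    have "s c = mhom mconst mvar c" unfolding s_def
      by (rule mhom_cong) (use that in \<open>auto simp: mpolys_iff \<theta>_def\<close>)
    then show ?thesis by (simp add: mhom_mconst_mvar)
  qed
  moreover have "coeff ?C k \<in> mpolys UNIV (yvars d)" for k
    by (rule char_poly_coeff_in[OF _ pencil_carrier]) (auto intro: pencil_entry_in)
  ultimately have sC: "map_poly s ?C = ?C" by (intro poly_eqI) simp
  have uv': "map_poly s u * ?C + map_poly s v * pderiv ?C = [:s h0:]"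
    using arg_cong[OF uv(2), of "map_poly s"]
    by (simp add: s.map_poly_hom_add ms.hom_mult s.map_poly_pderiv s.map_poly_pCons_hom sC)
  have "\<exists>l. inj_on l {..<n} \<and> map_poly (meval a) ?C = (\<Prod>i<n. [:- l i, 1:])" if a: "meval a (s h0) \<noteq> 0" for a
  proof -
    interpret m: idom_hom "meval a :: rpoly \<Rightarrow> real" ..
    let ?M = "mat_lincomb n d A (\<lambda>i. a (Yv i))"
    have "?M $$ (k, l) = ?M $$ (l, k)" if "k < n" "l < n" for k l
    proof -
      have "A i $$ (k, l) = A i $$ (l, k)" if "i < d" for i
        using sym that \<open>k < n\<close> \<open>l < n\<close> unfolding sym_mats_def
        by (metis (mono_tags, lifting) carrier_matD index_transpose_mat(1) mem_Collect_eq)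
      then show ?thesis using that by (simp add: mat_lincomb_def)
    qed
    moreover have "map_poly (meval a) (map_poly s u) * char_poly ?M + map_poly (meval a) (map_poly s v) * pderiv (char_poly ?M) = [:meval a (s h0):]"
      using arg_cong[OF uv', of "map_poly (meval a)"]
      by (simp add: mp_meval.hom_add mp_meval.hom_mult m.map_poly_pderiv meval.map_poly_pCons_hom meval_char_poly)
    ultimately show ?thesis
      unfolding meval_char_poly using a by (intro symmetric_separable_splits) auto
  qed
  with h hv show ?thesis by blast
qed

lemma root_family_pencil:
  assumes K: "subring_set K" and A: "\<And>i s t. i < d \<Longrightarrow> s < n \<Longrightarrow> t < n \<Longrightarrow> A i $$ (s, t) \<in> K"
    and Y: "yvars d \<subseteq> Y" "Y \<inter> lvars n = {}" and h: "h \<noteq> 0" "mvars h \<inter> lvars n = {}"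
    and split: "\<And>a. meval a h \<noteq> 0 \<Longrightarrow>
      \<exists>l. inj_on l {..<n} \<and> map_poly (meval a) (char_poly (pencil n d A)) = (\<Prod>i<n. [:- l i, 1:])"
  shows "root_family K Y n (char_poly (pencil n d A)) h"
proof
  show "coeff (char_poly (pencil n d A)) k \<in> mpolys K Y" for k
    by (rule char_poly_coeff_in[OF subring_set_mpolys[OF K] pencil_carrier])
       (rule pencil_entry_in[OF K A _ _ Y(1)], auto)
qed (use assms degree_monic_char_poly[of "pencil n d A" n] in auto)

section \<open>Zariski closures\<close>

abbreviation "xpolys n \<equiv> mpolys (UNIV :: complex set) (xvars n)"

abbreviation matval :: "complex mat \<Rightarrow> var \<Rightarrow> complex" where
  "matval M \<equiv> (\<lambda>v. case v of Xv k l \<Rightarrow> M $$ (k, l) | _ \<Rightarrow> 0)"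

lemma zariski_closure_iff:
  assumes "S \<subseteq> sym_mats n"
  shows "M \<in> zariski_closure n S \<longleftrightarrow> M \<in> sym_mats n \<and>
    (\<forall>f\<in>xpolys n. (\<forall>N\<in>S. eval_at_mat N f = 0) \<longrightarrow> eval_at_mat M f = 0)" (is "_ \<longleftrightarrow> ?R")
proof
  assume M: "M \<in> zariski_closure n S"
  let ?F = "{f \<in> xpolys n. \<forall>N\<in>S. eval_at_mat N f = 0}"
  let ?V = "{M \<in> sym_mats n. \<forall>f\<in>?F. eval_at_mat M f = 0}"
  have "zariski_closed n ?V" unfolding zariski_closed_def by (intro exI[of _ ?F]) auto
  moreover have "S \<subseteq> ?V" using assms by auto
  ultimately have "M \<in> ?V" using M unfolding zariski_closure_def by blast
  then show ?R by auto
next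
  assume ?R
  then show "M \<in> zariski_closure n S"
    unfolding zariski_closure_def zariski_closed_def by blast
qed

lemma zariski_closed_closure: "S \<subseteq> sym_mats n \<Longrightarrow> zariski_closed n (zariski_closure n S)"
  unfolding zariski_closed_def
  by (intro exI[of _ "{f \<in> xpolys n. \<forall>N\<in>S. eval_at_mat N f = 0}"]) (auto simp: zariski_closure_iff)

lemma closure_superset: "S \<subseteq> zariski_closure n S"
  by (auto simp: zariski_closure_def)

lemma vanishing_on_closure:
  "S \<subseteq> sym_mats n \<Longrightarrow> f \<in> xpolys n \<Longrightarrow> (\<forall>M\<in>S. eval_at_mat M f = 0) \<Longrightarrow> M \<in> zariski_closure n S \<Longrightarrow>
    eval_at_mat M f = 0"
  by (auto simp: zariski_closure_iff)

lemma zariski_closure_eqI: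
  assumes "S \<subseteq> sym_mats n" "T \<subseteq> sym_mats n"
    and "\<And>f. f \<in> xpolys n \<Longrightarrow> (\<forall>M\<in>S. eval_at_mat M f = 0) \<longleftrightarrow> (\<forall>M\<in>T. eval_at_mat M f = 0)"
  shows "zariski_closure n S = zariski_closure n T"
  using assms by (auto simp: zariski_closure_iff)

lemma eval_at_mat_mult: "eval_at_mat M (f * g) = eval_at_mat M f * eval_at_mat M g"
  by (simp add: eval_at_mat_def meval.hom_mult)

lemma irreducible_closure:
  assumes S: "S \<subseteq> sym_mats n" "S \<noteq> {}"
    and prime: "\<And>f g. f \<in> xpolys n \<Longrightarrow> g \<in> xpolys n \<Longrightarrow> (\<forall>M\<in>S. eval_at_mat M (f * g) = 0) \<Longrightarrow>
      (\<forall>M\<in>S. eval_at_mat M f = 0) \<or> (\<forall>M\<in>S. eval_at_mat M g = 0)"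
  shows "irreducible_variety n (zariski_closure n S)"
  unfolding irreducible_variety_def
proof (intro conjI allI impI zariski_closed_closure S(1))
  show "zariski_closure n S \<noteq> {}" using S(2) closure_superset[of S n] by auto
  fix V1 V2
  let ?V = "zariski_closure n S"
  assume "zariski_closed n V1 \<and> zariski_closed n V2 \<and> ?V = V1 \<union> V2"
  then obtain F1 F2 where F: "F1 \<subseteq> xpolys n" "V1 = {M \<in> sym_mats n. \<forall>f\<in>F1. eval_at_mat M f = 0}"
    "F2 \<subseteq> xpolys n" "V2 = {M \<in> sym_mats n. \<forall>f\<in>F2. eval_at_mat M f = 0}" and V: "?V = V1 \<union> V2"
    unfolding zariski_closed_def by blast
  have sym: "?V \<subseteq> sym_mats n" by (auto simp: zariski_closure_iff S)
  show "?V = V1 \<or> ?V = V2"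
  proof (rule ccontr)
    assume "\<not> ?thesis"
    then obtain M1 M2 where "M1 \<in> ?V" "M1 \<notin> V1" "M2 \<in> ?V" "M2 \<notin> V2" using V by blast
    then obtain f g where f: "f \<in> F1" "eval_at_mat M1 f \<noteq> 0" and g: "g \<in> F2" "eval_at_mat M2 g \<noteq> 0"
      using F(2,4) sym by blast
    have "\<forall>M\<in>S. eval_at_mat M (f * g) = 0"
      using f(1) g(1) F(2,4) V closure_superset[of S n] by (force simp: eval_at_mat_mult)
    then have "(\<forall>M\<in>S. eval_at_mat M f = 0) \<or> (\<forall>M\<in>S. eval_at_mat M g = 0)"
      using f(1) g(1) F(1,3) by (intro prime) auto
    then show False
      using vanishing_on_closure[OF S(1)] f g F(1,3) \<open>M1 \<in> ?V\<close> \<open>M2 \<in> ?V\<close> by blast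
  qed
qed

section \<open>Images of rational maps\<close>

text \<open>All entries share one denominator, as the parametrisation produces it;
  \<open>unirational\<close> allows one for each entry.\<close>

definition rational_image :: "nat \<Rightarrow> (nat \<Rightarrow> nat \<Rightarrow> (nat, complex) mpoly) \<Rightarrow> (nat, complex) mpoly \<Rightarrow> complex mat set" where
  "rational_image n p q = {M \<in> sym_mats n. \<exists>t :: nat \<Rightarrow> complex. \<forall>k l. k \<le> l \<and> l < n \<longrightarrow>
     meval t q \<noteq> 0 \<and> M $$ (k, l) = meval t (p k l) / meval t q}"

definition rational_value :: "(nat \<Rightarrow> nat \<Rightarrow> (nat, complex) mpoly) \<Rightarrow> (nat, complex) mpoly \<Rightarrow> (nat \<Rightarrow> complex) \<Rightarrow> var \<Rightarrow> complex" where
  "rational_value p q t v = (case v of Xv k l \<Rightarrow> meval t (p k l) / meval t q | _ \<Rightarrow> 0)"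

lemma rational_image_vanishing:
  assumes n: "n > 0" and f: "f \<in> xpolys n"
  shows "(\<forall>M\<in>rational_image n p q. eval_at_mat M f = 0) \<longleftrightarrow>
    (\<forall>t. meval t q \<noteq> 0 \<longrightarrow> meval (rational_value p q t) f = 0)"
proof (intro iffI ballI allI impI)
  fix t assume v: "\<forall>M\<in>rational_image n p q. eval_at_mat M f = 0" and t: "meval t q \<noteq> 0"
  define M where "M = Matrix.mat n n (\<lambda>(k, l). rational_value p q t (Xv (min k l) (max k l)))"
  have "M \<in> rational_image n p q"
    unfolding rational_image_def
    by (auto simp: M_def sym_mats_def min.commute max.commute rational_value_def t
        min_absorb1 max_absorb2 intro!: exI[of _ t] eq_matI)
  then have "eval_at_mat M f = 0" using v by blast
  moreover have "eval_at_mat M f = meval (rational_value p q t) f"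
    unfolding eval_at_mat_def
    by (rule meval_cong) (use f in \<open>auto simp: mpolys_iff xvars_def M_def min_absorb1 max_absorb2 dest!: subsetD\<close>)
  ultimately show "meval (rational_value p q t) f = 0" by simp
next
  fix M assume v: "\<forall>t. meval t q \<noteq> 0 \<longrightarrow> meval (rational_value p q t) f = 0" and "M \<in> rational_image n p q"
  then obtain t where t: "\<And>k l. k \<le> l \<Longrightarrow> l < n \<Longrightarrow> meval t q \<noteq> 0 \<and> M $$ (k, l) = meval t (p k l) / meval t q"
    by (auto simp: rational_image_def)
  have "eval_at_mat M f = meval (rational_value p q t) f"
    unfolding eval_at_mat_def
    by (rule meval_cong) (use f t in \<open>auto simp: mpolys_iff xvars_def rational_value_def dest!: subsetD\<close>)
  \<comment> \<open>The index (0, 0) exists because n is positive; membership in the image says that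
    \<open>q\<close> is nonzero at \<open>t\<close> only through an entry.\<close>
  then show "eval_at_mat M f = 0" using v t[of 0 0] n by simp
qed

text \<open>The pullback of \<open>f\<close> has a power of \<open>q\<close> as denominator, so that
  questions on rational functions become questions on polynomials.\<close>

lemma rational_numerator:
  fixes f :: "(var, complex) mpoly"
  assumes f: "f \<in> xpolys n"
  shows "\<exists>e F. \<forall>t. meval t q \<noteq> 0 \<longrightarrow> meval t F = meval t q ^ e * meval (rational_value p q t) f"
  using f subring_set_UNIV
proof (induct rule: mpolys_induct)
  case (const c)
  show ?case by (intro exI[of _ 0] exI[of _ "mconst c"]) simp
next
  case (var v)
  then obtain k l where "v = Xv k l" by (auto simp: xvars_def)
  then show ?case
    by (intro exI[of _ 1] exI[of _ "p k l"]) (simp add: rational_value_def)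
next
  case (add f g)
  then obtain e1 F1 e2 F2 where
    "\<And>t. meval t q \<noteq> 0 \<Longrightarrow> meval t F1 = meval t q ^ e1 * meval (rational_value p q t) f"
    "\<And>t. meval t q \<noteq> 0 \<Longrightarrow> meval t F2 = meval t q ^ e2 * meval (rational_value p q t) g" by blast
  then show ?case
    by (intro exI[of _ "e1 + e2"] exI[of _ "q ^ e2 * F1 + q ^ e1 * F2"])
       (simp add: meval.hom_add meval.hom_mult meval.hom_power power_add algebra_simps)
next
  case (mult f g)
  then obtain e1 F1 e2 F2 where
    "\<And>t. meval t q \<noteq> 0 \<Longrightarrow> meval t F1 = meval t q ^ e1 * meval (rational_value p q t) f"
    "\<And>t. meval t q \<noteq> 0 \<Longrightarrow> meval t F2 = meval t q ^ e2 * meval (rational_value p q t) g" by blast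
  then show ?case
    by (intro exI[of _ "e1 + e2"] exI[of _ "F1 * F2"])
       (simp add: meval.hom_mult power_add algebra_simps)
qed

text \<open>The parametrisation is controlled at real parameters off some \<open>g\<close> only;
  these are Zariski dense, which forces the numerator to be zero.\<close>

lemma rational_vanishing_real:
  fixes f :: "(var, complex) mpoly"
  assumes f: "f \<in> xpolys n" and q: "q \<noteq> 0" and g: "g \<noteq> 0"
    and van: "\<And>t. range t \<subseteq> range complex_of_real \<Longrightarrow> meval t q \<noteq> 0 \<Longrightarrow> meval t g \<noteq> 0 \<Longrightarrow> meval (rational_value p q t) f = 0"
    and t: "meval t q \<noteq> 0"
  shows "meval (rational_value p q t) f = 0"
proof -
  obtain e F where F: "\<And>t. meval t q \<noteq> 0 \<Longrightarrow> meval t F = meval t q ^ e * meval (rational_value p q t) f"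
    using rational_numerator[OF f] by blast
  have "F * (q * g) = 0"
  proof (rule meval_zero_imp_zero)
    show "infinite (range complex_of_real)"
      by (simp add: finite_image_iff inj_of_real infinite_UNIV_char_0)
    fix t :: "nat \<Rightarrow> complex" assume t: "range t \<subseteq> range complex_of_real"
    show "meval t (F * (q * g)) = 0"
    proof (cases "meval t q = 0 \<or> meval t g = 0")
      case False
      then show ?thesis using F[of t] van[OF t] by (simp add: meval.hom_mult)
    qed (auto simp: meval.hom_mult)
  qed
  then have "F = 0" using q g by auto
  then show ?thesis using F[OF t] t by auto
qed

text \<open>A product that vanishes on the image pulls back to a zero product in a polynomial ring
  over the complex numbers, which is a domain.\<close>

lemma rational_image_irreducible:
  assumes n: "n > 0" and q: "q \<noteq> 0"
  shows "irreducible_variety n (zariski_closure n (rational_image n p q))"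
proof (rule irreducible_closure)
  show sub: "rational_image n p q \<subseteq> sym_mats n" by (auto simp: rational_image_def)
  obtain t where t: "meval t q \<noteq> 0"
    using meval_zero_imp_zero[of "UNIV :: complex set" q] q by (auto simp: infinite_UNIV_char_0)
  then show "rational_image n p q \<noteq> {}"
    using rational_image_vanishing[OF n, of 1 p q] subring_setD(2)[OF subring_set_mpolys[OF subring_set_UNIV]]
    by (auto simp: meval.hom_one)
  fix f g assume fg: "f \<in> xpolys n" "g \<in> xpolys n" "\<forall>M\<in>rational_image n p q. eval_at_mat M (f * g) = 0"
  obtain e F where F: "\<And>t. meval t q \<noteq> 0 \<Longrightarrow> meval t F = meval t q ^ e * meval (rational_value p q t) f"
    using rational_numerator[OF fg(1)] by blast
  obtain e' G where G: "\<And>t. meval t q \<noteq> 0 \<Longrightarrow> meval t G = meval t q ^ e' * meval (rational_value p q t) g"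
    using rational_numerator[OF fg(2)] by blast
  have fgv: "meval (rational_value p q t) f * meval (rational_value p q t) g = 0" if "meval t q \<noteq> 0" for t
    using rational_image_vanishing[OF n, of "f * g" p q] fg that mpolys_closed(6)[OF subring_set_UNIV fg(1,2)]
    by (simp add: meval.hom_mult)
  have "F * G * q = 0"
  proof (rule meval_zero_imp_zero[of UNIV])
    fix t :: "nat \<Rightarrow> complex"
    show "meval t (F * G * q) = 0"
      using F[of t] G[of t] fgv[of t] by (cases "meval t q = 0") (auto simp: meval.hom_mult)
  qed (auto simp: infinite_UNIV_char_0)
  then have "F = 0 \<or> G = 0" using q by auto
  then show "(\<forall>M\<in>rational_image n p q. eval_at_mat M f = 0) \<or> (\<forall>M\<in>rational_image n p q. eval_at_mat M g = 0)"
    unfolding rational_image_vanishing[OF n fg(1)] rational_image_vanishing[OF n fg(2)]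
    using F G by (metis meval.hom_zero mult_eq_0_iff power_not_zero)
qed

section \<open>Sums of monomials\<close>

text \<open>The coefficient ring is general: complex numbers for values at a point, polynomials for
  expansions in z.\<close>

lemma monomial_sum_add:
  fixes c c' w :: "'b \<Rightarrow> 'a::comm_ring_1"
  assumes "finite S" "finite T"
  shows "(\<Sum>\<alpha>\<in>S. c \<alpha> * w \<alpha>) + (\<Sum>\<alpha>\<in>T. c' \<alpha> * w \<alpha>) =
    (\<Sum>\<alpha>\<in>S \<union> T. ((if \<alpha> \<in> S then c \<alpha> else 0) + (if \<alpha> \<in> T then c' \<alpha> else 0)) * w \<alpha>)"
proof -
  have "(\<Sum>\<alpha>\<in>S. c \<alpha> * w \<alpha>) = (\<Sum>\<alpha>\<in>S \<union> T. (if \<alpha> \<in> S then c \<alpha> else 0) * w \<alpha>)"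
    by (rule sum.mono_neutral_cong_left) (use assms in auto)
  moreover have "(\<Sum>\<alpha>\<in>T. c' \<alpha> * w \<alpha>) = (\<Sum>\<alpha>\<in>S \<union> T. (if \<alpha> \<in> T then c' \<alpha> else 0) * w \<alpha>)"
    by (rule sum.mono_neutral_cong_left) (use assms in auto)
  ultimately show ?thesis by (simp add: distrib_right sum.distrib)
qed

abbreviation add_pair :: "(nat \<Rightarrow> nat) \<times> (nat \<Rightarrow> nat) \<Rightarrow> nat \<Rightarrow> nat" where
  "add_pair \<equiv> \<lambda>p i. fst p i + snd p i"

lemma monomial_sum_mult:
  fixes c c' w :: "(nat \<Rightarrow> nat) \<Rightarrow> 'a::comm_ring_1"
  assumes ST: "finite S" "finite T" and w: "\<And>\<alpha> \<beta>. w (\<lambda>i. \<alpha> i + \<beta> i) = w \<alpha> * w \<beta>"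
  shows "(\<Sum>\<alpha>\<in>S. c \<alpha> * w \<alpha>) * (\<Sum>\<alpha>\<in>T. c' \<alpha> * w \<alpha>) =
    (\<Sum>\<gamma>\<in>add_pair ` (S \<times> T). (\<Sum>p\<in>{p \<in> S \<times> T. add_pair p = \<gamma>}. c (fst p) * c' (snd p)) * w \<gamma>)"
proof -
  have "(\<Sum>\<alpha>\<in>S. c \<alpha> * w \<alpha>) * (\<Sum>\<alpha>\<in>T. c' \<alpha> * w \<alpha>) =
      (\<Sum>p\<in>S \<times> T. (c (fst p) * w (fst p)) * (c' (snd p) * w (snd p)))"
    by (simp only: sum_product sum.cartesian_product split_def)
  also have "\<dots> = (\<Sum>p\<in>S \<times> T. c (fst p) * c' (snd p) * w (add_pair p))"
    by (rule sum.cong) (auto simp: w ac_simps)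
  also have "\<dots> = (\<Sum>\<gamma>\<in>add_pair ` (S \<times> T). \<Sum>p\<in>{p \<in> S \<times> T. add_pair p = \<gamma>}. c (fst p) * c' (snd p) * w (add_pair p))"
    by (rule sum.image_gen) (use ST in auto)
  also have "\<dots> = (\<Sum>\<gamma>\<in>add_pair ` (S \<times> T). (\<Sum>p\<in>{p \<in> S \<times> T. add_pair p = \<gamma>}. c (fst p) * c' (snd p)) * w \<gamma>)"
    unfolding sum_distrib_right by (intro sum.cong refl) auto
  finally show ?thesis .
qed

section \<open>Exponentials of the pencil\<close>

lemma mat_exp_carrier [simp]: "M \<in> carrier_mat n n \<Longrightarrow> mat_exp M \<in> carrier_mat n n"
  by (simp add: mat_exp_def)

lemma cmat_entry: "M \<in> carrier_mat n n \<Longrightarrow> s < n \<Longrightarrow> t < n \<Longrightarrow> cmat M $$ (s, t) = of_real (M $$ (s, t))"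
  by (simp add: cmat_def)

lemma pow_symmetric:
  fixes M :: "'a::comm_ring_1 mat"
  assumes M: "M \<in> carrier_mat n n" "transpose_mat M = M"
  shows "transpose_mat (M ^\<^sub>m r) = M ^\<^sub>m r"
proof (induct r)
  case (Suc r)
  have "M * M ^\<^sub>m r = M ^\<^sub>m r * M" for r
    by (induct r) (use M in \<open>auto simp: assoc_mult_mat[of _ n n _ n _ n, symmetric]\<close>)
  then show ?case using Suc M by (simp add: transpose_mult[of _ n n _ n])
qed (use M in auto)

lemma sym_mats_iff:
  "M \<in> sym_mats n \<longleftrightarrow> M \<in> carrier_mat n n \<and> (\<forall>k<n. \<forall>l<n. M $$ (k, l) = M $$ (l, k))"
proof
  assume M: "M \<in> sym_mats n"
  then have c: "M \<in> carrier_mat n n" "transpose_mat M = M" by (auto simp: sym_mats_def)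
  have "M $$ (k, l) = M $$ (l, k)" if "k < n" "l < n" for k l
  proof -
    have "M $$ (k, l) = transpose_mat M $$ (k, l)" by (simp only: c(2))
    also have "\<dots> = M $$ (l, k)" using that c(1) by simp
    finally show ?thesis .
  qed
  with c show "M \<in> carrier_mat n n \<and> (\<forall>k<n. \<forall>l<n. M $$ (k, l) = M $$ (l, k))" by blast
qed (auto simp: sym_mats_def intro!: eq_matI)

lemma mat_exp_symmetric:
  assumes M: "M \<in> sym_mats n"
  shows "mat_exp M \<in> sym_mats n"
proof -
  have c: "M \<in> carrier_mat n n" "transpose_mat M = M" using M by (auto simp: sym_mats_def)
  have "M ^\<^sub>m r \<in> sym_mats n" for r
    using pow_symmetric[OF c, of r] pow_carrier_mat[OF c(1), of r] by (simp add: sym_mats_def)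
  then show ?thesis using c by (auto simp: sym_mats_iff mat_exp_def)
qed

lemma mat_lincomb_symmetric:
  assumes "\<forall>i<d. A i \<in> sym_mats n"
  shows "mat_lincomb n d A y \<in> sym_mats n"
  using assms by (auto simp: sym_mats_iff mat_lincomb_def)

definition exp_image :: "nat \<Rightarrow> nat \<Rightarrow> (nat \<Rightarrow> real mat) \<Rightarrow> complex mat set" where
  "exp_image n d A = range (\<lambda>y. cmat (mat_exp (mat_lincomb n d A y)))"

lemma gibbs_variety_eq: "gibbs_variety n (mat_span n d A) = zariski_closure n (exp_image n d A)"
  by (simp add: gibbs_variety_def mat_span_def exp_image_def cmat_def image_image)

lemma exp_image_symmetric:
  assumes "\<forall>i<d. A i \<in> sym_mats n"
  shows "exp_image n d A \<subseteq> sym_mats n"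
proof
  fix M assume "M \<in> exp_image n d A"
  then obtain y where M: "M = cmat (mat_exp (mat_lincomb n d A y))" by (auto simp: exp_image_def)
  define N where "N = mat_exp (mat_lincomb n d A y)"
  have "N \<in> sym_mats n"
    unfolding N_def by (rule mat_exp_symmetric[OF mat_lincomb_symmetric[OF assms]])
  then have N: "N \<in> carrier_mat n n" "\<And>k l. k < n \<Longrightarrow> l < n \<Longrightarrow> N $$ (k, l) = N $$ (l, k)"
    by (auto simp: sym_mats_iff)
  have "cmat N \<in> carrier_mat n n" using N(1) by (simp add: cmat_def)
  moreover have "cmat N $$ (k, l) = cmat N $$ (l, k)" if "k < n" "l < n" for k l
    using N(2)[of k l] that by (simp add: cmat_entry[OF N(1)])
  ultimately have "cmat N \<in> sym_mats n" by (auto simp: sym_mats_iff)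
  then show "M \<in> sym_mats n" by (simp add: M N_def)
qed

section \<open>Spectral decomposition at a point\<close>

definition mat_at :: "nat \<Rightarrow> nat \<Rightarrow> (nat \<Rightarrow> real mat) \<Rightarrow> (var \<Rightarrow> real) \<Rightarrow> real mat" where
  "mat_at n d A a = mat_lincomb n d A (\<lambda>i. a (Yv i))"

definition proj_at :: "nat \<Rightarrow> nat \<Rightarrow> (nat \<Rightarrow> real mat) \<Rightarrow> (var \<Rightarrow> real) \<Rightarrow> nat \<Rightarrow> nat \<Rightarrow> nat \<Rightarrow> real" where
  "proj_at n d A a i s t = proj n (mat_at n d A a) (\<lambda>i. a (Lv i)) i s t"

text \<open>The entries of \<phi>(y, \<lambda>, z) at the point \<open>a\<close>, as values of the
  x-variables; for \<open>z i = exp (c * a (Lv i))\<close> they are the entries of the matrix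
  exponential.\<close>

definition xval :: "nat \<Rightarrow> nat \<Rightarrow> (nat \<Rightarrow> real mat) \<Rightarrow> (var \<Rightarrow> real) \<Rightarrow> (nat \<Rightarrow> real) \<Rightarrow> var \<Rightarrow> real" where
  "xval n d A a z v = (case v of Xv s t \<Rightarrow> \<Sum>i<n. z i * proj_at n d A a i s t | _ \<Rightarrow> 0)"

lemma mat_exp_at:
  assumes a: "a \<in> pts n (char_poly (pencil n d A)) h" and st: "s < n" "t < n"
  shows "mat_exp (mat_lincomb n d A (\<lambda>i. c * a (Yv i))) $$ (s, t) =
    (\<Sum>i<n. exp (c * a (Lv i)) * proj_at n d A a i s t)"
  unfolding mat_lincomb_smult proj_at_def mat_at_def
  by (rule mat_exp_smult_spectral) (use a st in \<open>auto simp: pts_def meval_char_poly\<close>)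

lemma eval_exp_at:
  fixes f :: "(var, complex) mpoly"
  assumes a: "a \<in> pts n (char_poly (pencil n d A)) h" and f: "f \<in> xpolys n"
  shows "eval_at_mat (cmat (mat_exp (mat_lincomb n d A (\<lambda>i. c * a (Yv i))))) f =
    meval (\<lambda>v. of_real (xval n d A a (\<lambda>i. exp (c * a (Lv i))) v)) f"
  unfolding eval_at_mat_def
proof (rule meval_cong)
  fix v assume "v \<in> mvars f"
  then have "v \<in> xvars n" using f by (auto simp: mpolys_iff)
  then obtain k l where v: "v = Xv k l" "k < n" "l < n" by (auto simp: xvars_def)
  have "mat_exp (mat_lincomb n d A (\<lambda>i. c * a (Yv i))) \<in> carrier_mat n n" by simp
  then have "cmat (mat_exp (mat_lincomb n d A (\<lambda>i. c * a (Yv i)))) $$ (k, l) =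
      of_real (mat_exp (mat_lincomb n d A (\<lambda>i. c * a (Yv i))) $$ (k, l))"
    using v by (simp add: cmat_def carrier_matD[of _ n n])
  then show "matval (cmat (mat_exp (mat_lincomb n d A (\<lambda>i. c * a (Yv i))))) v =
      of_real (xval n d A a (\<lambda>i. exp (c * a (Lv i))) v)"
    using v by (simp add: xval_def mat_exp_at[OF a])
qed

text \<open>The exponents that occur in \<open>f(\<Sum> z\<^sub>i P\<^sub>i)\<close> do not depend on the matrices \<open>P\<^sub>i\<close>.\<close>

lemma expand_in_z:
  fixes f :: "(var, complex) mpoly"
  assumes f: "f \<in> xpolys n"
  shows "\<exists>S :: (nat \<Rightarrow> nat) set. finite S \<and> (\<forall>a. \<exists>c. \<forall>z.
    meval (\<lambda>v. of_real (xval n d A a z v)) f = (\<Sum>\<alpha>\<in>S. c \<alpha> * of_real (\<Prod>i<n. z i ^ \<alpha> i)))"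
  using f subring_set_UNIV
proof (induct rule: mpolys_induct)
  case (const c)
  show ?case by (intro exI[of _ "{\<lambda>_. 0}"]) (auto intro!: exI[of _ "\<lambda>_. c"])
next
  case (var v)
  then obtain s t where v: "v = Xv s t" by (auto simp: xvars_def)
  let ?e = "\<lambda>i j :: nat. if i = j then 1 else 0 :: nat"
  have e: "(\<Prod>j<n. z j ^ ?e i j) = z i" if "i < n" for i and z :: "nat \<Rightarrow> real"
  proof -
    have "(\<Prod>j<n. z j ^ ?e i j) = (\<Prod>j<n. if j = i then z j else 1)"
      by (rule prod.cong) auto
    then show ?thesis using that by simp
  qed
  have inj: "inj_on ?e {..<n}"
    by (rule inj_onI) (metis zero_neq_one)
  show ?case
  proof (intro exI[of _ "?e ` {..<n}"] conjI allI)
    fix a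
    show "\<exists>c. \<forall>z. meval (\<lambda>v. complex_of_real (xval n d A a z v)) (mvar v) =
        (\<Sum>\<alpha>\<in>?e ` {..<n}. c \<alpha> * of_real (\<Prod>i<n. z i ^ \<alpha> i))"
    proof (intro exI[of _ "\<lambda>\<alpha>. of_real (proj_at n d A a (the_inv_into {..<n} ?e \<alpha>) s t)"] allI)
      fix z
      show "meval (\<lambda>v. complex_of_real (xval n d A a z v)) (mvar v) =
        (\<Sum>\<alpha>\<in>?e ` {..<n}. of_real (proj_at n d A a (the_inv_into {..<n} ?e \<alpha>) s t) * of_real (\<Prod>i<n. z i ^ \<alpha> i))"
        by (subst sum.reindex[OF inj])
           (simp add: the_inv_into_f_f[OF inj] e v xval_def mult.commute del: of_real_prod)
    qed
  qed simp
next
  case (add f g)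
  then obtain S T where S: "finite S" "\<And>a. \<exists>c. \<forall>z. meval (\<lambda>v. of_real (xval n d A a z v)) f = (\<Sum>\<alpha>\<in>S. c \<alpha> * of_real (\<Prod>i<n. z i ^ \<alpha> i))"
    and T: "finite T" "\<And>a. \<exists>c. \<forall>z. meval (\<lambda>v. of_real (xval n d A a z v)) g = (\<Sum>\<alpha>\<in>T. c \<alpha> * of_real (\<Prod>i<n. z i ^ \<alpha> i))"
    by blast
  show ?case
  proof (intro exI[of _ "S \<union> T"] conjI allI)
    fix a
    obtain c c' where c: "\<And>z. meval (\<lambda>v. of_real (xval n d A a z v)) f = (\<Sum>\<alpha>\<in>S. c \<alpha> * of_real (\<Prod>i<n. z i ^ \<alpha> i))"
      "\<And>z. meval (\<lambda>v. of_real (xval n d A a z v)) g = (\<Sum>\<alpha>\<in>T. c' \<alpha> * of_real (\<Prod>i<n. z i ^ \<alpha> i))"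
      using S(2)[of a] T(2)[of a] by blast
    show "\<exists>c. \<forall>z. meval (\<lambda>v. complex_of_real (xval n d A a z v)) (f + g) =
        (\<Sum>\<alpha>\<in>S \<union> T. c \<alpha> * of_real (\<Prod>i<n. z i ^ \<alpha> i))"
      unfolding meval.hom_add c by (intro exI allI) (rule monomial_sum_add[OF S(1) T(1)])
  qed (use S(1) T(1) in auto)
next
  case (mult f g)
  then obtain S T where S: "finite S" "\<And>a. \<exists>c. \<forall>z. meval (\<lambda>v. of_real (xval n d A a z v)) f = (\<Sum>\<alpha>\<in>S. c \<alpha> * of_real (\<Prod>i<n. z i ^ \<alpha> i))"
    and T: "finite T" "\<And>a. \<exists>c. \<forall>z. meval (\<lambda>v. of_real (xval n d A a z v)) g = (\<Sum>\<alpha>\<in>T. c \<alpha> * of_real (\<Prod>i<n. z i ^ \<alpha> i))"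
    by blast
  show ?case
  proof (intro exI[of _ "add_pair ` (S \<times> T)"] conjI allI)
    fix a
    obtain c c' where c: "\<And>z. meval (\<lambda>v. of_real (xval n d A a z v)) f = (\<Sum>\<alpha>\<in>S. c \<alpha> * of_real (\<Prod>i<n. z i ^ \<alpha> i))"
      "\<And>z. meval (\<lambda>v. of_real (xval n d A a z v)) g = (\<Sum>\<alpha>\<in>T. c' \<alpha> * of_real (\<Prod>i<n. z i ^ \<alpha> i))"
      using S(2)[of a] T(2)[of a] by blast
    show "\<exists>c. \<forall>z. meval (\<lambda>v. complex_of_real (xval n d A a z v)) (f * g) =
        (\<Sum>\<gamma>\<in>add_pair ` (S \<times> T). c \<gamma> * of_real (\<Prod>i<n. z i ^ \<gamma> i))"
      unfolding meval.hom_mult c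
      by (intro exI allI) (rule monomial_sum_mult[OF S(1) T(1)], simp add: power_add prod.distrib)
  qed (use S(1) T(1) in auto)
qed

text \<open>
  Along the ray through \<open>y\<close> the function \<open>f\<close> becomes an exponential sum, whose coefficients vanish.
\<close>

lemma frequency_sums_vanish:
  fixes c :: "(nat \<Rightarrow> nat) \<Rightarrow> complex" and l :: "nat \<Rightarrow> real"
  assumes S: "finite S"
    and v: "\<And>k::nat. (\<Sum>\<alpha>\<in>S. c \<alpha> * of_real (\<Prod>i<n. exp (k * l i) ^ \<alpha> i)) = 0"
    and w: "\<And>\<alpha> \<beta>. \<alpha> \<in> S \<Longrightarrow> \<beta> \<in> S \<Longrightarrow> (\<Sum>i<n. \<alpha> i * l i) = (\<Sum>i<n. \<beta> i * l i) \<Longrightarrow> w \<alpha> = w \<beta>"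
  shows "(\<Sum>\<alpha>\<in>S. c \<alpha> * w \<alpha>) = 0"
proof -
  let ?\<mu> = "\<lambda>\<alpha>. \<Sum>i<n. \<alpha> i * l i"
  have e: "(\<Prod>i<n. exp (k * l i) ^ \<alpha> i) = exp (k * ?\<mu> \<alpha>)" for k :: nat and \<alpha> :: "nat \<Rightarrow> nat"
  proof -
    have "(\<Prod>i<n. exp (k * l i) ^ \<alpha> i) = (\<Prod>i<n. exp (\<alpha> i * (k * l i)))"
      by (simp only: exp_of_nat_mult)
    also have "\<dots> = exp (\<Sum>i<n. \<alpha> i * (k * l i))" by (simp add: exp_sum)
    finally show ?thesis by (simp add: sum_distrib_left ac_simps)
  qed
  have "(\<Sum>\<mu>\<in>?\<mu> ` S. (\<Sum>\<alpha>\<in>{\<alpha> \<in> S. ?\<mu> \<alpha> = \<mu>}. c \<alpha>) * of_real (exp (k * \<mu>))) = 0" for k :: nat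
  proof -
    have "0 = (\<Sum>\<alpha>\<in>S. c \<alpha> * of_real (exp (k * ?\<mu> \<alpha>)))" using v[of k] by (simp only: e)
    also have "\<dots> = (\<Sum>\<mu>\<in>?\<mu> ` S. \<Sum>\<alpha>\<in>{\<alpha> \<in> S. ?\<mu> \<alpha> = \<mu>}. c \<alpha> * of_real (exp (k * ?\<mu> \<alpha>)))"
      by (rule sum.image_gen[OF S])
    also have "\<dots> = (\<Sum>\<mu>\<in>?\<mu> ` S. (\<Sum>\<alpha>\<in>{\<alpha> \<in> S. ?\<mu> \<alpha> = \<mu>}. c \<alpha>) * of_real (exp (k * \<mu>)))"
      unfolding sum_distrib_right by (intro sum.cong refl) auto
    finally show ?thesis by simp
  qed
  then have z: "(\<Sum>\<alpha>\<in>{\<alpha> \<in> S. ?\<mu> \<alpha> = \<mu>}. c \<alpha>) = 0" if "\<mu> \<in> ?\<mu> ` S" for \<mu>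
    using exp_linear_independent[of "?\<mu> ` S" "\<lambda>\<mu>. \<Sum>\<alpha>\<in>{\<alpha> \<in> S. ?\<mu> \<alpha> = \<mu>}. c \<alpha>"] S that by auto
  have "(\<Sum>\<alpha>\<in>S. c \<alpha> * w \<alpha>) = (\<Sum>\<mu>\<in>?\<mu> ` S. \<Sum>\<alpha>\<in>{\<alpha> \<in> S. ?\<mu> \<alpha> = \<mu>}. c \<alpha> * w \<alpha>)"
    by (rule sum.image_gen[OF S])
  also have "\<dots> = 0"
  proof (rule sum.neutral, rule ballI)
    fix \<mu> assume \<mu>: "\<mu> \<in> ?\<mu> ` S"
    then obtain \<beta> where \<beta>: "\<beta> \<in> S" "?\<mu> \<beta> = \<mu>" by auto
    have "(\<Sum>\<alpha>\<in>{\<alpha> \<in> S. ?\<mu> \<alpha> = \<mu>}. c \<alpha> * w \<alpha>) = (\<Sum>\<alpha>\<in>{\<alpha> \<in> S. ?\<mu> \<alpha> = \<mu>}. c \<alpha>) * w \<beta>"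
      unfolding sum_distrib_right
    proof (rule sum.cong[OF refl])
      fix \<alpha> assume "\<alpha> \<in> {\<alpha> \<in> S. ?\<mu> \<alpha> = \<mu>}"
      then have "w \<alpha> = w \<beta>" using \<beta> by (intro w) auto
      then show "c \<alpha> * w \<alpha> = c \<alpha> * w \<beta>" by simp
    qed
    then show "(\<Sum>\<alpha>\<in>{\<alpha> \<in> S. ?\<mu> \<alpha> = \<mu>}. c \<alpha> * w \<alpha>) = 0" using z[OF \<mu>] by simp
  qed
  finally show ?thesis .
qed

section \<open>Polynomial functions\<close>

text \<open>Polynomiality as a property of functions on assignments: formulas such as
  \<open>xnum\<close>, written in terms of values, then need no parallel version built from
  polynomials.\<close>

definition polyfun :: "real set \<Rightarrow> var set \<Rightarrow> ((var \<Rightarrow> real) \<Rightarrow> real) \<Rightarrow> bool" where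
  "polyfun K V F \<longleftrightarrow> (\<exists>p\<in>mpolys K V. \<forall>a. F a = meval a p)"

lemma polyfun_meval: "p \<in> mpolys K V \<Longrightarrow> polyfun K V (\<lambda>a. meval a p)"
  by (auto simp: polyfun_def)

context
  fixes K :: "real set" and V :: "var set"
  assumes K: "subring_set K"
begin

lemma polyfun_const: "c \<in> K \<Longrightarrow> polyfun K V (\<lambda>a. c)"
  unfolding polyfun_def by (intro bexI[of _ "mconst c"]) (auto simp: K)

lemma polyfun_of_int: "polyfun K V (\<lambda>a. of_int c)"
  by (rule polyfun_const) (rule subring_setD(11)[OF K])

lemma polyfun_of_nat: "polyfun K V (\<lambda>a. of_nat c)"
  by (rule polyfun_const) (rule subring_setD(10)[OF K])

lemma polyfun_1: "polyfun K V (\<lambda>a. 1)"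
  by (rule polyfun_const) (rule subring_setD(2)[OF K])

lemma polyfun_0: "polyfun K V (\<lambda>a. 0)"
  by (rule polyfun_const) (rule subring_setD(1)[OF K])

lemma polyfun_var: "v \<in> V \<Longrightarrow> polyfun K V (\<lambda>a. a v)"
  unfolding polyfun_def by (intro bexI[of _ "mvar v"]) (auto simp: K)

lemma polyfun_add: "polyfun K V F \<Longrightarrow> polyfun K V G \<Longrightarrow> polyfun K V (\<lambda>a. F a + G a)"
  unfolding polyfun_def by (metis mpolys_closed(4)[OF K] meval.hom_add)

lemma polyfun_mult: "polyfun K V F \<Longrightarrow> polyfun K V G \<Longrightarrow> polyfun K V (\<lambda>a. F a * G a)"
  unfolding polyfun_def by (metis mpolys_closed(6)[OF K] meval.hom_mult)

lemma polyfun_diff: "polyfun K V F \<Longrightarrow> polyfun K V G \<Longrightarrow> polyfun K V (\<lambda>a. F a - G a)"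
  unfolding polyfun_def by (metis mpolys_closed(5)[OF K] meval.hom_minus)

lemma polyfun_power: "polyfun K V F \<Longrightarrow> polyfun K V (\<lambda>a. F a ^ k)"
  unfolding polyfun_def by (metis mpolys_closed(7)[OF K] meval.hom_power)

lemma polyfun_sum: "(\<And>i. i \<in> S \<Longrightarrow> polyfun K V (F i)) \<Longrightarrow> polyfun K V (\<lambda>a. \<Sum>i\<in>S. F i a)"
  by (induct S rule: infinite_finite_induct) (auto intro: polyfun_add polyfun_0)

lemma polyfun_prod: "(\<And>i. i \<in> S \<Longrightarrow> polyfun K V (F i)) \<Longrightarrow> polyfun K V (\<lambda>a. \<Prod>i\<in>S. F i a)"
  by (induct S rule: infinite_finite_induct) (auto intro: polyfun_mult polyfun_1)

lemma polyfun_coeff_prod: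
  assumes "\<And>i k. i \<in> S \<Longrightarrow> polyfun K V (\<lambda>a. coeff (p a i) k)"
  shows "polyfun K V (\<lambda>a. coeff (\<Prod>i\<in>S. p a i) k)"
  using assms
proof (induct S arbitrary: k rule: infinite_finite_induct)
  case (insert x F)
  then show ?case by (simp add: coeff_mult) (intro polyfun_sum polyfun_mult, auto)
qed (auto simp: coeff_1 intro: polyfun_1 polyfun_0)

lemma polyfun_coeff_linear:
  assumes "polyfun K V F"
  shows "polyfun K V (\<lambda>a. coeff [:- F a, 1:] k)"
proof -
  have "polyfun K V (\<lambda>a. 0 - F a)" by (intro polyfun_diff polyfun_0 assms)
  moreover have "(\<lambda>a. coeff [:- F a, 1:] k) = (if k = 0 then (\<lambda>a. 0 - F a) else if k = 1 then (\<lambda>a. 1) else (\<lambda>a. 0))"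
    by (auto simp: coeff_pCons fun_eq_iff split: nat.splits)
  ultimately show ?thesis by (simp only:) (auto intro: polyfun_1 polyfun_0)
qed

lemma polyfun_pow_entry:
  assumes M: "\<And>a. M a \<in> carrier_mat n n" and e: "\<And>s t. s < n \<Longrightarrow> t < n \<Longrightarrow> polyfun K V (\<lambda>a. M a $$ (s, t))"
    and st: "s < n" "t < n"
  shows "polyfun K V (\<lambda>a. (M a ^\<^sub>m r) $$ (s, t))"
  using st(2)
proof (induct r arbitrary: t)
  case 0
  have "(\<lambda>a. (M a ^\<^sub>m 0) $$ (s, t)) = (\<lambda>a. if s = t then 1 else 0)"
    using carrier_matD(1)[OF M] st(1) 0 by auto
  then show ?case by (simp only:) (auto intro: polyfun_1 polyfun_0)
next
  case (Suc r)
  have eq: "(\<lambda>a. (M a ^\<^sub>m Suc r) $$ (s, t)) = (\<lambda>a. \<Sum>k<n. (M a ^\<^sub>m r) $$ (s, k) * M a $$ (k, t))"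
    using mat_mult_entry[of "M _ ^\<^sub>m r" n "M _" s t] M Suc.prems st(1) by auto
  show ?case unfolding eq by (intro polyfun_sum polyfun_mult Suc.hyps e) (use Suc.prems in auto)
qed

lemma polyfun_ent:
  assumes M: "\<And>a. M a \<in> carrier_mat n n" and e: "\<And>s t. s < n \<Longrightarrow> t < n \<Longrightarrow> polyfun K V (\<lambda>a. M a $$ (s, t))"
    and p: "\<And>k. polyfun K V (\<lambda>a. coeff (p a) k)" "\<And>a. degree (p a) \<le> N" and st: "s < n" "t < n"
  shows "polyfun K V (\<lambda>a. ent (M a) s t (p a))"
  unfolding ent_superset[OF p(2)]
  by (intro polyfun_sum polyfun_mult p polyfun_pow_entry[OF M e] st)

end

lemma polyfun_reorder:
  assumes K: "subring_set K" and F: "polyfun K (Y \<union> lvars n) F" and Y: "Y \<inter> lvars n = {}"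
    and \<sigma>: "\<sigma> permutes {..<n}"
  shows "polyfun K (Y \<union> lvars n) (\<lambda>a. F (reorder \<sigma> a))"
proof -
  obtain p where p: "p \<in> mpolys K (Y \<union> lvars n)" "\<And>a. F a = meval a p"
    using F by (auto simp: polyfun_def)
  show ?thesis unfolding polyfun_def
    by (intro bexI[of _ "reorder_poly \<sigma> p"])
       (auto simp: p(2) meval_reorder_poly reorder_poly_mpolys[OF K p(1) Y \<sigma>])
qed

lemma prod_permutations:
  assumes \<tau>: "\<tau> permutes S"
  shows "(\<Prod>\<sigma> | \<sigma> permutes S. F (\<tau> \<circ> \<sigma>)) = (\<Prod>\<sigma> | \<sigma> permutes S. F \<sigma>)"
  by (rule prod.reindex_bij_witness[of _ "\<lambda>\<sigma>. inv_into UNIV \<tau> \<circ> \<sigma>" "\<lambda>\<sigma>. \<tau> \<circ> \<sigma>"])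
     (use \<tau> in \<open>auto simp: permutes_compose permutes_inv o_assoc permutes_inv_o\<close>)

lemma reorder_id [simp]: "reorder id a = a"
  by (auto simp: reorder_def fun_eq_iff split: var.splits)

section \<open>Generic relations between the roots\<close>

text \<open>\<open>B\<close> indexes a candidate for a \<rat>-basis of the span of the eigenvalues,
  with a common denominator \<open>N\<close> of the coordinates; integral coordinates can serve as
  exponents.\<close>

definition relsys :: "nat \<Rightarrow> nat set \<Rightarrow> nat \<Rightarrow> (nat \<Rightarrow> nat \<Rightarrow> int) \<Rightarrow> (var \<Rightarrow> real) \<Rightarrow> bool" where
  "relsys n B N \<nu> a \<longleftrightarrow> (\<forall>i<n. N * a (Lv i) = (\<Sum>k\<in>B. \<nu> k i * a (Lv k)))"

context root_family
begin

lemma ex_points: "\<exists>a. a \<in> points"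
proof -
  obtain a where "meval a h \<noteq> 0"
    using meval_zero_imp_zero[of "UNIV :: real set" h] h_nonzero by (auto simp: infinite_UNIV_char_0)
  then show ?thesis using ex_point by blast
qed

text \<open>
  \<open>f\<close> is \<open>\<chi>(p)\<close>, where \<open>\<chi>\<close> is the norm polynomial of \<open>p\<close> with the root \<open>0\<close> removed.
\<close>

lemma zero_locus_polynomial:
  assumes p: "p \<in> Syl"
  shows "\<exists>f\<in>Syl. \<exists>c\<in>mpolys K Y. c \<noteq> 0 \<and>
    (\<forall>a\<in>points. meval a f = (if meval a p = 0 then meval a c else 0))"
proof -
  obtain N where N: "\<And>k. coeff N k \<in> mpolys K Y"
    "\<And>a. a \<in> points \<Longrightarrow> map_poly (meval a) N = (\<Prod>\<sigma> | \<sigma> permutes {..<n}. [:- meval (reorder \<sigma> a) p, 1:])"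
    using norm_poly[OF p] by blast
  have fin: "finite {\<sigma>. \<sigma> permutes {..<n}}" by (simp add: finite_permutations)
  have "N \<noteq> 0"
  proof
    assume "N = 0"
    obtain a where "a \<in> points" using ex_points by blast
    from N(2)[OF this] \<open>N = 0\<close> show False using fin by (auto simp: eq_commute[of 0])
  qed
  then have "\<exists>k. coeff N k \<noteq> 0" by (auto simp: poly_eq_iff)
  define k where "k = (LEAST k. coeff N k \<noteq> 0)"
  have k: "coeff N k \<noteq> 0" unfolding k_def by (rule LeastI_ex) fact
  have lt: "coeff N j = 0" if "j < k" for j using not_less_Least[of j "\<lambda>k. coeff N k \<noteq> 0"] that k_def by auto
  define q where "q = poly_shift k N"
  have Nq: "N = Polynomial.monom 1 k * q"
    by (rule poly_eqI) (auto simp: coeff_monom_mult q_def coeff_poly_shift lt)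
  have qin: "coeff q j \<in> Syl" for j
    using mpolys_mono[OF N(1)[of "j + k"] subset_refl, of "Y \<union> lvars n"] by (simp add: q_def coeff_poly_shift)
  have v: "meval a (poly q p) = (if meval a p = 0 then meval a (coeff N k) else 0)" if a: "a \<in> points" for a
  proof -
    have "poly (map_poly (meval a) N) (meval a p) = (\<Prod>\<sigma> | \<sigma> permutes {..<n}. meval a p - meval (reorder \<sigma> a) p)"
      unfolding N(2)[OF a] by (rule prod_linear_roots)
    also have "\<dots> = 0"
      by (rule prod_zero[OF fin]) (rule bexI[of _ id], auto simp: permutes_id)
    finally have "meval a p ^ k * meval a (poly q p) = 0"
      by (simp add: Nq mp_meval.hom_mult poly_monom)
    moreover have "meval a (poly q p) = meval a (coeff N k)" if "meval a p = 0"
    proof -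
      have "meval a (poly q p) = poly (map_poly (meval a) q) 0"
        by (simp only: poly_map_meval that)
      then show ?thesis by (simp add: poly_0_coeff_0 q_def coeff_poly_shift)
    qed
    ultimately show ?thesis by auto
  qed
  have "poly q p \<in> Syl" by (rule poly_coeff_in[OF _ qin p]) (simp add: K)
  then show ?thesis
    by (intro bexI[of _ "poly q p"] bexI[of _ "coeff N k"]) (use v k N(1) in auto)
qed

text \<open>The ordering may depend on the point: no ordering of the eigenvalues is distinguished,
  and a relation may hold only after renaming them.\<close>

definition generic_relsys :: "nat set \<Rightarrow> nat \<Rightarrow> (nat \<Rightarrow> nat \<Rightarrow> int) \<Rightarrow> bool" where
  "generic_relsys B N \<nu> \<longleftrightarrow> B \<subseteq> {..<n} \<and> N > 0 \<and>
     (\<forall>a\<in>points. \<exists>\<sigma>. \<sigma> permutes {..<n} \<and> relsys n B N \<nu> (reorder \<sigma> a))"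

text \<open>The trivial system, with all indices in \<open>B\<close> and \<open>N = 1\<close>, is
  generic. Minimality of \<open>B\<close> takes the place of linear independence: it excludes
  further relations at generic points.\<close>

lemma ex_minimal_relsys:
  "\<exists>B N \<nu>. generic_relsys B N \<nu> \<and> (\<forall>B' N' \<nu>'. generic_relsys B' N' \<nu>' \<longrightarrow> card B \<le> card B')"
proof -
  have "(\<Sum>k<n. (if k = i then 1 else 0) * a (Lv k)) = a (Lv i)" if "i < n" for i and a :: "var \<Rightarrow> real"
    using that by (simp add: if_distrib[of "\<lambda>x. x * _"] cong: if_cong)
  then have "generic_relsys {..<n} 1 (\<lambda>k i. if k = i then 1 else 0)"
    unfolding generic_relsys_def relsys_def
    by (auto intro!: exI[of _ id] permutes_id simp: if_distrib[of "of_int"] cong: if_cong)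
  then have "(\<lambda>x. generic_relsys (fst x) (fst (snd x)) (snd (snd x))) ({..<n}, 1, \<lambda>k i. if k = i then 1 else 0)"
    by simp
  from ex_has_least_nat[where m = "\<lambda>x. card (fst x)" and
      P = "\<lambda>x. generic_relsys (fst x) (fst (snd x)) (snd (snd x))", OF this]
  obtain x where "generic_relsys (fst x) (fst (snd x)) (snd (snd x))"
    "\<And>y. generic_relsys (fst y) (fst (snd y)) (snd (snd y)) \<Longrightarrow> card (fst x) \<le> card (fst y)" by blast
  then show ?thesis
    by (intro exI[of _ "fst x"] exI[of _ "fst (snd x)"] exI[of _ "snd (snd x)"]) (metis fst_conv snd_conv)
qed

text \<open>
  A further relation that is not implied by a minimal system would allow to eliminate one more
  element of \<open>B\<close>.
\<close>

lemma relsys_eliminate: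
  assumes r: "relsys n B N \<nu> a" and B: "finite B" "k0 \<in> B" and N: "N > 0"
    and v: "(\<Sum>i<n. v i * a (Lv i)) = 0" and w: "(\<Sum>i<n. v i * \<nu> k0 i) \<noteq> (0::int)"
  shows "relsys n (B - {k0}) (nat (N * \<bar>\<Sum>i<n. v i * \<nu> k0 i\<bar>))
    (\<lambda>k i. sgn (\<Sum>i<n. v i * \<nu> k0 i) * ((\<Sum>i<n. v i * \<nu> k0 i) * \<nu> k i - \<nu> k0 i * (\<Sum>i<n. v i * \<nu> k i))) a"
  unfolding relsys_def
proof (intro allI impI)
  fix i assume i: "i < n"
  define W where "W k = (\<Sum>i<n. v i * \<nu> k i)" for k
  have rr: "N * a (Lv i) = (\<Sum>k\<in>B. \<nu> k i * a (Lv k))" if "i < n" for i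
    using r that by (simp add: relsys_def)
  have "0 = (\<Sum>i<n. v i * (N * a (Lv i)))" using v by (simp add: ac_simps flip: sum_distrib_left)
  also have "\<dots> = (\<Sum>i<n. \<Sum>k\<in>B. v i * (\<nu> k i * a (Lv k)))" by (simp add: rr sum_distrib_left)
  also have "\<dots> = (\<Sum>k\<in>B. W k * a (Lv k))"
    by (subst sum.swap) (simp add: W_def sum_distrib_left sum_distrib_right ac_simps)
  also have "\<dots> = W k0 * a (Lv k0) + (\<Sum>k\<in>B - {k0}. W k * a (Lv k))"
    using B by (rule sum.remove)
  finally have e: "W k0 * a (Lv k0) = - (\<Sum>k\<in>B - {k0}. W k * a (Lv k))" by simp
  have "W k0 * (N * a (Lv i)) = W k0 * (\<nu> k0 i * a (Lv k0) + (\<Sum>k\<in>B - {k0}. \<nu> k i * a (Lv k)))"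
    using B by (subst rr[OF i], subst sum.remove[of _ k0]) auto
  also have "\<dots> = \<nu> k0 i * (W k0 * a (Lv k0)) + (\<Sum>k\<in>B - {k0}. W k0 * \<nu> k i * a (Lv k))"
    by (simp add: distrib_left sum_distrib_left ac_simps)
  also have "\<dots> = (\<Sum>k\<in>B - {k0}. (W k0 * \<nu> k i - \<nu> k0 i * W k) * a (Lv k))"
    unfolding e by (simp add: sum_distrib_left algebra_simps sum_subtractf)
  finally have f: "sgn (W k0) * (W k0 * (N * a (Lv i))) =
     sgn (W k0) * (\<Sum>k\<in>B - {k0}. (W k0 * \<nu> k i - \<nu> k0 i * W k) * a (Lv k))" by simp
  \<comment> \<open>The new denominator has to be a positive natural number, so the sign of
    \<open>W k0\<close> is moved into the coefficients.\<close>
  have "\<bar>real_of_int (W k0)\<bar> = real_of_int (sgn (W k0)) * real_of_int (W k0)"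
    by (cases "W k0" "0 :: int" rule: linorder_cases) auto
  then have s: "real (nat (N * \<bar>W k0\<bar>)) = N * (real_of_int (sgn (W k0)) * real_of_int (W k0))" by simp
  show "real (nat (N * \<bar>\<Sum>i<n. v i * \<nu> k0 i\<bar>)) * a (Lv i) = (\<Sum>k\<in>B - {k0}. real_of_int
      (sgn (\<Sum>i<n. v i * \<nu> k0 i) * ((\<Sum>i<n. v i * \<nu> k0 i) * \<nu> k i - \<nu> k0 i * (\<Sum>i<n. v i * \<nu> k i))) * a (Lv k))"
    using f unfolding W_def[symmetric] s by (simp add: sum_distrib_left ac_simps)
qed

text \<open>Over the reals a system of equations becomes a single one by summing squares.\<close>

lemma relsys_polynomial:
  assumes "B \<subseteq> {..<n}"
  shows "\<exists>p\<in>Syl. \<forall>a. meval a p = 0 \<longleftrightarrow> relsys n B N \<nu> a \<and> (\<Sum>i<n. of_int (v i) * a (Lv i)) = 0"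
proof -
  let ?F = "\<lambda>a. (\<Sum>i<n. (of_nat N * a (Lv i) - (\<Sum>k\<in>B. of_int (\<nu> k i) * a (Lv k)))\<^sup>2) + (\<Sum>i<n. of_int (v i) * a (Lv i))\<^sup>2"
  have "polyfun K (Y \<union> lvars n) ?F"
    by (intro polyfun_add polyfun_sum polyfun_power polyfun_diff polyfun_mult polyfun_of_nat polyfun_of_int polyfun_var K)
       (use assms in \<open>auto simp: lvars_def\<close>)
  then obtain p where p: "p \<in> Syl" "\<And>a. ?F a = meval a p" by (auto simp: polyfun_def)
  have "meval a p = 0 \<longleftrightarrow> relsys n B N \<nu> a \<and> (\<Sum>i<n. of_int (v i) * a (Lv i)) = 0" for a
    unfolding p(2)[symmetric]
    by (subst add_nonneg_eq_0_iff) (auto simp: sum_nonneg sum_nonneg_eq_0_iff relsys_def)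
  with p(1) show ?thesis by blast
qed

text \<open>The constant coefficient \<open>?c\<close> of a norm vanishes at a point exactly when
  some ordering satisfies the system together with the relation \<open>v\<close>. If it were zero
  identically, eliminating \<open>k0\<close> would give a generic system with a smaller
  \<open>B\<close>.\<close>

lemma minimal_relsys_independent:
  assumes gen: "generic_relsys B N \<nu>"
    and min: "\<And>B' N' \<nu>'. generic_relsys B' N' \<nu>' \<Longrightarrow> card B \<le> card B'"
    and k0: "k0 \<in> B" and w: "(\<Sum>i<n. v i * \<nu> k0 i) \<noteq> (0::int)"
  shows "\<exists>c\<in>mpolys K Y. c \<noteq> 0 \<and> (\<forall>a\<in>points. meval a c \<noteq> 0 \<longrightarrow>
    (\<forall>\<sigma>. \<sigma> permutes {..<n} \<and> relsys n B N \<nu> (reorder \<sigma> a) \<longrightarrow> (\<Sum>i<n. v i * a (Lv (\<sigma> i))) \<noteq> 0))"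
proof -
  have B: "B \<subseteq> {..<n}" "N > 0" "finite B" using gen finite_subset[of B "{..<n}"] by (auto simp: generic_relsys_def)
  obtain p where p: "p \<in> Syl" "\<And>a. meval a p = 0 \<longleftrightarrow> relsys n B N \<nu> a \<and> (\<Sum>i<n. of_int (v i) * a (Lv i)) = 0"
    using relsys_polynomial[OF B(1)] by blast
  obtain R where R: "\<And>k. coeff R k \<in> mpolys K Y"
    "\<And>a. a \<in> points \<Longrightarrow> map_poly (meval a) R = (\<Prod>\<sigma> | \<sigma> permutes {..<n}. [:- meval (reorder \<sigma> a) p, 1:])"
    using norm_poly[OF p(1)] by blast
  have fin: "finite {\<sigma>. \<sigma> permutes {..<n}}" by (simp add: finite_permutations)
  let ?c = "coeff R 0"
  have c: "meval a ?c = 0 \<longleftrightarrow> (\<exists>\<sigma>. \<sigma> permutes {..<n} \<and> meval (reorder \<sigma> a) p = 0)" if a: "a \<in> points" for a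
  proof -
    have "meval a ?c = poly (map_poly (meval a) R) 0" by (simp add: poly_0_coeff_0)
    also have "\<dots> = (\<Prod>\<sigma> | \<sigma> permutes {..<n}. 0 - meval (reorder \<sigma> a) p)"
      unfolding R(2)[OF a] by (rule prod_linear_roots)
    finally show ?thesis using fin by auto
  qed
  have "?c \<noteq> 0"
  proof
    assume "?c = 0"
    let ?W = "\<Sum>i<n. v i * \<nu> k0 i"
    let ?B = "B - {k0}" and ?N = "nat (N * \<bar>?W\<bar>)"
      and ?\<nu> = "\<lambda>k i. sgn ?W * (?W * \<nu> k i - \<nu> k0 i * (\<Sum>i<n. v i * \<nu> k i))"
    have "generic_relsys ?B ?N ?\<nu>"
      unfolding generic_relsys_def
    proof (intro conjI ballI)
      show "?B \<subseteq> {..<n}" using B(1) by auto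
      show "?N > 0" using w B(2) by simp
      fix a assume "a \<in> points"
      then obtain \<sigma> where \<sigma>: "\<sigma> permutes {..<n}" "relsys n B N \<nu> (reorder \<sigma> a)"
        "(\<Sum>i<n. of_int (v i) * reorder \<sigma> a (Lv i)) = 0"
        using c[of a] \<open>?c = 0\<close> p(2) by auto
      from relsys_eliminate[OF \<sigma>(2) B(3) k0 B(2) \<sigma>(3) w]
      show "\<exists>\<sigma>. \<sigma> permutes {..<n} \<and> relsys n ?B ?N ?\<nu> (reorder \<sigma> a)" using \<sigma>(1) by blast
    qed
    from min[OF this] show False using B(3) k0 card_Diff1_less[of B k0] by simp
  qed
  then show ?thesis
    by (intro bexI[of _ ?c] R(1)) (use c p(2) in auto)
qed

end

section \<open>A rational parametrisation\<close>

lemma lag_reorder: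
  assumes \<sigma>: "\<sigma> permutes {..<n}"
  shows "lag n (\<lambda>j. l (\<sigma> j)) i = lag n l (\<sigma> i)" "lagden n (\<lambda>j. l (\<sigma> j)) i = lagden n l (\<sigma> i)"
    "(\<Prod>j\<in>{..<n} - {i}. F (\<sigma> j)) = (\<Prod>j\<in>{..<n} - {\<sigma> i}. F j)"
proof -
  have bij: "bij_betw \<sigma> ({..<n} - {i}) ({..<n} - {\<sigma> i})"
    unfolding bij_betw_def
    using permutes_inj_on[OF \<sigma>] image_set_diff[OF permutes_inj[OF \<sigma>]] permutes_image[OF \<sigma>] by auto
  show "lag n (\<lambda>j. l (\<sigma> j)) i = lag n l (\<sigma> i)" "lagden n (\<lambda>j. l (\<sigma> j)) i = lagden n l (\<sigma> i)"
    unfolding lag_def lagden_def by (rule prod.reindex_bij_betw[OF bij])+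
  show "(\<Prod>j\<in>{..<n} - {i}. F (\<sigma> j)) = (\<Prod>j\<in>{..<n} - {\<sigma> i}. F j)"
    by (rule prod.reindex_bij_betw[OF bij])
qed

text \<open>
  Besides \<open>y\<close> there are parameters \<open>\<xi>\<^sub>j = Yv (d + j)\<close> and \<open>s\<^sub>k = Yv (d + n + k)\<close>. The function
  \<open>wval k\<close> is \<open>1\<close> at the orderings where \<open>f0\<close> vanishes, and it takes an arbitrary value at a
  prescribed ordering \<open>\<xi>\<close> and the value \<open>1\<close> at all other ones.  So \<open>zval\<close>, which multiplies over
  all orderings, is a function of the eigenvalue \<open>Lv i\<close> that does not depend on their ordering.
\<close>

definition wval :: "nat \<Rightarrow> nat \<Rightarrow> rpoly \<Rightarrow> nat \<Rightarrow> (var \<Rightarrow> real) \<Rightarrow> real" where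
  "wval n d f0 k a = 1 + meval a f0 * a (Yv (d + n + k)) *
     (\<Prod>i<n. \<Prod>j\<in>{..<n} - {i}. a (Lv i) - a (Yv (d + j)))"

definition zval :: "nat \<Rightarrow> nat \<Rightarrow> rpoly \<Rightarrow> nat set \<Rightarrow> (nat \<Rightarrow> nat \<Rightarrow> int) \<Rightarrow> (var \<Rightarrow> real) \<Rightarrow> nat \<Rightarrow> real" where
  "zval n d f0 B \<nu> a i = (\<Prod>k\<in>B. \<Prod>\<sigma> | \<sigma> permutes {..<n}.
     wval n d f0 k (reorder \<sigma> a) powi \<nu> k (inv_into UNIV \<sigma> i))"

text \<open>This is \<open>zval\<close> times \<open>zden\<close>: the shift by \<open>e\<close>
  makes all exponents nonnegative once \<open>e\<close> bounds them.\<close>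

definition znum :: "nat \<Rightarrow> nat \<Rightarrow> rpoly \<Rightarrow> nat set \<Rightarrow> (nat \<Rightarrow> nat \<Rightarrow> int) \<Rightarrow> nat \<Rightarrow> (var \<Rightarrow> real) \<Rightarrow> nat \<Rightarrow> real" where
  "znum n d f0 B \<nu> e a i = (\<Prod>k\<in>B. \<Prod>\<sigma> | \<sigma> permutes {..<n}.
     wval n d f0 k (reorder \<sigma> a) ^ nat (\<nu> k (inv_into UNIV \<sigma> i) + int e))"

definition zden :: "nat \<Rightarrow> nat \<Rightarrow> rpoly \<Rightarrow> nat set \<Rightarrow> nat \<Rightarrow> (var \<Rightarrow> real) \<Rightarrow> real" where
  "zden n d f0 B e a = (\<Prod>k\<in>B. \<Prod>\<sigma> | \<sigma> permutes {..<n}. wval n d f0 k (reorder \<sigma> a) ^ e)"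

text \<open>The factor that brings the fraction with denominator \<open>lagden n l i\<close> to the
  common denominator of all projectors.\<close>

definition lagcof :: "nat \<Rightarrow> (nat \<Rightarrow> real) \<Rightarrow> nat \<Rightarrow> real" where
  "lagcof n l i = (\<Prod>j\<in>{..<n} - {i}. lagden n l j)"

definition xnum :: "nat \<Rightarrow> nat \<Rightarrow> (nat \<Rightarrow> real mat) \<Rightarrow> rpoly \<Rightarrow> nat set \<Rightarrow> (nat \<Rightarrow> nat \<Rightarrow> int) \<Rightarrow> nat \<Rightarrow> nat \<Rightarrow> nat \<Rightarrow> (var \<Rightarrow> real) \<Rightarrow> real" where
  "xnum n d A f0 B \<nu> e s t a = (\<Sum>i<n. znum n d f0 B \<nu> e a i * lagcof n (\<lambda>i. a (Lv i)) i *
     ent (mat_at n d A a) s t (lag n (\<lambda>i. a (Lv i)) i))"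

definition xden :: "nat \<Rightarrow> nat \<Rightarrow> rpoly \<Rightarrow> nat set \<Rightarrow> nat \<Rightarrow> (var \<Rightarrow> real) \<Rightarrow> real" where
  "xden n d f0 B e a = zden n d f0 B e a * (\<Prod>i<n. lagden n (\<lambda>i. a (Lv i)) i)"

lemma mat_at_reorder [simp]: "mat_at n d A (reorder \<sigma> a) = mat_at n d A a"
  by (simp add: mat_at_def)

lemma zden_reorder: "\<tau> permutes {..<n} \<Longrightarrow> zden n d f0 B e (reorder \<tau> a) = zden n d f0 B e a"
  unfolding zden_def reorder_reorder
  using prod_permutations[where F = "\<lambda>\<sigma>. wval n d f0 _ (reorder \<sigma> a) ^ e"] by (rule prod.cong[OF refl]) simp

text \<open>In the ordering \<open>reorder \<sigma> a\<close> the eigenvalue \<open>a (Lv i)\<close>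
  stands at position \<open>inv_into UNIV \<sigma> i\<close> and takes the exponents of that
  position. So the value belongs to the eigenvalue and not to its index.\<close>

lemma znum_reorder:
  assumes \<tau>: "\<tau> permutes {..<n}"
  shows "znum n d f0 B \<nu> e (reorder \<tau> a) i = znum n d f0 B \<nu> e a (\<tau> i)"
proof -
  have "(\<Prod>\<sigma> | \<sigma> permutes {..<n}. wval n d f0 k (reorder (\<tau> \<circ> \<sigma>) a) ^ nat (\<nu> k (inv_into UNIV \<sigma> i) + int e)) =
      (\<Prod>\<sigma> | \<sigma> permutes {..<n}. wval n d f0 k (reorder (\<tau> \<circ> \<sigma>) a) ^ nat (\<nu> k (inv_into UNIV (\<tau> \<circ> \<sigma>) (\<tau> i)) + int e))" for k
  proof (rule prod.cong[OF refl])
    fix \<sigma> assume "\<sigma> \<in> {\<sigma>. \<sigma> permutes {..<n}}"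
    then have "inv_into UNIV (\<tau> \<circ> \<sigma>) = inv_into UNIV \<sigma> \<circ> inv_into UNIV \<tau>"
      using \<tau> by (intro o_inv_distrib) (auto simp: permutes_bij)
    then have "inv_into UNIV (\<tau> \<circ> \<sigma>) (\<tau> i) = inv_into UNIV \<sigma> i"
      using permutes_inverses(2)[OF \<tau>] by simp
    then show "wval n d f0 k (reorder (\<tau> \<circ> \<sigma>) a) ^ nat (\<nu> k (inv_into UNIV \<sigma> i) + int e) =
      wval n d f0 k (reorder (\<tau> \<circ> \<sigma>) a) ^ nat (\<nu> k (inv_into UNIV (\<tau> \<circ> \<sigma>) (\<tau> i)) + int e)" by simp
  qed
  then show ?thesis
    unfolding znum_def reorder_reorder
    using prod_permutations[OF \<tau>, where F = "\<lambda>\<sigma>. wval n d f0 _ (reorder \<sigma> a) ^ nat (\<nu> _ (inv_into UNIV \<sigma> (\<tau> i)) + int e)"]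
    by simp
qed

lemma xden_reorder:
  assumes \<tau>: "\<tau> permutes {..<n}"
  shows "xden n d f0 B e (reorder \<tau> a) = xden n d f0 B e a"
proof -
  have "(\<Prod>i<n. lagden n (\<lambda>i. a (Lv i)) (\<tau> i)) = (\<Prod>i<n. lagden n (\<lambda>i. a (Lv i)) i)"
    using prod.permute[OF \<tau>, of "lagden n (\<lambda>i. a (Lv i))"] by (simp add: comp_def)
  then show ?thesis
    using lag_reorder(2)[OF \<tau>, of "\<lambda>i. a (Lv i)"] by (simp add: xden_def zden_reorder[OF \<tau>])
qed

lemma xnum_reorder:
  assumes \<tau>: "\<tau> permutes {..<n}"
  shows "xnum n d A f0 B \<nu> e s t (reorder \<tau> a) = xnum n d A f0 B \<nu> e s t a"
proof -
  let ?l = "\<lambda>i. a (Lv i)"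
  have cof: "lagcof n (\<lambda>i. ?l (\<tau> i)) i = lagcof n ?l (\<tau> i)" for i
    unfolding lagcof_def lag_reorder(2)[OF \<tau>, of ?l] by (rule lag_reorder(3)[OF \<tau>])
  let ?F = "\<lambda>i. znum n d f0 B \<nu> e a i * lagcof n ?l i * ent (mat_at n d A a) s t (lag n ?l i)"
  have "xnum n d A f0 B \<nu> e s t (reorder \<tau> a) = (\<Sum>i<n. ?F (\<tau> i))"
    unfolding xnum_def
    by (simp add: znum_reorder[OF \<tau>] cof lag_reorder(1)[OF \<tau>, of ?l])
  also have "\<dots> = (\<Sum>i<n. ?F i)" using sum.permute[OF \<tau>, of ?F] by (simp add: comp_def)
  finally show ?thesis by (simp add: xnum_def)
qed

text \<open>A positive \<open>e\<close> makes every weight a factor of \<open>zden\<close>, so the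
  weights can be inverted wherever the denominator is nonzero.\<close>

lemma zden_nonzero:
  assumes "zden n d f0 B e a \<noteq> 0" "e > 0" "finite B" "k \<in> B" "\<sigma> permutes {..<n}"
  shows "wval n d f0 k (reorder \<sigma> a) \<noteq> 0"
  using assms by (auto simp: zden_def finite_permutations)

lemma xnum_over_xden:
  assumes nz: "xden n d f0 B e a \<noteq> 0" and e: "e > 0" "\<And>k i. k \<in> B \<Longrightarrow> \<bar>\<nu> k i\<bar> \<le> int e" and B: "finite B"
  shows "xnum n d A f0 B \<nu> e s t a / xden n d f0 B e a = xval n d A a (zval n d f0 B \<nu> a) (Xv s t)"
proof -
  let ?l = "\<lambda>i. a (Lv i)"
  have z0: "zden n d f0 B e a \<noteq> 0" using nz by (simp add: xden_def)
  have zn: "znum n d f0 B \<nu> e a i = zval n d f0 B \<nu> a i * zden n d f0 B e a" for i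
  proof -
    have "wval n d f0 k (reorder \<sigma> a) ^ nat (\<nu> k (inv_into UNIV \<sigma> i) + int e) =
        wval n d f0 k (reorder \<sigma> a) powi \<nu> k (inv_into UNIV \<sigma> i) * wval n d f0 k (reorder \<sigma> a) ^ e"
      if "k \<in> B" "\<sigma> permutes {..<n}" for k \<sigma>
    proof -
      have "wval n d f0 k (reorder \<sigma> a) \<noteq> 0" by (rule zden_nonzero[OF z0 e(1) B that])
      moreover have "\<nu> k (inv_into UNIV \<sigma> i) + int e \<ge> 0" using e(2)[OF that(1), of "inv_into UNIV \<sigma> i"] by linarith
      ultimately show ?thesis
        by (metis power_int_add power_int_of_nat power_int_def)
    qed
    then show ?thesis
      unfolding znum_def zval_def zden_def prod.distrib[symmetric] by (intro prod.cong refl) auto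
  qed
  have l: "(\<Prod>j<n. lagden n ?l j) = lagden n ?l i * lagcof n ?l i" if "i < n" for i
    unfolding lagcof_def using that by (intro prod.remove) auto
  have "znum n d f0 B \<nu> e a i * lagcof n ?l i * ent (mat_at n d A a) s t (lag n ?l i) / xden n d f0 B e a =
      zval n d f0 B \<nu> a i * proj_at n d A a i s t" if "i < n" for i
    using nz z0 by (simp add: zn proj_at_def proj_def xden_def l[OF that])
  then show ?thesis
    by (simp add: xnum_def xval_def sum_divide_distrib)
qed

section \<open>Real polynomials in y as complex polynomials in the parameters\<close>

definition complex_poly :: "rpoly \<Rightarrow> (nat, complex) mpoly" where
  "complex_poly = mhom (\<lambda>c. mconst (of_real c)) (\<lambda>v. case v of Yv i \<Rightarrow> mvar i | _ \<Rightarrow> 0)"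

lemma comm_ring_hom_mconst_of_real: "comm_ring_hom (\<lambda>c. mconst (complex_of_real c))"
  by unfold_locales (auto simp: mconst.hom_add mconst.hom_mult)

lemma of_real_meval: "of_real (meval a c) = mhom complex_of_real (\<lambda>v. of_real (a v)) c"
  unfolding meval_eq_mhom
  by (subst comm_ring_hom.hom_mhom[OF comm_ring_hom_id]) (auto intro: of_real_hom.comm_ring_hom_axioms)

lemma meval_complex_poly:
  assumes c: "c \<in> mpolys UNIV (yvars m)" and t: "\<And>i. i < m \<Longrightarrow> t i = of_real (a (Yv i))"
  shows "meval t (complex_poly c) = of_real (meval a c)"
proof -
  have "meval t (complex_poly c) = mhom complex_of_real (\<lambda>v. meval t (case v of Yv i \<Rightarrow> mvar i | _ \<Rightarrow> 0)) c"
    unfolding complex_poly_def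
    by (subst comm_ring_hom.hom_mhom[OF comm_ring_hom_mconst_of_real comm_ring_hom_meval]) simp
  also have "\<dots> = mhom complex_of_real (\<lambda>v. of_real (a v)) c"
    by (rule mhom_cong) (use c t in \<open>auto simp: mpolys_iff yvars_def dest!: subsetD\<close>)
  finally show ?thesis by (simp add: of_real_meval)
qed

lemma complex_poly_in:
  assumes "c \<in> mpolys UNIV (yvars m)"
  shows "complex_poly c \<in> mpolys UNIV {..<m}"
  unfolding complex_poly_def
  by (rule mhom_mpolys[OF assms _ _ comm_ring_hom_mconst_of_real]) (auto simp: yvars_def)

lemma complex_poly_nonzero:
  assumes c: "c \<in> mpolys UNIV (yvars m)" "c \<noteq> 0"
  shows "complex_poly c \<noteq> 0"
proof -
  obtain a where "meval a c \<noteq> 0"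
    using meval_zero_imp_zero[of "UNIV :: real set" c] c(2) by (auto simp: infinite_UNIV_char_0)
  then show ?thesis
    using meval_complex_poly[OF c(1), of "\<lambda>i. of_real (a (Yv i))" a] by auto
qed

section \<open>The pencil with a fixed discriminant \<open>h\<close>\<close>

locale pencil_family =
  fixes n d :: nat and A :: "nat \<Rightarrow> real mat" and h :: rpoly
  assumes A_sym: "\<forall>i<d. A i \<in> sym_mats n"
    and h0: "h \<noteq> 0" and h_yvars: "mvars h \<subseteq> yvars d"
    and h_split: "meval a h \<noteq> 0 \<Longrightarrow>
      \<exists>l. inj_on l {..<n} \<and> map_poly (meval a) (char_poly (pencil n d A)) = (\<Prod>i<n. [:- l i, 1:])"
begin

abbreviation "points \<equiv> pts n (char_poly (pencil n d A)) h"

lemma yvars_lvars: "yvars m \<inter> lvars k = {}"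
  by (auto simp: yvars_def lvars_def)

text \<open>For \<open>m > d\<close> the additional variables in \<open>yvars m\<close> are free
  parameters, on which neither the pencil nor \<open>h\<close> depends.\<close>

lemma family:
  assumes "subring_set K" "\<And>i s t. i < d \<Longrightarrow> s < n \<Longrightarrow> t < n \<Longrightarrow> A i $$ (s, t) \<in> K" "d \<le> m"
  shows "root_family K (yvars m) n (char_poly (pencil n d A)) h"
proof (rule root_family_pencil)
  show "yvars d \<subseteq> yvars m" using assms(3) by (auto simp: yvars_def)
  show "mvars h \<inter> lvars n = {}" using h_yvars yvars_lvars[of d n] by blast
qed (use assms h0 h_split yvars_lvars in auto)

lemma points_cong:
  assumes a: "a \<in> points" and y: "\<And>i. i < d \<Longrightarrow> b (Yv i) = a (Yv i)" and l: "\<And>i. i < n \<Longrightarrow> b (Lv i) = a (Lv i)"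
  shows "b \<in> points"
proof -
  have 1: "meval b h = meval a h"
    by (rule meval_cong) (use h_yvars y in \<open>auto simp: yvars_def\<close>)
  have 2: "mat_lincomb n d A (\<lambda>i. b (Yv i)) = mat_lincomb n d A (\<lambda>i. a (Yv i))"
    by (rule eq_matI) (auto simp: mat_lincomb_def y)
  have 3: "inj_on (\<lambda>i. b (Lv i)) {..<n} = inj_on (\<lambda>i. a (Lv i)) {..<n}"
    by (rule inj_on_cong) (simp add: l)
  show ?thesis using a by (simp add: pts_def 1 2 3 l meval_char_poly)
qed

end

text \<open>On the points, \<open>f0\<close> is a multiple of the indicator of the orderings that
  satisfy the minimal system; the factor \<open>c0\<close> is a polynomial in y alone, and so the
  same for all orderings.\<close>

locale parametrisation = pencil_family +
  fixes B :: "nat set" and N :: nat and \<nu> :: "nat \<Rightarrow> nat \<Rightarrow> int" and f0 c0 :: rpoly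
  assumes n_pos: "n > 0"
    and gen: "root_family.generic_relsys n (char_poly (pencil n d A)) h B N \<nu>"
    and min: "root_family.generic_relsys n (char_poly (pencil n d A)) h B' N' \<nu>' \<Longrightarrow> card B \<le> card B'"
    and f0: "f0 \<in> mpolys UNIV (yvars d \<union> lvars n)"
    and c0: "c0 \<in> mpolys UNIV (yvars d)" "c0 \<noteq> 0"
    and f0_val: "a \<in> points \<Longrightarrow> meval a f0 = (if relsys n B N \<nu> a then meval a c0 else 0)"
begin

sublocale base: root_family UNIV "yvars d" n "char_poly (pencil n d A)" h
  by (rule family) auto

sublocale big: root_family UNIV "yvars (d + 2 * n)" n "char_poly (pencil n d A)" h
  by (rule family) auto

lemma B: "B \<subseteq> {..<n}" "finite B" "N > 0"
  using gen finite_subset[of B "{..<n}"] by (auto simp: base.generic_relsys_def)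

text \<open>\<open>Suc\<close> keeps \<open>e\<close> positive even if all exponents are
  zero.\<close>

definition e where "e = Suc (nat (\<Sum>k\<in>B. \<Sum>i<n. \<bar>\<nu> k i\<bar>))"

text \<open>Cut off outside the index range, since \<open>e\<close> is built from the exponents of
  indices below n while \<open>xnum_over_xden\<close> asks for a bound at every index.\<close>

definition \<nu>' where "\<nu>' k i = (if i < n then \<nu> k i else 0)"

lemma e: "e > 0" "k \<in> B \<Longrightarrow> \<bar>\<nu>' k i\<bar> \<le> int e"
proof -
  show "e > 0" by (simp add: e_def)
  assume k: "k \<in> B"
  have "\<bar>\<nu> k i\<bar> \<le> (\<Sum>i<n. \<bar>\<nu> k i\<bar>)" if "i < n"
    by (rule member_le_sum) (use that in auto)
  moreover have "(\<Sum>i<n. \<bar>\<nu> k i\<bar>) \<le> (\<Sum>k\<in>B. \<Sum>i<n. \<bar>\<nu> k i\<bar>)"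
    by (rule member_le_sum) (use k B(2) in \<open>auto intro: sum_nonneg\<close>)
  ultimately show "\<bar>\<nu>' k i\<bar> \<le> int e" by (auto simp: e_def \<nu>'_def)
qed

abbreviation "z \<equiv> zval n d f0 B \<nu>'"
abbreviation "num \<equiv> xnum n d A f0 B \<nu>' e"
abbreviation "den \<equiv> xden n d f0 B e"

abbreviation "YL \<equiv> yvars (d + 2 * n) \<union> lvars n"

lemma polyfun_lagden: "i < n \<Longrightarrow> polyfun UNIV YL (\<lambda>a. lagden n (\<lambda>i. a (Lv i)) i)"
  unfolding lagden_def
  by (intro polyfun_prod polyfun_diff polyfun_var subring_set_UNIV) (auto simp: lvars_def)

lemma polyfun_wval: "k \<in> B \<Longrightarrow> polyfun UNIV YL (wval n d f0 k)"
  unfolding wval_def[abs_def]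
  by (intro polyfun_add polyfun_mult polyfun_1 polyfun_prod polyfun_diff polyfun_var subring_set_UNIV
      polyfun_meval mpolys_mono[OF f0])
     (use B(1) in \<open>auto simp: lvars_def yvars_def\<close>)

lemma polyfun_wval_reorder:
  assumes "k \<in> B" "\<sigma> permutes {..<n}"
  shows "polyfun UNIV YL (\<lambda>a. wval n d f0 k (reorder \<sigma> a))"
  by (rule polyfun_reorder[OF subring_set_UNIV polyfun_wval[OF assms(1)] yvars_lvars assms(2)])

lemma polyfun_den: "polyfun UNIV YL den"
  unfolding xden_def[abs_def] zden_def
  by (intro polyfun_mult polyfun_prod polyfun_power polyfun_wval_reorder polyfun_lagden subring_set_UNIV) auto

lemma polyfun_num:
  assumes "s < n" "t < n"
  shows "polyfun UNIV YL (num s t)"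
proof -
  have M: "polyfun UNIV YL (\<lambda>a. mat_at n d A a $$ (s, t))" if "s < n" "t < n" for s t
    using that unfolding mat_at_def mat_lincomb_def
    by (simp, intro polyfun_sum polyfun_mult polyfun_const polyfun_var subring_set_UNIV)
       (auto simp: yvars_def)
  have "polyfun UNIV YL (\<lambda>a. ent (mat_at n d A a) s t (lag n (\<lambda>i. a (Lv i)) i))" if "i < n" for i
  proof (rule polyfun_ent[OF subring_set_UNIV _ M])
    show "mat_at n d A a \<in> carrier_mat n n" for a by (simp add: mat_at_def)
    show "polyfun UNIV YL (\<lambda>a. coeff (lag n (\<lambda>i. a (Lv i)) i) k)" for k
      unfolding lag_def
      by (intro polyfun_coeff_prod polyfun_coeff_linear polyfun_var subring_set_UNIV) (auto simp: lvars_def)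
    show "degree (lag n (\<lambda>i. a (Lv i)) i) \<le> n" for a :: "var \<Rightarrow> real"
      using degree_lag[OF that, of "\<lambda>i. a (Lv i)"] by simp
  qed (use assms in auto)
  then show ?thesis
    unfolding xnum_def[abs_def] znum_def lagcof_def
    by (intro polyfun_sum polyfun_mult polyfun_prod polyfun_power polyfun_wval_reorder polyfun_lagden subring_set_UNIV) auto
qed

lemma symmetric_polyfun:
  assumes F: "polyfun UNIV YL F" "\<And>a \<sigma>. \<sigma> permutes {..<n} \<Longrightarrow> F (reorder \<sigma> a) = F a"
  shows "\<exists>c\<in>mpolys UNIV (yvars (d + 2 * n)). \<forall>a\<in>points. meval a c = F a"
proof -
  obtain p where p: "p \<in> mpolys UNIV YL" "\<And>a. F a = meval a p" using F(1) by (auto simp: polyfun_def)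
  show ?thesis using big.symmetric_value[OF p(1)] F(2) unfolding p(2) by blast
qed

lemma ordering:
  assumes "a \<in> points"
  shows "\<exists>\<sigma>. \<sigma> permutes {..<n} \<and> relsys n B N \<nu> (reorder \<sigma> a) \<and> reorder \<sigma> a \<in> points"
  using gen assms base.reorder_points[OF assms] unfolding base.generic_relsys_def by blast

text \<open>
  For \<open>\<xi> = \<lambda>\<close> only the ordering \<open>\<lambda>\<close> itself contributes to \<open>zval\<close>; \<open>s\<close> is chosen to give it the weights
  \<open>wval k = exp (\<lambda>\<^sub>k / N)\<close>.
\<close>

lemma parameters_for_exp:
  assumes a: "a \<in> points" and c: "meval a c0 \<noteq> 0"
  shows "\<exists>b\<in>points. (\<forall>i<d. b (Yv i) = a (Yv i)) \<and> den b \<noteq> 0 \<and> (\<forall>i<n. z b i = exp (b (Lv i)))"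
proof -
  obtain \<tau> where \<tau>: "\<tau> permutes {..<n}" "relsys n B N \<nu> (reorder \<tau> a)" "reorder \<tau> a \<in> points"
    using ordering[OF a] by blast
  define a1 where "a1 = reorder \<tau> a"
  let ?l = "\<lambda>i. a1 (Lv i)"
  define Q where "Q = (\<Prod>i<n. \<Prod>j\<in>{..<n} - {i}. ?l i - ?l j)"
  have inj: "inj_on ?l {..<n}" using \<tau>(3) by (simp add: a1_def pts_def)
  have Q: "Q \<noteq> 0" using inj by (auto simp: Q_def inj_on_def)
  have "meval a1 c0 = meval a c0"
    by (rule base.meval_agree[OF c0(1) yvars_lvars]) (simp add: a1_def reorder_off[OF \<tau>(1)])
  then have c1: "meval a1 c0 \<noteq> 0" using c by simp
  define b where "b v = (case v of Yv i \<Rightarrow> if i < d then a1 v else if i < d + n then ?l (i - d)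
      else (exp (?l (i - (d + n)) / N) - 1) / (meval a1 c0 * Q) | _ \<Rightarrow> a1 v)" for v
  have bs: "b (Lv i) = ?l i" "i < d \<Longrightarrow> b (Yv i) = a1 (Yv i)" "i < n \<Longrightarrow> b (Yv (d + i)) = ?l i"
    "b (Yv (d + n + i)) = (exp (?l i / N) - 1) / (meval a1 c0 * Q)" for i
    by (auto simp: b_def)
  have bp: "b \<in> points" by (rule points_cong[of a1]) (use \<tau>(3) bs in \<open>auto simp: a1_def\<close>)
  have rb: "relsys n B N \<nu> b" using \<tau>(2) by (simp add: relsys_def bs flip: a1_def)
  have cb: "meval b c0 = meval a1 c0"
    by (rule meval_cong) (use c0(1) bs(2) in \<open>auto simp: mpolys_iff yvars_def dest!: subsetD\<close>)
  have w1: "wval n d f0 k (reorder id b) = exp (?l k / N)" if "k \<in> B" for k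
  proof -
    have "(\<Prod>i<n. \<Prod>j\<in>{..<n} - {i}. b (Lv i) - b (Yv (d + j))) = Q"
      unfolding Q_def by (intro prod.cong refl) (auto simp: bs)
    then show ?thesis using Q c1 by (simp add: wval_def f0_val[OF bp] rb cb bs(4))
  qed
  have w2: "wval n d f0 k (reorder \<sigma> b) = 1" if \<sigma>: "\<sigma> permutes {..<n}" "\<sigma> \<noteq> id" for k \<sigma>
  proof -
    obtain i where i: "\<sigma> i \<noteq> i" using \<sigma>(2) by fastforce
    then have "i < n" using permutes_not_in[OF \<sigma>(1), of i] by auto
    moreover have "\<sigma> i < n" using permutes_in_image[OF \<sigma>(1), of i] \<open>i < n\<close> by simp
    \<comment> \<open>The factor for \<open>j = \<sigma> i\<close> is zero, because the parameter
      \<xi> of index \<open>j\<close> was set to the eigenvalue of index \<open>j\<close>.\<close>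
    ultimately have "(\<Prod>j\<in>{..<n} - {i}. b (Lv (\<sigma> i)) - b (Yv (d + j))) = 0"
      using i by (intro prod_zero) (auto simp: bs intro!: bexI[of _ "\<sigma> i"])
    then have "(\<Prod>i<n. \<Prod>j\<in>{..<n} - {i}. b (Lv (\<sigma> i)) - b (Yv (d + j))) = 0"
      using \<open>i < n\<close> by (intro prod_zero) auto
    then show ?thesis by (simp add: wval_def)
  qed
  have fin: "finite {\<sigma>. \<sigma> permutes {..<n}}" by (simp add: finite_permutations)
  have id: "id \<in> {\<sigma>. \<sigma> permutes {..<n}}" by (simp add: permutes_id)
  have "zden n d f0 B e b \<noteq> 0"
  proof -
    have "wval n d f0 k (reorder \<sigma> b) \<noteq> 0" if "k \<in> B" "\<sigma> permutes {..<n}" for k \<sigma>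
      using w1[OF that(1)] w2[OF that(2), of k] by (cases "\<sigma> = id") auto
    then show ?thesis using B(2) fin by (simp add: zden_def)
  qed
  then have "den b \<noteq> 0" using lagden_nonzero[OF inj] by (simp add: xden_def bs)
  moreover have "z b i = exp (b (Lv i))" if i: "i < n" for i
  proof -
    have "(\<Prod>\<sigma> | \<sigma> permutes {..<n}. wval n d f0 k (reorder \<sigma> b) powi \<nu>' k (inv_into UNIV \<sigma> i)) =
        exp (?l k / N) powi \<nu> k i" if k: "k \<in> B" for k
    proof -
      have "(\<Prod>\<sigma>\<in>{\<sigma>. \<sigma> permutes {..<n}} - {id}. wval n d f0 k (reorder \<sigma> b) powi \<nu>' k (inv_into UNIV \<sigma> i)) = 1"
        by (rule prod.neutral) (auto simp: w2)
      then show ?thesis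
        using w1[OF k] i by (subst prod.remove[OF fin id]) (simp add: \<nu>'_def inv_id)
    qed
    then have "z b i = (\<Prod>k\<in>B. exp (?l k / N) powi \<nu> k i)" by (simp add: zval_def)
    also have "\<dots> = exp (\<Sum>k\<in>B. \<nu> k i * (?l k / N))" by (simp add: exp_sum B(2) exp_power_int)
    also have "(\<Sum>k\<in>B. \<nu> k i * (?l k / N)) = (\<Sum>k\<in>B. \<nu> k i * ?l k) / N"
      by (simp add: sum_divide_distrib)
    also have "(\<Sum>k\<in>B. \<nu> k i * ?l k) = N * ?l i" using rb i by (simp add: relsys_def bs)
    also have "N * ?l i / N = ?l i" using B(3) by simp
    finally show ?thesis by (simp add: bs)
  qed
  moreover have "\<forall>i<d. b (Yv i) = a (Yv i)" by (simp add: bs a1_def)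
  ultimately show ?thesis using bp by blast
qed

lemma prod_powi:
  fixes w :: real
  assumes "w \<noteq> 0"
  shows "(\<Prod>i\<in>S. (w powi m i) ^ \<alpha> i) = w powi (\<Sum>i\<in>S. int (\<alpha> i) * m i)"
proof -
  have "(w powi m i) ^ \<alpha> i = w powi (int (\<alpha> i) * m i)" for i
    by (simp add: power_int_mult mult.commute[of "int _"])
  then show ?thesis
    by (induct S rule: infinite_finite_induct) (auto simp: power_int_add assms)
qed

text \<open>Collects the exponents of each weight; equality of two monomials in \<open>z a\<close>
  then follows from equality of integer pairings with \<open>\<nu>'\<close>.\<close>

lemma z_monomial:
  assumes "den a \<noteq> 0"
  shows "(\<Prod>i<n. z a i ^ \<alpha> i) = (\<Prod>k\<in>B. \<Prod>\<sigma> | \<sigma> permutes {..<n}.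
    wval n d f0 k (reorder \<sigma> a) powi (\<Sum>i<n. int (\<alpha> i) * \<nu>' k (inv_into UNIV \<sigma> i)))"
proof -
  have z0: "zden n d f0 B e a \<noteq> 0" using assms by (simp add: xden_def)
  have "(\<Prod>i<n. z a i ^ \<alpha> i) = (\<Prod>i<n. \<Prod>k\<in>B. \<Prod>\<sigma> | \<sigma> permutes {..<n}.
     (wval n d f0 k (reorder \<sigma> a) powi \<nu>' k (inv_into UNIV \<sigma> i)) ^ \<alpha> i)"
    by (simp add: zval_def prod_power_distrib)
  also have "\<dots> = (\<Prod>k\<in>B. \<Prod>\<sigma> | \<sigma> permutes {..<n}. \<Prod>i<n.
     (wval n d f0 k (reorder \<sigma> a) powi \<nu>' k (inv_into UNIV \<sigma> i)) ^ \<alpha> i)"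
    by (subst prod.swap) (intro prod.cong refl prod.swap)
  also have "\<dots> = (\<Prod>k\<in>B. \<Prod>\<sigma> | \<sigma> permutes {..<n}.
    wval n d f0 k (reorder \<sigma> a) powi (\<Sum>i<n. int (\<alpha> i) * \<nu>' k (inv_into UNIV \<sigma> i)))"
    by (intro prod.cong refl prod_powi) (use zden_nonzero[OF z0 e(1) B(2)] in auto)
  finally show ?thesis .
qed

text \<open>At a generic point, exponents \<alpha> and \<beta> of equal frequency give equal
  monomials in \<open>z a\<close>. Indeed, an ordering that satisfies the system turns the equality
  of frequencies into a relation \<open>v\<close>, which by minimality of \<open>B\<close> is
  orthogonal to all \<open>\<nu> k\<close>; at the other orderings the weights are 1. Only finitely
  many \<open>v\<close> occur, and \<open>c\<close> is the product of their exceptional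
  polynomials.\<close>

lemma generic_vanishing:
  assumes f: "f \<in> xpolys n" and van: "\<forall>M\<in>exp_image n d A. eval_at_mat M f = 0"
  shows "\<exists>c\<in>mpolys UNIV (yvars d). c \<noteq> 0 \<and> (\<forall>a\<in>points. meval a c \<noteq> 0 \<longrightarrow> den a \<noteq> 0 \<longrightarrow>
    meval (\<lambda>v. of_real (xval n d A a (z a) v)) f = 0)"
proof -
  obtain S :: "(nat \<Rightarrow> nat) set" where S: "finite S" "\<And>a. \<exists>c. \<forall>z.
    meval (\<lambda>v. of_real (xval n d A a z v)) f = (\<Sum>\<alpha>\<in>S. c \<alpha> * of_real (\<Prod>i<n. z i ^ \<alpha> i))"
    using expand_in_z[OF f] by blast
  define G where "G v c \<longleftrightarrow> c \<in> mpolys UNIV (yvars d) \<and> c \<noteq> 0 \<and> (\<forall>a\<in>points. meval a c \<noteq> 0 \<longrightarrow> (\<forall>\<sigma>. \<sigma> permutes {..<n} \<and>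
      relsys n B N \<nu> (reorder \<sigma> a) \<longrightarrow> (\<Sum>i<n. v i * a (Lv (\<sigma> i))) = 0 \<longrightarrow> (\<forall>k\<in>B. (\<Sum>i<n. v i * \<nu> k i) = 0)))"
    for v :: "nat \<Rightarrow> int" and c
  have "\<exists>c. G v c" for v
  proof (cases "\<forall>k\<in>B. (\<Sum>i<n. v i * \<nu> k i) = 0")
    case True
    then show ?thesis by (intro exI[of _ 1]) (auto simp: G_def mpolys_closed)
  next
    case False
    then obtain k0 where k0: "k0 \<in> B" "(\<Sum>i<n. v i * \<nu> k0 i) \<noteq> 0" by blast
    have "\<exists>c\<in>mpolys UNIV (yvars d). c \<noteq> 0 \<and> (\<forall>a\<in>points. meval a c \<noteq> 0 \<longrightarrow>
      (\<forall>\<sigma>. \<sigma> permutes {..<n} \<and> relsys n B N \<nu> (reorder \<sigma> a) \<longrightarrow> (\<Sum>i<n. v i * a (Lv (\<sigma> i))) \<noteq> 0))"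
      by (rule base.minimal_relsys_independent[OF gen _ k0]) (rule min)
    then show ?thesis unfolding G_def by blast
  qed
  then have "\<forall>v. \<exists>c. G v c" by blast
  from choice[OF this] obtain cv where "\<And>v. G v (cv v)" by blast
  then have cv: "\<And>v. cv v \<in> mpolys UNIV (yvars d)" "\<And>v. cv v \<noteq> 0"
    "\<And>v a \<sigma> k. a \<in> points \<Longrightarrow> meval a (cv v) \<noteq> 0 \<Longrightarrow> \<sigma> permutes {..<n} \<Longrightarrow> relsys n B N \<nu> (reorder \<sigma> a) \<Longrightarrow>
      (\<Sum>i<n. v i * a (Lv (\<sigma> i))) = 0 \<Longrightarrow> k \<in> B \<Longrightarrow> (\<Sum>i<n. v i * \<nu> k i) = 0"
    unfolding G_def by blast+
  let ?v = "\<lambda>\<alpha> \<beta> \<sigma> j. int (\<alpha> (\<sigma> j)) - int (\<beta> (\<sigma> j))"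
  let ?P = "{\<sigma>. \<sigma> permutes {..<n}}"
  have fin: "finite ?P" by (simp add: finite_permutations)
  define c where "c = (\<Prod>\<alpha>\<in>S. \<Prod>\<beta>\<in>S. \<Prod>\<sigma>\<in>?P. cv (?v \<alpha> \<beta> \<sigma>))"
  have "c \<in> mpolys UNIV (yvars d)"
    unfolding c_def by (intro mpolys_closed(9) subring_set_UNIV cv)
  moreover have "c \<noteq> 0" using S(1) fin cv(2) by (simp add: c_def)
  moreover have "meval (\<lambda>v. of_real (xval n d A a (z a) v)) f = 0"
    if a: "a \<in> points" and ca: "meval a c \<noteq> 0" and da: "den a \<noteq> 0" for a
  proof -
    let ?l = "\<lambda>i. a (Lv i)"
    have cva: "meval a (cv (?v \<alpha> \<beta> \<sigma>)) \<noteq> 0" if "\<alpha> \<in> S" "\<beta> \<in> S" "\<sigma> permutes {..<n}" for \<alpha> \<beta> \<sigma>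
      using ca that S(1) fin by (auto simp: c_def meval.hom_prod)
    obtain cc where cc: "\<And>z. meval (\<lambda>v. of_real (xval n d A a z v)) f =
        (\<Sum>\<alpha>\<in>S. cc \<alpha> * of_real (\<Prod>i<n. z i ^ \<alpha> i))"
      using S(2) by blast
    \<comment> \<open>The coefficients \<open>cc\<close> depend on \<open>a\<close> but not on z, so
      the exponential sum along the ray and the value at \<open>z a\<close> share them.\<close>
    have "(\<Sum>\<alpha>\<in>S. cc \<alpha> * of_real (\<Prod>i<n. z a i ^ \<alpha> i)) = 0"
    proof (rule frequency_sums_vanish[OF S(1)])
      fix k :: nat
      have "cmat (mat_exp (mat_lincomb n d A (\<lambda>i. k * a (Yv i)))) \<in> exp_image n d A"
        by (auto simp: exp_image_def)
      then have "meval (\<lambda>v. of_real (xval n d A a (\<lambda>i. exp (k * ?l i)) v)) f = 0"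
        using van eval_exp_at[OF a f, of k] by simp
      then show "(\<Sum>\<alpha>\<in>S. cc \<alpha> * of_real (\<Prod>i<n. exp (k * ?l i) ^ \<alpha> i)) = 0" by (simp only: cc)
    next
      fix \<alpha> \<beta> assume ab: "\<alpha> \<in> S" "\<beta> \<in> S" "(\<Sum>i<n. real (\<alpha> i) * ?l i) = (\<Sum>i<n. real (\<beta> i) * ?l i)"
      have "wval n d f0 k (reorder \<sigma> a) powi (\<Sum>i<n. int (\<alpha> i) * \<nu>' k (inv_into UNIV \<sigma> i)) =
          wval n d f0 k (reorder \<sigma> a) powi (\<Sum>i<n. int (\<beta> i) * \<nu>' k (inv_into UNIV \<sigma> i))"
        if k: "k \<in> B" and \<sigma>: "\<sigma> permutes {..<n}" for k \<sigma>
      proof (cases "relsys n B N \<nu> (reorder \<sigma> a)")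
        case False
        then have "meval (reorder \<sigma> a) f0 = 0" using f0_val[OF base.reorder_points[OF a \<sigma>]] by simp
        then show ?thesis by (simp add: wval_def)
      next
        case True
        have r: "(\<Sum>i<n. int (\<alpha> i) * \<nu>' k (inv_into UNIV \<sigma> i)) = (\<Sum>j<n. int (\<alpha> (\<sigma> j)) * \<nu> k j)" for \<alpha> :: "nat \<Rightarrow> nat"
        proof -
          have "(\<Sum>i<n. int (\<alpha> i) * \<nu>' k (inv_into UNIV \<sigma> i)) =
              (\<Sum>j<n. int (\<alpha> (\<sigma> j)) * \<nu>' k (inv_into UNIV \<sigma> (\<sigma> j)))"
            by (subst sum.permute[OF \<sigma>]) (simp add: comp_def)
          then show ?thesis by (simp add: permutes_inverses(2)[OF \<sigma>] \<nu>'_def)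
        qed
        have "(\<Sum>i<n. real (\<alpha> (\<sigma> i)) * ?l (\<sigma> i)) = (\<Sum>i<n. real (\<beta> (\<sigma> i)) * ?l (\<sigma> i))"
          using ab(3) sum.permute[OF \<sigma>, of "\<lambda>i. real (\<alpha> i) * ?l i"] sum.permute[OF \<sigma>, of "\<lambda>i. real (\<beta> i) * ?l i"]
          by (simp add: comp_def)
        then have "(\<Sum>i<n. ?v \<alpha> \<beta> \<sigma> i * ?l (\<sigma> i)) = 0"
          by (simp add: left_diff_distrib sum_subtractf)
        from cv(3)[OF a cva[OF ab(1,2) \<sigma>] \<sigma> True this k]
        show ?thesis unfolding r by (simp add: left_diff_distrib sum_subtractf)
      qed
      then have "(\<Prod>i<n. z a i ^ \<alpha> i) = (\<Prod>i<n. z a i ^ \<beta> i)"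
        unfolding z_monomial[OF da] by (intro prod.cong refl) auto
      then show "complex_of_real (\<Prod>i<n. z a i ^ \<alpha> i) = of_real (\<Prod>i<n. z a i ^ \<beta> i)" by simp
    qed
    then show ?thesis by (simp only: cc)
  qed
  ultimately show ?thesis by blast
qed

text \<open>The two images are compared only through the polynomials that vanish on them. One
  direction is \<open>generic_vanishing\<close> at real parameters, the other uses that generic
  exponentials are attained by suitable parameters.\<close>

lemma exp_image_rational:
  "\<exists>p q. (\<forall>k l. k < n \<longrightarrow> l < n \<longrightarrow> p k l \<in> mpolys UNIV {..<d + 2 * n}) \<and> q \<in> mpolys UNIV {..<d + 2 * n} \<and> q \<noteq> 0 \<and>
    (\<forall>f\<in>xpolys n. (\<forall>M\<in>exp_image n d A. eval_at_mat M f = 0) \<longleftrightarrow> (\<forall>M\<in>rational_image n p q. eval_at_mat M f = 0))"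
proof -
  let ?m = "d + 2 * n"
  obtain cd where cd: "cd \<in> mpolys UNIV (yvars ?m)" "\<And>a. a \<in> points \<Longrightarrow> meval a cd = den a"
    using symmetric_polyfun[OF polyfun_den xden_reorder] by blast
  have "\<exists>c\<in>mpolys UNIV (yvars ?m). k < n \<longrightarrow> l < n \<longrightarrow> (\<forall>a\<in>points. meval a c = num k l a)" for k l
    using symmetric_polyfun[OF polyfun_num xnum_reorder, of k l] mpolys_closed(1)[OF subring_set_UNIV] by blast
  then obtain cn where cn: "\<And>k l. cn k l \<in> mpolys UNIV (yvars ?m)"
    "\<And>k l a. k < n \<Longrightarrow> l < n \<Longrightarrow> a \<in> points \<Longrightarrow> meval a (cn k l) = num k l a" by metis
  define p where "p k l = complex_poly (cn k l)" for k l
  define q where "q = complex_poly cd"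
  let ?t = "\<lambda>a i. complex_of_real (a (Yv i))"
  have tq: "meval (?t a) q = of_real (den a)" if "a \<in> points" for a
    unfolding q_def using meval_complex_poly[OF cd(1), of "?t a" a] cd(2)[OF that] by simp
  have val: "meval (rational_value p q (?t a)) f = meval (\<lambda>v. of_real (xval n d A a (z a) v)) f"
    if a: "a \<in> points" and da: "den a \<noteq> 0" and f: "f \<in> xpolys n" for a f
  proof (rule meval_cong)
    fix v assume "v \<in> mvars f"
    then have "v \<in> xvars n" using f by (auto simp: mpolys_iff)
    then obtain k l where v: "v = Xv k l" "k < n" "l < n" by (auto simp: xvars_def)
    have "meval (?t a) (p k l) = of_real (num k l a)"
      unfolding p_def using meval_complex_poly[OF cn(1), of "?t a" a] cn(2)[OF v(2,3) a] by simp
    then show "rational_value p q (?t a) v = of_real (xval n d A a (z a) v)"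
      using xnum_over_xden[OF da e B(2), where A = A and s = k and t = l] by (simp add: rational_value_def v(1) tq[OF a] flip: of_real_divide)
  qed
  \<comment> \<open>Joining \<open>c0\<close> to the discriminant provides a point from which
    parameters with nonzero denominator can be built, so \<open>q\<close> is not the zero
    polynomial.\<close>
  have "root_family UNIV (yvars d) n (char_poly (pencil n d A)) (h * c0)"
    by (rule base.refine) (use c0 yvars_lvars[of d n] in \<open>auto simp: mpolys_iff\<close>)
  from root_family.ex_points[OF this] obtain a0 where "a0 \<in> points" "meval a0 c0 \<noteq> 0"
    by (auto simp: base.pts_refine)
  then obtain b0 where "b0 \<in> points" "den b0 \<noteq> 0" using parameters_for_exp by blast
  then have q0: "q \<noteq> 0" using tq[of b0] by auto
  have "(\<forall>M\<in>exp_image n d A. eval_at_mat M f = 0) \<longleftrightarrow> (\<forall>M\<in>rational_image n p q. eval_at_mat M f = 0)"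
    if f: "f \<in> xpolys n" for f
  proof
    assume "\<forall>M\<in>exp_image n d A. eval_at_mat M f = 0"
    from generic_vanishing[OF f this] obtain c where c: "c \<in> mpolys UNIV (yvars d)" "c \<noteq> 0"
      "\<And>a. a \<in> points \<Longrightarrow> meval a c \<noteq> 0 \<Longrightarrow> den a \<noteq> 0 \<Longrightarrow> meval (\<lambda>v. of_real (xval n d A a (z a) v)) f = 0"
      by blast
    have "h \<in> mpolys UNIV (yvars d)" using h_yvars by (simp add: mpolys_iff)
    then have "h * c \<in> mpolys UNIV (yvars d)" using c(1) by (simp add: mpolys_closed)
    then have hc: "h * c \<in> mpolys UNIV (yvars ?m)" by (rule mpolys_mono) (auto simp: yvars_def)
    have hc0: "complex_poly (h * c) \<noteq> 0" by (rule complex_poly_nonzero[OF hc]) (use h0 c(2) in simp)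
    \<comment> \<open>Real parameters off \<open>h * c\<close> admit real eigenvalues, and there
      \<open>val\<close> identifies the rational map with the matrix built from
      \<open>z\<close>.\<close>
    show "\<forall>M\<in>rational_image n p q. eval_at_mat M f = 0"
      unfolding rational_image_vanishing[OF n_pos f]
    proof (intro allI impI, rule rational_vanishing_real[OF f q0 hc0])
      fix t assume t: "range t \<subseteq> range complex_of_real" "meval t q \<noteq> 0" "meval t (complex_poly (h * c)) \<noteq> 0"
      define a where "a v = (case v of Yv i \<Rightarrow> Re (t i) | _ \<Rightarrow> 0)" for v
      have ta: "t i = of_real (a (Yv i))" for i using t(1) by (auto simp: a_def dest!: subsetD[of _ _ "t i"])
      have ha: "meval a h \<noteq> 0" "meval a c \<noteq> 0"
        using t(3) meval_complex_poly[OF hc, of t a] ta by (auto simp: meval.hom_mult)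
      then obtain b where b: "b \<in> points" "\<And>v. v \<notin> lvars n \<Longrightarrow> b v = a v" using base.ex_point by blast
      have by': "b (Yv i) = a (Yv i)" for i by (rule b(2)) (auto simp: lvars_def)
      have tb: "t = ?t b" by (simp add: fun_eq_iff ta by')
      have "meval b c \<noteq> 0" using ha(2) base.meval_agree[OF c(1) yvars_lvars b(2)] by simp
      moreover have db: "den b \<noteq> 0" using t(2) tq[OF b(1)] by (simp add: tb)
      ultimately show "meval (rational_value p q t) f = 0"
        unfolding tb val[OF b(1) db f] by (intro c(3)[OF b(1)])
    qed
  next
    assume van: "\<forall>M\<in>rational_image n p q. eval_at_mat M f = 0"
    have hc: "h * c0 \<noteq> 0" using h0 c0(2) by simp
    show "\<forall>M\<in>exp_image n d A. eval_at_mat M f = 0"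
    proof
      fix M assume "M \<in> exp_image n d A"
      then obtain y where M: "M = cmat (mat_exp (mat_lincomb n d A y))" by (auto simp: exp_image_def)
      show "eval_at_mat M f = 0"
        unfolding M
      proof (rule vanishing_extends[OF hc f])
        fix a assume "meval a (h * c0) \<noteq> 0"
        then have ha: "meval a h \<noteq> 0" "meval a c0 \<noteq> 0" by (auto simp: meval.hom_mult)
        then obtain b where b: "b \<in> points" "\<And>v. v \<notin> lvars n \<Longrightarrow> b v = a v" using base.ex_point by blast
        have "meval b c0 \<noteq> 0" using ha(2) base.meval_agree[OF c0(1) yvars_lvars b(2)] by simp
        then obtain b' where b': "b' \<in> points" "\<And>i. i < d \<Longrightarrow> b' (Yv i) = b (Yv i)" "den b' \<noteq> 0"
            "\<And>i. i < n \<Longrightarrow> z b' i = exp (b' (Lv i))"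
          using parameters_for_exp[OF b(1)] by blast
        have "b' (Yv i) = a (Yv i)" if "i < d" for i
          using b'(2)[OF that] b(2)[of "Yv i"] by (auto simp: lvars_def)
        then have "mat_lincomb n d A (\<lambda>i. a (Yv i)) = mat_lincomb n d A (\<lambda>i. 1 * b' (Yv i))"
          by (intro eq_matI) (auto simp: mat_lincomb_def)
        moreover have "xval n d A b' (z b') = xval n d A b' (\<lambda>i. exp (1 * b' (Lv i)))"
          by (auto simp: xval_def fun_eq_iff b'(4) split: var.splits intro!: sum.cong)
        moreover have "meval (rational_value p q (?t b')) f = 0"
          using van tq[OF b'(1)] b'(3) unfolding rational_image_vanishing[OF n_pos f] by simp
        ultimately show "eval_at_mat (cmat (mat_exp (mat_lincomb n d A (\<lambda>i. a (Yv i))))) f = 0"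
          using eval_exp_at[OF b'(1) f, of 1] val[OF b'(1,3) f] by simp
      qed
    qed
  qed
  moreover have "p k l \<in> mpolys UNIV {..<?m}" for k l unfolding p_def by (rule complex_poly_in[OF cn(1)])
  moreover have "q \<in> mpolys UNIV {..<?m}" unfolding q_def by (rule complex_poly_in[OF cd(1)])
  ultimately show ?thesis using q0 by blast
qed

end

section \<open>Factors and elementary symmetric polynomials\<close>

lemma mvar_inject: "(mvar v :: rpoly) = mvar w \<longleftrightarrow> v = w"
proof
  assume "(mvar v :: rpoly) = mvar w"
  from arg_cong[OF this, of "meval (\<lambda>u. if u = v then 1 else 0)"] show "v = w" by (auto split: if_splits)
qed simp

text \<open>\<open>\<Phi>\<close> reads a polynomial as a univariate one in \<open>v\<close>.
  Degrees in \<open>v\<close> add up, so the factors of a product without \<open>v\<close> are free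
  of \<open>v\<close>. This will show that \<open>D\<close> involves the eigenvalues only.\<close>

lemma mvars_factor:
  fixes p q :: rpoly
  assumes "p * q \<noteq> 0"
  shows "mvars p \<subseteq> mvars (p * q)"
proof
  fix v assume v: "v \<in> mvars p"
  show "v \<in> mvars (p * q)"
  proof (rule ccontr)
    assume nv: "v \<notin> mvars (p * q)"
    define \<Phi> where "\<Phi> = mhom (\<lambda>c. [:mconst c:]) (\<lambda>w. if w = v then [:0, 1:] else [:mvar w :: rpoly:])"
    have hc: "comm_ring_hom (\<lambda>c::real. [:mconst c :: rpoly:])"
      by unfold_locales (auto simp: mconst.hom_add mconst.hom_mult one_pCons)
    interpret \<Phi>: comm_ring_hom \<Phi> unfolding \<Phi>_def by (rule comm_ring_hom.mhom_hom[OF hc])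
    have ev: "poly (\<Phi> r) x = mhom mconst (\<lambda>w. if w = v then x else mvar w) r" for r x
    proof -
      have "comm_ring_hom (\<lambda>f :: rpoly poly. poly f x)" by unfold_locales auto
      moreover have "poly (if w = v then [:0, 1:] else [:mvar w :: rpoly:]) x = (if w = v then x else mvar w)" for w
        by simp
      ultimately show ?thesis
        unfolding \<Phi>_def by (subst comm_ring_hom.hom_mhom[OF hc]) (simp_all only: poly_pCons poly_0 mult_zero_right add_0_right)
    qed
    have pv: "poly (\<Phi> r) (mvar v) = r" for r
      unfolding ev by (subst mhom_mconst_mvar[symmetric]) (rule mhom_cong, auto)
    have "\<Phi> (p * q) = mhom (\<lambda>c. [:mconst c:]) (\<lambda>w. [:mvar w:]) (p * q)"
      unfolding \<Phi>_def by (rule mhom_cong) (use nv in auto)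
    also have "\<dots> = [:mhom mconst mvar (p * q):]"
    proof -
      have "comm_ring_hom (\<lambda>f::rpoly. [:f:])" by unfold_locales (auto simp: one_pCons)
      from mconst.hom_mhom[OF this, of mvar "p * q"] show ?thesis by simp
    qed
    finally have "\<Phi> p * \<Phi> q = [:p * q:]" by (simp add: mhom_mconst_mvar \<Phi>.hom_mult)
    moreover from this have "\<Phi> p \<noteq> 0" "\<Phi> q \<noteq> 0" using assms by auto
    ultimately have "degree (\<Phi> p) + degree (\<Phi> q) = 0" using degree_mult_eq[of "\<Phi> p" "\<Phi> q"] by simp
    then obtain s where s: "\<Phi> p = [:s:]" using degree_eq_zeroE[of "\<Phi> p"] by auto
    have "p = mhom mconst (\<lambda>w. if w = v then 0 else mvar w) p"
      using pv[of p] ev[of p 0] s by simp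
    moreover have "p \<in> mpolys UNIV UNIV" by (simp add: mpolys_iff)
    then have "mhom mconst (\<lambda>w. if w = v then 0 else mvar w) p \<in> mpolys UNIV (UNIV - {v})"
      by (rule mhom_mpolys) (auto simp: comm_ring_hom_mconst mpolys_closed)
    ultimately show False using v by (simp add: mpolys_iff) blast
  qed
qed

section \<open>Vieta's formulas and the generators \<open>E1'\<close>\<close>

lemma coeff_prod_linear:
  fixes x :: "nat \<Rightarrow> 'a::comm_ring_1"
  assumes "i \<le> n"
  shows "coeff (\<Prod>j<n. [:- x j, 1:]) i = (- 1) ^ (n - i) * (\<Sum>S | S \<subseteq> {..<n} \<and> card S = n - i. \<Prod>j\<in>S. x j)"
proof -
  have "(\<Prod>j<n. [:- x j, 1:]) = (\<Prod>j<n. [:- x j:] + [:0, 1:])" by simp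
  also have "\<dots> = (\<Sum>S\<in>Pow {..<n}. (\<Prod>j\<in>S. [:- x j:]) * (\<Prod>j\<in>{..<n} - S. [:0, 1:]))"
    by (rule prod_add) simp
  also have "\<dots> = (\<Sum>S\<in>Pow {..<n}. Polynomial.monom ((- 1) ^ card S * (\<Prod>j\<in>S. x j)) (n - card S))"
  proof (rule sum.cong[OF refl])
    fix S assume "S \<in> Pow {..<n}"
    then have S: "S \<subseteq> {..<n}" "finite S" using finite_subset[of S "{..<n}"] by auto
    have "(\<Prod>j\<in>S. [:- x j:]) = [:\<Prod>j\<in>S. - x j:]" by (rule prod_to_poly)
    also have "(\<Prod>j\<in>S. - x j) = (- 1) ^ card S * (\<Prod>j\<in>S. x j)" by (simp add: prod_uminus)
    finally have 1: "(\<Prod>j\<in>S. [:- x j:]) = [:(- 1) ^ card S * (\<Prod>j\<in>S. x j):]" .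
    have "card ({..<n} - S) = n - card S" using S by (simp add: card_Diff_subset)
    then have 2: "(\<Prod>j\<in>{..<n} - S. [:0, 1:] :: 'a poly) = Polynomial.monom 1 (n - card S)"
      by (simp add: monom_altdef)
    show "(\<Prod>j\<in>S. [:- x j:]) * (\<Prod>j\<in>{..<n} - S. [:0, 1:]) = Polynomial.monom ((- 1) ^ card S * (\<Prod>j\<in>S. x j)) (n - card S)"
      unfolding 1 2 by (simp add: smult_monom)
  qed
  finally have "coeff (\<Prod>j<n. [:- x j, 1:]) i =
      (\<Sum>S\<in>Pow {..<n}. if n - card S = i then (- 1) ^ card S * (\<Prod>j\<in>S. x j) else 0)"
    by (simp add: coeff_sum)
  also have "\<dots> = (\<Sum>S\<in>{S \<in> Pow {..<n}. n - card S = i}. (- 1) ^ card S * (\<Prod>j\<in>S. x j))"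
    by (rule sum.inter_filter[symmetric]) simp
  also have "{S \<in> Pow {..<n}. n - card S = i} = {S. S \<subseteq> {..<n} \<and> card S = n - i}"
  proof -
    have "card S \<le> n" if "S \<subseteq> {..<n}" for S using card_mono[OF _ that] by simp
    then show ?thesis using assms by fastforce
  qed
  also have "(\<Sum>S | S \<subseteq> {..<n} \<and> card S = n - i. (- 1) ^ card S * (\<Prod>j\<in>S. x j)) =
      (- 1) ^ (n - i) * (\<Sum>S | S \<subseteq> {..<n} \<and> card S = n - i. \<Prod>j\<in>S. x j)"
    unfolding sum_distrib_left by (rule sum.cong) auto
  finally show ?thesis .
qed

text \<open>The sign comes from det(A - \<lambda>) against det(\<lambda> - A); it is a unit and does
  not affect the ideal.\<close>

lemma E1'_eq:
  "E1' n d A = (\<lambda>i. (- 1) ^ n * coeff ((\<Prod>j<n. [:- mvar (Lv j), 1:]) - char_poly (pencil n d A)) i) ` {..<n}"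
  unfolding E1'_def
proof (rule image_cong[OF refl])
  fix i assume "i \<in> {..<n}"
  then have i: "i \<le> n" by simp
  obtain k where k: "n = i + k" using i le_Suc_ex by blast
  have "(- 1) ^ n * (- 1) ^ (n - i) = ((- 1) ^ i :: rpoly)"
    unfolding k by (simp add: power_add mult.assoc)
  then have "(- 1) ^ n * coeff (\<Prod>j<n. [:- mvar (Lv j) :: rpoly, 1:]) i = (- 1) ^ i * elem_sym n (n - i)"
    unfolding coeff_prod_linear[OF i] elem_sym_def by (simp add: mult.assoc[symmetric])
  then show "(- 1) ^ i * elem_sym n (n - i) - coeff (pencil_char_poly n d A) i =
      (- 1) ^ n * coeff ((\<Prod>j<n. [:- mvar (Lv j), 1:]) - char_poly (pencil n d A)) i"
    by (simp add: pencil_char_poly_eq right_diff_distrib)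
qed

section \<open>Real polynomials at complex arguments\<close>

lemma lookup_map_of_real:
  "Poly_Mapping.lookup (Poly_Mapping.map complex_of_real p) m = of_real (Poly_Mapping.lookup p m)"
  by (simp add: Poly_Mapping.map.rep_eq "when_def")

lemma keys_map_of_real: "Poly_Mapping.keys (Poly_Mapping.map complex_of_real p) = Poly_Mapping.keys p"
  by (auto simp: in_keys_iff lookup_map_of_real)

lemma map_of_real_in: "p \<in> mpolys UNIV V \<Longrightarrow> Poly_Mapping.map complex_of_real p \<in> mpolys UNIV V"
  by (simp add: mpolys_iff mvars_def keys_map_of_real)

lemma meval_map_of_real: "meval c (Poly_Mapping.map complex_of_real p) = mhom complex_of_real c p"
  by (simp add: meval_def mhom_def lookup_map_of_real keys_map_of_real)

section \<open>Descent of coefficients\<close>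

interpretation real_rat: vector_space "\<lambda>q x. real_of_rat q * x"
  by unfold_locales (auto simp: algebra_simps of_rat_add of_rat_mult)

definition coeff_map :: "(real \<Rightarrow> real) \<Rightarrow> rpoly \<Rightarrow> rpoly" where
  "coeff_map \<psi> p = (\<Sum>m\<in>Poly_Mapping.keys p. Poly_Mapping.single m (\<psi> (Poly_Mapping.lookup p m)))"

text \<open>\<open>\<psi>\<close> is \<rat>-linear. Applied to coefficients it is linear over the
  polynomials with rational coefficients; if its values are rational, it carries an ideal with
  rational generators from real to rational coefficients.\<close>

context
  fixes \<psi> :: "real \<Rightarrow> real"
  assumes \<psi>_add: "\<psi> (x + y) = \<psi> x + \<psi> y" and \<psi>_rat: "q \<in> \<rat> \<Longrightarrow> \<psi> (x * q) = \<psi> x * q"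
begin

lemma \<psi>_0: "\<psi> 0 = 0"
  using \<psi>_rat[of 0 0] by simp

lemma \<psi>_sum: "\<psi> (sum f S) = (\<Sum>i\<in>S. \<psi> (f i))"
  by (induct S rule: infinite_finite_induct) (auto simp: \<psi>_0 \<psi>_add)

lemma lookup_coeff_map: "Poly_Mapping.lookup (coeff_map \<psi> p) m = \<psi> (Poly_Mapping.lookup p m)"
proof -
  have "Poly_Mapping.lookup (coeff_map \<psi> p) m = (\<Sum>k\<in>Poly_Mapping.keys p. if k = m then \<psi> (Poly_Mapping.lookup p k) else 0)"
    by (simp add: coeff_map_def lookup_sum lookup_single "when_def")
  then show ?thesis by (auto simp: in_keys_iff \<psi>_0)
qed

lemma coeff_map_add: "coeff_map \<psi> (p + q) = coeff_map \<psi> p + coeff_map \<psi> q"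
  by (rule poly_mapping_eqI) (simp add: lookup_coeff_map lookup_add \<psi>_add)

lemma coeff_map_mult:
  assumes q: "q \<in> mpolys \<rat> V"
  shows "coeff_map \<psi> (p * q) = coeff_map \<psi> p * q"
proof (rule poly_mapping_eqI)
  fix m
  have l: "Poly_Mapping.lookup (r * q) m = (\<Sum>k\<in>Poly_Mapping.keys p. \<Sum>j\<in>Poly_Mapping.keys q.
      if k + j = m then Poly_Mapping.lookup r k * Poly_Mapping.lookup q j else 0)"
    if "Poly_Mapping.keys r \<subseteq> Poly_Mapping.keys p" for r
  proof -
    have "Poly_Mapping.lookup (r * q) m = (\<Sum>k\<in>Poly_Mapping.keys r. \<Sum>j\<in>Poly_Mapping.keys q.
        if k + j = m then Poly_Mapping.lookup r k * Poly_Mapping.lookup q j else 0)"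
      by (simp add: mult_sum_single[of r] lookup_sum lookup_single "when_def")
    also have "\<dots> = (\<Sum>k\<in>Poly_Mapping.keys p. \<Sum>j\<in>Poly_Mapping.keys q.
        if k + j = m then Poly_Mapping.lookup r k * Poly_Mapping.lookup q j else 0)"
      by (rule sum.mono_neutral_left) (use that in \<open>auto simp: in_keys_iff intro!: sum.neutral\<close>)
    finally show ?thesis .
  qed
  have k: "Poly_Mapping.keys (coeff_map \<psi> p) \<subseteq> Poly_Mapping.keys p"
    by (auto simp: in_keys_iff lookup_coeff_map \<psi>_0)
  show "Poly_Mapping.lookup (coeff_map \<psi> (p * q)) m = Poly_Mapping.lookup (coeff_map \<psi> p * q) m"
    unfolding lookup_coeff_map l[OF subset_refl] l[OF k] \<psi>_sum
    by (intro sum.cong refl) (use q in \<open>auto simp: \<psi>_0 mpolys_iff \<psi>_rat\<close>)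
qed

lemma coeff_map_in:
  assumes \<psi>: "\<And>x. \<psi> x \<in> \<rat>" and p: "p \<in> mpolys UNIV V"
  shows "coeff_map \<psi> p \<in> mpolys \<rat> V"
proof -
  have "Poly_Mapping.keys (coeff_map \<psi> p) \<subseteq> Poly_Mapping.keys p"
    by (auto simp: in_keys_iff lookup_coeff_map \<psi>_0)
  then show ?thesis using p \<psi> unfolding mpolys_iff lookup_coeff_map mvars_def by blast
qed

lemma coeff_map_idl:
  assumes \<psi>: "\<And>x. \<psi> x \<in> \<rat>" and E: "E \<subseteq> mpolys \<rat> V" and p: "p \<in> idl (mpolys UNIV V) E"
  shows "coeff_map \<psi> p \<in> idl (mpolys \<rat> V) E"
  using p
proof induct
  case zero
  have "coeff_map \<psi> 0 = 0" by (simp add: coeff_map_def)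
  then show ?case by (simp add: idl.zero)
next
  case (step x r e)
  have "coeff_map \<psi> (x + r * e) = coeff_map \<psi> x + coeff_map \<psi> r * e"
    using step(4) E by (subst coeff_map_add, subst coeff_map_mult[of e V]) auto
  then show ?case using idl.step[OF step(2) coeff_map_in[OF \<psi> step(3)] step(4)] by simp
qed

end

text \<open>
  \<open>P \<cdot> \<real>[V]\<close> contains \<open>g\<close> as soon as \<open>P\<close> contains the images of \<open>g\<close> under all \<open>\<rat>\<close>-linear functionals.
\<close>

lemma rational_colon_descent:
  fixes f g :: rpoly
  assumes E: "E \<subseteq> mpolys \<rat> V" and f: "f \<in> mpolys \<rat> V" and g: "g \<in> mpolys UNIV V"
    and gf: "g * f \<in> idl (mpolys UNIV V) E"
    and P: "\<And>u. u \<in> mpolys \<rat> V \<Longrightarrow> u * f \<in> idl (mpolys \<rat> V) E \<Longrightarrow> u \<in> P"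
  shows "g \<in> idl (mpolys UNIV V) P"
proof -
  \<comment> \<open>A Hamel basis of \<real> over \<rat>, obtained by extending the empty set;
    \<open>\<psi> b\<close> is the coordinate at \<open>b\<close>.\<close>
  define Bs where "Bs = real_rat.extend_basis {}"
  have Bs: "real_rat.independent Bs" "real_rat.span Bs = UNIV"
    using real_rat.independent_extend_basis[OF real_rat.independent_empty]
      real_rat.span_extend_basis[OF real_rat.independent_empty] by (auto simp: Bs_def)
  define \<psi> where "\<psi> b x = real_of_rat (real_rat.representation Bs x b)" for b x
  have add: "\<psi> b (x + y) = \<psi> b x + \<psi> b y" for b x y
    by (simp add: \<psi>_def real_rat.representation_add Bs of_rat_add)
  have rat: "\<psi> b (x * q) = \<psi> b x * q" if q: "q \<in> \<rat>" for b x q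
  proof -
    obtain r where r: "q = real_of_rat r" using Rats_cases[OF q] by blast
    show ?thesis
      using real_rat.representation_scale[OF Bs(1), of x r] Bs(2)
      by (simp add: \<psi>_def r mult.commute[of x] of_rat_mult)
  qed
  have inQ: "\<psi> b x \<in> \<rat>" for b x by (simp add: \<psi>_def)
  let ?nz = "\<lambda>x. {b. real_rat.representation Bs x b \<noteq> 0}"
  have finnz: "finite (?nz x)" for x by (rule real_rat.finite_representation)
  have expand: "x = (\<Sum>b\<in>T. \<psi> b x * b)" if "finite T" "?nz x \<subseteq> T" for x T
  proof -
    have "x = (\<Sum>b\<in>?nz x. \<psi> b x * b)"
      using real_rat.sum_nonzero_representation_eq[OF Bs(1), of x] Bs(2) by (simp add: \<psi>_def)
    also have "\<dots> = (\<Sum>b\<in>T. \<psi> b x * b)"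
      by (rule sum.mono_neutral_left) (use that in \<open>auto simp: \<psi>_def\<close>)
    finally show ?thesis .
  qed
  have lookup_cm: "Poly_Mapping.lookup (coeff_map (\<psi> b) g) m = \<psi> b (Poly_Mapping.lookup g m)" for b m
    by (rule lookup_coeff_map[where \<psi> = "\<psi> b", OF add rat])
  have P': "coeff_map (\<psi> b) g \<in> P" for b
  proof (rule P)
    show "coeff_map (\<psi> b) g \<in> mpolys \<rat> V" by (rule coeff_map_in[where \<psi> = "\<psi> b", OF add rat inQ g])
    show "coeff_map (\<psi> b) g * f \<in> idl (mpolys \<rat> V) E"
      using coeff_map_idl[where \<psi> = "\<psi> b", OF add rat inQ E gf]
      by (simp add: coeff_map_mult[where \<psi> = "\<psi> b", OF add rat f])
  qed
  define T where "T = (\<Union>m\<in>Poly_Mapping.keys g. ?nz (Poly_Mapping.lookup g m))"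
  have T: "finite T" using finnz by (simp add: T_def)
  \<comment> \<open>The coordinates of the coefficients reassemble \<open>g\<close> as a finite real
    combination of rational polynomials, all of which lie in \<open>P\<close>.\<close>
  have "g = (\<Sum>b\<in>T. mconst b * coeff_map (\<psi> b) g)"
  proof (rule poly_mapping_eqI)
    fix m
    have lk: "Poly_Mapping.lookup (mconst b * p) m = b * Poly_Mapping.lookup p m" for b and p :: rpoly
    proof -
      have "mconst b * p = Poly_Mapping.map ((*) b) p"
        by (simp add: mconst_def mult_map_scale_conv_mult)
      then show ?thesis by (simp add: Poly_Mapping.map.rep_eq "when_def")
    qed
    have sub: "?nz (Poly_Mapping.lookup g m) \<subseteq> T"
      by (cases "m \<in> Poly_Mapping.keys g") (auto simp: T_def in_keys_iff real_rat.representation_zero)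
    have "Poly_Mapping.lookup (\<Sum>b\<in>T. mconst b * coeff_map (\<psi> b) g) m = (\<Sum>b\<in>T. b * \<psi> b (Poly_Mapping.lookup g m))"
      by (simp add: lookup_sum lk lookup_cm)
    then show "Poly_Mapping.lookup g m = Poly_Mapping.lookup (\<Sum>b\<in>T. mconst b * coeff_map (\<psi> b) g) m"
      using expand[OF T sub] by (simp only: mult.commute)
  qed
  also have "\<dots> \<in> idl (mpolys UNIV V) P"
    by (intro ideal_setD(5,3)[OF idl_ideal_set] subring_set_mpolys subring_set_UNIV mconst_mpolys idl_incl P') auto
  finally show ?thesis .
qed

section \<open>The entries of \<open>\<phi>\<close>\<close>

text \<open>The mirror image of \<open>ent_pCons_0\<close>: the products in \<open>\<phi>\<close>
  are built by multiplying from the left.\<close>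

lemma ent_pCons_0_left:
  fixes A :: "'a::comm_ring_1 mat"
  assumes A: "A \<in> carrier_mat n n" and st: "s < n" "t < n"
  shows "ent A s t (pCons 0 p) = (\<Sum>k<n. A $$ (s, k) * ent A k t p)"
proof -
  have comm: "A ^\<^sub>m Suc r = A * A ^\<^sub>m r" for r
    by (induct r) (use A in \<open>auto simp: assoc_mult_mat[of _ n n _ n _ n]\<close>)
  have "ent A s t (pCons 0 p) = (\<Sum>r\<le>Suc (degree p). coeff (pCons 0 p) r * (A ^\<^sub>m r) $$ (s, t))"
    by (rule ent_superset) (simp add: degree_pCons_le)
  also have "\<dots> = (\<Sum>r\<le>degree p. coeff p r * (A ^\<^sub>m Suc r) $$ (s, t))"
    by (simp only: sum.atMost_Suc_shift) simp
  also have "\<dots> = (\<Sum>r\<le>degree p. \<Sum>k<n. A $$ (s, k) * (coeff p r * (A ^\<^sub>m r) $$ (k, t)))"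
    unfolding comm by (simp add: mat_mult_entry[of _ n] A st sum_distrib_left ac_simps del: index_mult_mat)
  also have "\<dots> = (\<Sum>k<n. A $$ (s, k) * ent A k t p)"
    by (subst sum.swap) (simp add: ent_def sum_distrib_left)
  finally show ?thesis .
qed

abbreviation "lvar \<equiv> (\<lambda>i. mvar (Lv i) :: rpoly)"

text \<open>Each factor is multiplied by its own denominator, so the induction runs on images of
  polynomial identities. That \<open>i\<close> is outside \<open>js\<close> makes these denominators
  nonzero.\<close>

lemma \<phi>_product_entry:
  assumes "distinct js" "i \<notin> set js"
  shows "foldr (\<lambda>j M. \<phi>_factor n d A i j * M) js (1\<^sub>m n) \<in> carrier_mat n n \<and>
    (\<forall>s<n. \<forall>t<n. to_fract (\<Prod>j\<in>set js. lvar i - lvar j) *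
      foldr (\<lambda>j M. \<phi>_factor n d A i j * M) js (1\<^sub>m n) $$ (s, t) =
      to_fract (ent (pencil n d A) s t (\<Prod>j\<in>set js. [:- lvar j, 1:])))"
  using assms
proof (induct js)
  case Nil
  have "ent (pencil n d A) s t 1 = (if s = t then 1 else 0)" if "s < n" "t < n" for s t
    using ent_const[OF pencil_carrier[of n d A] that, of 1] by (simp add: one_pCons)
  then show ?case by auto
next
  case (Cons j js)
  let ?M = "foldr (\<lambda>j M. \<phi>_factor n d A i j * M) js (1\<^sub>m n)" and ?P = "pencil n d A"
  let ?p = "\<Prod>j\<in>set js. [:- lvar j, 1:]" and ?x = "\<Prod>j\<in>set js. lvar i - lvar j"
  have M: "?M \<in> carrier_mat n n"
    and IH: "\<And>s t. s < n \<Longrightarrow> t < n \<Longrightarrow> to_fract ?x * ?M $$ (s, t) = to_fract (ent ?P s t ?p)"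
    using Cons by auto
  have F: "\<phi>_factor n d A i j \<in> carrier_mat n n" unfolding \<phi>_factor_def
    by (intro smult_carrier_mat minus_carrier_mat) auto
  have ij: "lvar i - lvar j \<noteq> 0"
    using Cons.prems(2) by (auto simp: mvar_inject)
  have Fe: "to_fract (lvar i - lvar j) * \<phi>_factor n d A i j $$ (s, k) = to_fract (?P $$ (s, k)) - (if s = k then to_fract (lvar j) else 0)"
    if "s < n" "k < n" for s k
  proof -
    have "to_fract (lvar i) - to_fract (lvar j) \<noteq> 0" using ij by (metis to_fract_0 to_fract_diff to_fract_eq_iff)
    then show ?thesis using that carrier_matD[OF pencil_carrier[of n d A]] by (simp add: \<phi>_factor_def)
  qed
  have e: "to_fract ((lvar i - lvar j) * ?x) * (\<phi>_factor n d A i j * ?M) $$ (s, t) = to_fract (ent ?P s t ([:- lvar j, 1:] * ?p))"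
    if st: "s < n" "t < n" for s t
  proof -
    have "to_fract ((lvar i - lvar j) * ?x) * (\<phi>_factor n d A i j * ?M) $$ (s, t) =
        (\<Sum>k<n. (to_fract (lvar i - lvar j) * \<phi>_factor n d A i j $$ (s, k)) * (to_fract ?x * ?M $$ (k, t)))"
      unfolding mat_mult_entry[OF F M st] to_fract_mult sum_distrib_left by (simp only: ac_simps)
    also have "\<dots> = (\<Sum>k<n. (to_fract (?P $$ (s, k)) - (if s = k then to_fract (lvar j) else 0)) * to_fract (ent ?P k t ?p))"
      by (rule sum.cong) (auto simp: Fe IH st simp del: to_fract_diff)
    also have "\<dots> = (\<Sum>k<n. to_fract (?P $$ (s, k)) * to_fract (ent ?P k t ?p)) - to_fract (lvar j) * to_fract (ent ?P s t ?p)"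
      using st by (simp add: left_diff_distrib sum_subtractf if_distrib[of "\<lambda>x. x * _"] cong: if_cong)
    also have "\<dots> = to_fract (ent ?P s t (pCons 0 ?p) - lvar j * ent ?P s t ?p)"
      by (simp add: ent_pCons_0_left[OF pencil_carrier st])
    also have "ent ?P s t (pCons 0 ?p) - lvar j * ent ?P s t ?p = ent ?P s t ([:- lvar j, 1:] * ?p)"
      by (simp add: ent_diff ent_smult)
    finally show ?thesis .
  qed
  show ?case
    using Cons.prems F M e by (simp del: mult_pCons_left to_fract_mult to_fract_diff index_mult_mat)
qed

text \<open>\<open>phi_num\<close> over \<open>phi_den\<close> is an entry of \<open>\<phi>\<close>.
  The denominator is explicit and common to all entries, but need not be the least one
  \<open>D\<close>; the two are linked by \<open>D_dvd\<close>.\<close>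

definition phi_num :: "nat \<Rightarrow> nat \<Rightarrow> (nat \<Rightarrow> real mat) \<Rightarrow> nat \<Rightarrow> nat \<Rightarrow> rpoly" where
  "phi_num n d A s t = (\<Sum>i<n. mvar (Zv i) * (\<Prod>j\<in>{..<n} - {i}. lagden n lvar j) * ent (pencil n d A) s t (lag n lvar i))"

definition phi_den :: "nat \<Rightarrow> rpoly" where
  "phi_den n = (\<Prod>i<n. lagden n lvar i)"

lemma inj_lvar: "inj_on lvar {..<n}"
  by (auto simp: inj_on_def mvar_inject)

lemma phi_den_nonzero: "phi_den n \<noteq> 0"
  using lagden_nonzero[OF inj_lvar] by (simp add: phi_den_def)

lemma \<phi>_entry:
  assumes st: "s < n" "t < n"
  shows "to_fract (phi_den n) * \<phi> n d A $$ (s, t) = to_fract (phi_num n d A s t)"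
proof -
  let ?f = "\<lambda>i. foldr (\<lambda>j M. \<phi>_factor n d A i j * M) (filter (\<lambda>j. j \<noteq> i) [0..<n]) (1\<^sub>m n) $$ (s, t)"
  have "set (filter (\<lambda>j. j \<noteq> i) [0..<n]) = {..<n} - {i}" for i by auto
  then have f: "to_fract (lagden n lvar i) * ?f i = to_fract (ent (pencil n d A) s t (lag n lvar i))" for i
    using \<phi>_product_entry[of "filter (\<lambda>j. j \<noteq> i) [0..<n]" i n d A] st
    by (simp add: lagden_def lag_def)
  have den: "phi_den n = (\<Prod>j\<in>{..<n} - {i}. lagden n lvar j) * lagden n lvar i" if "i < n" for i
    unfolding phi_den_def using that by (subst prod.remove[of _ i]) (auto simp: mult.commute)
  have "to_fract (phi_den n) * \<phi> n d A $$ (s, t) = (\<Sum>i<n. to_fract (phi_den n) * (to_fract (mvar (Zv i)) * ?f i))"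
    using st by (simp add: \<phi>_def sum_distrib_left)
  also have "\<dots> = (\<Sum>i<n. to_fract (mvar (Zv i)) * to_fract (\<Prod>j\<in>{..<n} - {i}. lagden n lvar j) * (to_fract (lagden n lvar i) * ?f i))"
    by (rule sum.cong) (auto simp: den ac_simps)
  also have "\<dots> = to_fract (phi_num n d A s t)"
    by (simp add: f phi_num_def)
  finally show ?thesis .
qed

section \<open>Irreducibility and unirationality\<close>

context pencil_family
begin

lemma ex_parametrisation:
  assumes "n > 0"
  shows "\<exists>B N \<nu> f0 c0. parametrisation n d A h B N \<nu> f0 c0"
proof -
  interpret base: root_family UNIV "yvars d" n "char_poly (pencil n d A)" h
    by (rule family) auto
  obtain B N \<nu> where gen: "base.generic_relsys B N \<nu>"
    and min: "\<And>B' N' \<nu>'. base.generic_relsys B' N' \<nu>' \<Longrightarrow> card B \<le> card B'"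
    using base.ex_minimal_relsys by blast
  have "B \<subseteq> {..<n}" using gen by (simp add: base.generic_relsys_def)
  \<comment> \<open>For \<open>v = 0\<close> the additional relation is void, and \<open>p\<close>
    cuts out the system alone.\<close>
  from base.relsys_polynomial[OF this, of N \<nu> "\<lambda>_. 0"]
  obtain p where p: "p \<in> mpolys UNIV (yvars d \<union> lvars n)" "\<And>a. meval a p = 0 \<longleftrightarrow> relsys n B N \<nu> a" by auto
  obtain f c where f: "f \<in> mpolys UNIV (yvars d \<union> lvars n)" "c \<in> mpolys UNIV (yvars d)" "c \<noteq> 0"
    "\<And>a. a \<in> points \<Longrightarrow> meval a f = (if meval a p = 0 then meval a c else 0)"
    using base.zero_locus_polynomial[OF p(1)] by blast
  have "parametrisation n d A h B N \<nu> f c"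
    by unfold_locales (use assms gen min f p(2) in auto)
  then show ?thesis by blast
qed

theorem irreducible_and_unirational:
  "irreducible_variety n (zariski_closure n (exp_image n d A)) \<and> unirational n (zariski_closure n (exp_image n d A))"
proof (cases "n = 0")
  \<comment> \<open>There is a single matrix of size 0, and it has no entry from which
    \<open>rational_image\<close> could read its denominator.\<close>
  case True
  have sub: "exp_image n d A \<subseteq> sym_mats n" by (rule exp_image_symmetric[OF A_sym])
  have one: "M = M'" if "M \<in> sym_mats n" "M' \<in> sym_mats n" for M M' :: "complex mat"
    using that True by (intro eq_matI) (auto simp: sym_mats_def)
  obtain E where E: "E \<in> exp_image n d A" by (auto simp: exp_image_def)
  then have eq: "exp_image n d A = {E}" "sym_mats n = {E}" using sub one by blast+
  have "irreducible_variety n (zariski_closure n (exp_image n d A))"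
    by (rule irreducible_closure[OF sub]) (auto simp: eq(1) eval_at_mat_mult)
  moreover have "unirational n (zariski_closure n (exp_image n d A))"
    unfolding unirational_def
    by (intro exI[of _ 0] exI[of _ "\<lambda>_ _. 1"] conjI) (simp_all add: True mpolys_closed, use eq True in simp)
  ultimately show ?thesis ..
next
  case False
  then have n: "n > 0" by simp
  obtain B N \<nu> f0 c0 where "parametrisation n d A h B N \<nu> f0 c0" using ex_parametrisation[OF n] by blast
  from parametrisation.exp_image_rational[OF this] obtain p q where
    pq: "\<And>k l. k < n \<Longrightarrow> l < n \<Longrightarrow> p k l \<in> mpolys UNIV {..<d + 2 * n}" "q \<in> mpolys UNIV {..<d + 2 * n}" "q \<noteq> 0"
    and van: "\<And>f. f \<in> xpolys n \<Longrightarrow>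
      (\<forall>M\<in>exp_image n d A. eval_at_mat M f = 0) \<longleftrightarrow> (\<forall>M\<in>rational_image n p q. eval_at_mat M f = 0)"
    by blast
  have eq: "zariski_closure n (exp_image n d A) = zariski_closure n (rational_image n p q)"
    by (rule zariski_closure_eqI[OF exp_image_symmetric[OF A_sym] _ van]) (auto simp: rational_image_def)
  have "unirational n (zariski_closure n (rational_image n p q))"
    unfolding unirational_def rational_image_def
    by (intro exI[of _ "d + 2 * n"] exI[of _ p] exI[of _ "\<lambda>_ _. q"] conjI refl) (use pq in auto)
  with rational_image_irreducible[OF n pq(3)] show ?thesis by (simp add: eq)
qed

end

section \<open>Primality of the real ideal of an irreducible variety\<close>

lemma real_ideal_prime:
  assumes V: "irreducible_variety n V"
  shows "primeideal (real_ideal_of n V) (RX n)"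
proof (rule primeidealI)
  let ?c = "Poly_Mapping.map complex_of_real :: (var, real) mpoly \<Rightarrow> _"
  have ev: "eval_at_mat M (?c f) = mhom complex_of_real (matval M) f" for M f
    by (simp add: eval_at_mat_def meval_map_of_real)
  obtain F where F: "F \<subseteq> xpolys n" "V = {M \<in> sym_mats n. \<forall>f\<in>F. eval_at_mat M f = 0}"
    using V by (auto simp: irreducible_variety_def zariski_closed_def)
  obtain M0 where M0: "M0 \<in> V" using V by (auto simp: irreducible_variety_def)
  interpret h: comm_ring_hom "mhom complex_of_real a" for a :: "var \<Rightarrow> complex"
    by (rule of_real_hom.mhom_hom)
  show "ideal (real_ideal_of n V) (RX n)"
    unfolding ideal_mpoly_ring_iff[OF subring_set_UNIV]
    by (auto simp: real_ideal_of_def ideal_set_def mpolys_closed ev h.hom_add h.hom_mult)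
  show "cring (RX n)" by (rule cring_mpoly_ring) simp
  have "1 \<in> carrier (RX n)" by (simp add: mpolys_closed)
  moreover have "1 \<notin> real_ideal_of n V" using M0 by (auto simp: real_ideal_of_def ev)
  ultimately show "carrier (RX n) \<noteq> real_ideal_of n V" by auto
  fix f g assume f: "f \<in> carrier (RX n)" and g: "g \<in> carrier (RX n)" and "f \<otimes>\<^bsub>RX n\<^esub> g \<in> real_ideal_of n V"
  then have fg: "eval_at_mat M (?c f) * eval_at_mat M (?c g) = 0" if "M \<in> V" for M
    using that by (auto simp: real_ideal_of_def ev h.hom_mult)
  let ?V = "\<lambda>f. {M \<in> V. eval_at_mat M (?c f) = 0}"
  have closed: "zariski_closed n (?V f)" if "f \<in> carrier (RX n)" for f
    unfolding zariski_closed_def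
    by (rule exI[of _ "insert (?c f) F"]) (use F map_of_real_in[OF that] in auto)
  have "V = ?V f \<union> ?V g" using fg by auto
  then have "V = ?V f \<or> V = ?V g"
    using V closed[OF f] closed[OF g] unfolding irreducible_variety_def by blast
  then show "f \<in> real_ideal_of n V \<or> g \<in> real_ideal_of n V"
    using f g by (auto simp: real_ideal_of_def)
qed

section \<open>The implicitization ideal\<close>

lemma elements_mat_carrier:
  assumes "m \<in> carrier_mat n n"
  shows "elements_mat m = {m $$ (s, t) | s t. s < n \<and> t < n}"
proof -
  have "elements_mat m = (\<Union>s\<in>{0..<n}. (\<lambda>t. m $$ (s, t)) ` {0..<n})"
    using assms by (simp add: elements_mat_def)
  then show ?thesis by fastforce
qed

lemma poly_in_z:
  fixes F :: rpoly
  assumes F: "F \<in> mpolys K (Y \<union> zvars n)" and K: "subring_set K"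
  shows "\<exists>S :: (nat \<Rightarrow> nat) set. \<exists>c. finite S \<and> (\<forall>\<alpha>\<in>S. c \<alpha> \<in> mpolys K Y) \<and>
    F = (\<Sum>\<alpha>\<in>S. c \<alpha> * (\<Prod>i<n. mvar (Zv i) ^ \<alpha> i))"
  using F K
proof (induct rule: mpolys_induct)
  case (const c)
  then show ?case by (intro exI[of _ "{\<lambda>_. 0}"] exI[of _ "\<lambda>_. mconst c"]) (simp add: K)
next
  case (var v)
  show ?case
  proof (cases "v \<in> Y")
    case True
    then show ?thesis by (intro exI[of _ "{\<lambda>_. 0}"] exI[of _ "\<lambda>_. mvar v"]) (simp add: K)
  next
    case False
    then obtain j where j: "v = Zv j" "j < n" using var by (auto simp: zvars_def)
    have "(\<Prod>i<n. mvar (Zv i) ^ (if i = j then 1 else 0)) = (\<Prod>i<n. if i = j then mvar (Zv i) else 1 :: rpoly)"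
      by (rule prod.cong) auto
    also have "\<dots> = mvar v" using j by simp
    finally show ?thesis
      by (intro exI[of _ "{\<lambda>i. if i = j then 1 else 0}"] exI[of _ "\<lambda>_. 1"]) (simp add: mpolys_closed K)
  qed
next
  case (add f g)
  then obtain S T c c' where S: "finite S" "\<And>\<alpha>. \<alpha> \<in> S \<Longrightarrow> c \<alpha> \<in> mpolys K Y" "f = (\<Sum>\<alpha>\<in>S. c \<alpha> * (\<Prod>i<n. mvar (Zv i) ^ \<alpha> i))"
    and T: "finite T" "\<And>\<alpha>. \<alpha> \<in> T \<Longrightarrow> c' \<alpha> \<in> mpolys K Y" "g = (\<Sum>\<alpha>\<in>T. c' \<alpha> * (\<Prod>i<n. mvar (Zv i) ^ \<alpha> i))"
    by blast
  let ?e = "\<lambda>\<alpha>. (if \<alpha> \<in> S then c \<alpha> else 0) + (if \<alpha> \<in> T then c' \<alpha> else 0)"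
  have "f + g = (\<Sum>\<alpha>\<in>S \<union> T. ?e \<alpha> * (\<Prod>i<n. mvar (Zv i) ^ \<alpha> i))"
    unfolding S(3) T(3) by (rule monomial_sum_add[OF S(1) T(1)])
  moreover have "?e \<alpha> \<in> mpolys K Y" for \<alpha> using S(2) T(2) by (auto simp: mpolys_closed K)
  ultimately show ?case using S(1) T(1) by (intro exI[of _ "S \<union> T"] exI[of _ ?e]) auto
next
  case (mult f g)
  then obtain S T c c' where S: "finite S" "\<And>\<alpha>. \<alpha> \<in> S \<Longrightarrow> c \<alpha> \<in> mpolys K Y" "f = (\<Sum>\<alpha>\<in>S. c \<alpha> * (\<Prod>i<n. mvar (Zv i) ^ \<alpha> i))"
    and T: "finite T" "\<And>\<alpha>. \<alpha> \<in> T \<Longrightarrow> c' \<alpha> \<in> mpolys K Y" "g = (\<Sum>\<alpha>\<in>T. c' \<alpha> * (\<Prod>i<n. mvar (Zv i) ^ \<alpha> i))"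
    by blast
  let ?e = "\<lambda>\<gamma>. \<Sum>p\<in>{p \<in> S \<times> T. add_pair p = \<gamma>}. c (fst p) * c' (snd p)"
  have "f * g = (\<Sum>\<gamma>\<in>add_pair ` (S \<times> T). ?e \<gamma> * (\<Prod>i<n. mvar (Zv i) ^ \<gamma> i))"
    unfolding S(3) T(3) by (rule monomial_sum_mult[OF S(1) T(1)]) (simp add: power_add prod.distrib)
  moreover have "?e \<gamma> \<in> mpolys K Y" for \<gamma>
    by (intro mpolys_closed(8)[OF K] mpolys_closed(6)[OF K] S(2) T(2)) auto
  ultimately show ?case using S(1) T(1) by (intro exI[of _ "add_pair ` (S \<times> T)"] exI[of _ ?e]) auto
qed

text \<open>Here \<open>f0\<close> is the witness of the associated prime, unlike in
  \<open>parametrisation\<close>. The points at which it is nonzero are zeros of \<open>P\<close>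
  and serve as test points for it.\<close>

locale implicitization = pencil_family +
  fixes E1 :: "rpoly set" and D f0 :: rpoly
  assumes A_rat: "i < d \<Longrightarrow> s < n \<Longrightarrow> t < n \<Longrightarrow> A i $$ (s, t) \<in> \<rat>"
    and E1: "E1 \<subseteq> carrier (Qyl n d)"
    and prime: "primeideal (Idl\<^bsub>Qyl n d\<^esub> E1) (Qyl n d)"
    and f0: "f0 \<in> carrier (Qyl n d)"
    and colon: "Idl\<^bsub>Qyl n d\<^esub> E1 = {g \<in> carrier (Qyl n d). g * f0 \<in> Idl\<^bsub>Qyl n d\<^esub> (E1' n d A)}"
    and D: "least_common_denominator (\<phi>_minus_X_entries n d A) D"
begin

sublocale Q: root_family \<rat> "yvars d" n "char_poly (pencil n d A)" h
  by (rule family) (auto simp: A_rat)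

sublocale R: root_family UNIV "yvars d" n "char_poly (pencil n d A)" h
  by (rule family) auto

abbreviation "SQ \<equiv> mpolys (\<rat> :: real set) (yvars d \<union> lvars n)"
abbreviation "SR \<equiv> mpolys (UNIV :: real set) (yvars d \<union> lvars n)"
abbreviation "S \<equiv> mpolys (UNIV :: real set) (yvars d \<union> lvars n \<union> zvars n \<union> xvars n)"
abbreviation "P \<equiv> Idl\<^bsub>Qyl n d\<^esub> E1"

lemma P_idl: "P = idl SQ E1"
  by (rule genideal_mpoly_ring[OF subring_set_Rats E1])

lemma E1'_in: "E1' n d A \<subseteq> SQ"
  unfolding E1'_eq
  by (intro image_subsetI mpolys_closed(6) mpolys_closed(7) mpolys_closed(3) mpolys_closed(2)
      subring_set_Rats Q.generators_in_ring)

lemma E1'_vanish: "p \<in> E1' n d A \<Longrightarrow> a \<in> points \<Longrightarrow> meval a p = 0"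
  unfolding E1'_eq using Q.generators_vanish by (auto simp: meval.hom_mult simp del: coeff_diff)

lemma idl_E1'_vanish: "p \<in> idl T (E1' n d A) \<Longrightarrow> a \<in> points \<Longrightarrow> meval a p = 0"
  by (rule idl_hom_zero[OF comm_ring_hom_meval]) (auto intro: E1'_vanish)

text \<open>\<open>E1'\<close> covers the coefficients of index below n; from n on the two
  polynomials agree, both being monic of degree n.\<close>

lemma generators_in_idl:
  assumes T: "subring_set T"
  shows "coeff ((\<Prod>j<n. [:- mvar (Lv j), 1:]) - char_poly (pencil n d A)) k \<in> idl T (E1' n d A)"
proof (cases "k < n")
  case True
  let ?c = "coeff ((\<Prod>j<n. [:- lvar j, 1:]) - char_poly (pencil n d A)) k"
  have "(- 1) ^ n * ?c \<in> E1' n d A" unfolding E1'_eq using True by blast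
  then have "(- 1) ^ n * ((- 1) ^ n * ?c) \<in> idl T (E1' n d A)"
    by (intro ideal_setD(3)[OF idl_ideal_set[OF T]] idl_incl T subring_setD(7)[OF T] subring_setD(3)[OF T] subring_setD(2)[OF T])
  then show ?thesis by (simp only: left_minus_one_mult_self)
next
  case False
  have deg: "degree (\<Prod>j<n. [:- lvar j, 1:]) \<le> n"
  proof -
    have "degree (\<Prod>j<n. [:- lvar j, 1:]) \<le> (\<Sum>j<n. degree [:- lvar j, 1:])"
      by (rule degree_prod_sum_le[unfolded comp_def]) simp
    then show ?thesis by simp
  qed
  have "coeff (\<Prod>j<n. [:- lvar j, 1:]) n = 1"
    using coeff_prod_linear[of n n lvar] by (simp add: card_eq_0_iff finite_subset[of _ "{..<n}"] conj_commute cong: conj_cong)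
  then have "coeff ((\<Prod>j<n. [:- lvar j, 1:]) - char_poly (pencil n d A)) k = 0"
    using False Q.C_monic deg by (cases "k = n") (auto simp: coeff_eq_0)
  then show ?thesis by (simp only: idl.zero)
qed

lemma vanishing_Q:
  assumes "w \<noteq> 0" "w \<in> mpolys UNIV (yvars d)" "p \<in> SQ" "\<And>a. a \<in> points \<Longrightarrow> meval a w \<noteq> 0 \<Longrightarrow> meval a p = 0"
  shows "p \<in> idl SQ (E1' n d A)"
proof -
  interpret Qw: root_family \<rat> "yvars d" n "char_poly (pencil n d A)" "h * w"
    by (rule Q.refine) (use assms(1,2) yvars_lvars[of d n] in \<open>auto simp: mpolys_iff\<close>)
  show ?thesis
    by (rule Qw.vanishing_in_ideal[OF idl_ideal_set generators_in_idl _ assms(3)])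
       (use assms(4) idl_E1'_vanish in \<open>auto simp: Q.pts_refine\<close>)
qed

text \<open>A nonzero \<open>w\<close> in y can be joined to \<open>h\<close>, since the family
  stays a \<open>root_family\<close>; vanishing where \<open>w\<close> is nonzero thus suffices for
  membership. The genericity conditions of \<open>subset_ideal_J\<close> are absorbed in this
  way.\<close>

lemma vanishing_R:
  assumes "w \<noteq> 0" "w \<in> mpolys UNIV (yvars d)" "p \<in> SR" "\<And>a. a \<in> points \<Longrightarrow> meval a w \<noteq> 0 \<Longrightarrow> meval a p = 0"
  shows "p \<in> idl SR (E1' n d A)"
proof -
  interpret Rw: root_family UNIV "yvars d" n "char_poly (pencil n d A)" "h * w"
    by (rule R.refine) (use assms(1,2) yvars_lvars[of d n] in \<open>auto simp: mpolys_iff\<close>)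
  show ?thesis
    by (rule Rw.vanishing_in_ideal[OF idl_ideal_set generators_in_idl _ assms(3)])
       (use assms(4) idl_E1'_vanish in \<open>auto simp: R.pts_refine\<close>)
qed

lemma P_iff: "g \<in> P \<longleftrightarrow> g \<in> SQ \<and> g * f0 \<in> idl SQ (E1' n d A)"
  by (subst colon) (simp add: genideal_mpoly_ring[OF subring_set_Rats E1'_in])

lemma P_vanish: "g \<in> P \<Longrightarrow> a \<in> points \<Longrightarrow> meval a f0 \<noteq> 0 \<Longrightarrow> meval a g = 0"
  using idl_E1'_vanish[of "g * f0" SQ a] by (simp add: P_iff meval.hom_mult)

lemma P_ideal: "ideal_set SQ P"
  unfolding P_idl by (rule idl_ideal_set) simp

lemma f0_not_idl: "f0 \<notin> idl SQ (E1' n d A)"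
proof
  interpret P: primeideal P "Qyl n d" by (rule prime)
  assume "f0 \<in> idl SQ (E1' n d A)"
  then have "1 \<in> P" by (simp add: P_iff mpolys_closed)
  then have "SQ \<subseteq> P" using ideal_setD(3)[OF P_ideal, of _ 1] by auto
  then show False using P.I_notcarr P.a_subset by blast
qed

lemma prime_P: "u \<in> SQ \<Longrightarrow> v \<in> SQ \<Longrightarrow> u * v \<in> P \<Longrightarrow> u \<in> P \<or> v \<in> P"
  using primeideal.I_prime[OF prime, of u v] by simp

text \<open>The sum of the squares of \<open>f0\<close> over all orderings is symmetric, hence given
  by a polynomial \<open>c\<close> in y, and by reality it vanishes only where \<open>f0\<close>
  vanishes at every ordering. For \<open>c = 0\<close> the ideal of \<open>E1'\<close> would contain
  \<open>f0\<close>, and \<open>P\<close> would not be proper.\<close>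

lemma generic_ordering:
  "\<exists>c\<in>mpolys UNIV (yvars d). c \<noteq> 0 \<and> (\<forall>a\<in>points. meval a c \<noteq> 0 \<longrightarrow>
    (\<exists>\<sigma>. \<sigma> permutes {..<n} \<and> reorder \<sigma> a \<in> points \<and> meval (reorder \<sigma> a) f0 \<noteq> 0))"
proof -
  have fin: "finite {\<sigma>. \<sigma> permutes {..<n}}" by (simp add: finite_permutations)
  define p where "p = (\<Sum>\<sigma> | \<sigma> permutes {..<n}. (reorder_poly \<sigma> f0)\<^sup>2)"
  have p: "p \<in> SQ" unfolding p_def
    by (intro mpolys_closed(8) mpolys_closed(7) reorder_poly_mpolys subring_set_Rats yvars_lvars f0) simp
  have pv: "meval a p = (\<Sum>\<sigma> | \<sigma> permutes {..<n}. (meval (reorder \<sigma> a) f0)\<^sup>2)" for a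
    by (simp add: p_def meval.hom_sum meval.hom_power meval_reorder_poly)
  have "meval (reorder \<tau> a) p = meval a p" if \<tau>: "\<tau> permutes {..<n}" for \<tau> a
    unfolding pv reorder_reorder
    by (rule sum.reindex_bij_witness[of _ "\<lambda>\<sigma>. inv_into UNIV \<tau> \<circ> \<sigma>" "\<lambda>\<sigma>. \<tau> \<circ> \<sigma>"])
       (use \<tau> in \<open>auto simp: permutes_compose permutes_inv o_assoc permutes_inv_o\<close>)
  from Q.symmetric_value[OF p this] obtain c where c: "c \<in> mpolys \<rat> (yvars d)"
    "\<And>a. a \<in> points \<Longrightarrow> meval a c = meval a p" by blast
  have zero: "meval a p = 0 \<longleftrightarrow> (\<forall>\<sigma>. \<sigma> permutes {..<n} \<longrightarrow> meval (reorder \<sigma> a) f0 = 0)" for a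
    unfolding pv by (subst sum_nonneg_eq_0_iff[OF fin]) auto
  have "c \<noteq> 0"
  proof
    assume "c = 0"
    then have "meval a f0 = 0" if "a \<in> points" for a
      using c(2)[OF that] zero[of a] permutes_id[of "{..<n}"] reorder_id[of a] by (metis meval.hom_zero)
    then have "f0 \<in> idl SQ (E1' n d A)" using f0 by (intro vanishing_Q[of 1]) (auto simp: mpolys_closed)
    then show False using f0_not_idl by simp
  qed
  moreover have "c \<in> mpolys UNIV (yvars d)" by (rule mpolys_mono[OF c(1)]) auto
  ultimately show ?thesis
    using c(2) zero Q.reorder_points by (intro bexI[of _ c]) auto
qed

text \<open>The polynomial \<open>f\<close> is a multiple of the indicator of the zeros of
  \<open>u\<close>, so \<open>u * f\<close> vanishes at all points. Primality puts \<open>f\<close>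
  into \<open>P\<close>; then \<open>f\<close> vanishes where \<open>f0\<close> is nonzero, and for
  generic y no zero of \<open>u\<close> is left there.\<close>

lemma generic_relation:
  assumes u: "u \<in> SQ" "u \<notin> P"
  shows "\<exists>w\<in>mpolys UNIV (yvars d). w \<noteq> 0 \<and> (\<forall>a\<in>points. meval a w \<noteq> 0 \<longrightarrow> meval a f0 \<noteq> 0 \<longrightarrow> meval a u \<noteq> 0)"
proof -
  obtain f c where f: "f \<in> SQ" "c \<in> mpolys \<rat> (yvars d)" "c \<noteq> 0"
    "\<And>a. a \<in> points \<Longrightarrow> meval a f = (if meval a u = 0 then meval a c else 0)"
    using Q.zero_locus_polynomial[OF u(1)] by blast
  have "u * f * f0 \<in> idl SQ (E1' n d A)"
    by (rule vanishing_Q[of 1]) (use f u(1) f0 in \<open>auto simp: mpolys_closed meval.hom_mult\<close>)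
  then have "u * f \<in> P" using u(1) f(1) by (simp add: P_iff mpolys_closed)
  then have "f \<in> P" using prime_P[OF u(1) f(1)] u(2) by blast
  then have "meval a u \<noteq> 0" if "a \<in> points" "meval a c \<noteq> 0" "meval a f0 \<noteq> 0" for a
    using P_vanish[of f a] f(4)[of a] that by auto
  moreover have "c \<in> mpolys UNIV (yvars d)" by (rule mpolys_mono[OF f(2)]) auto
  ultimately show ?thesis using f(3) by blast
qed

subsection \<open>The denominator\<close>

lemma phi_X_carrier: "\<phi> n d A - map_mat to_fract (X_mat n) \<in> carrier_mat n n"
  by (intro minus_carrier_mat) (simp add: X_mat_def)

lemma phi_X_entry:
  assumes "s < n" "t < n"
  shows "to_fract (phi_den n) * (\<phi> n d A - map_mat to_fract (X_mat n)) $$ (s, t) =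
    to_fract (phi_num n d A s t - phi_den n * mvar (Xv (min s t) (max s t)))"
  using \<phi>_entry[OF assms, of d A] assms by (simp add: X_mat_def right_diff_distrib)

lemma phi_X_entries:
  "\<phi>_minus_X_entries n d A = {(\<phi> n d A - map_mat to_fract (X_mat n)) $$ (s, t) | s t. s < n \<and> t < n}"
  by (simp only: \<phi>_minus_X_entries_def elements_mat_carrier[OF phi_X_carrier])

lemma D_dvd: "D dvd phi_den n"
proof -
  have "common_denominator (\<phi>_minus_X_entries n d A) (phi_den n)"
    unfolding common_denominator_def phi_X_entries
    using phi_X_entry phi_den_nonzero by (auto simp del: to_fract_diff to_fract_mult index_minus_mat)
  then show ?thesis using D by (simp add: least_common_denominator_def)
qed

lemma lagden_lvar_in: "i < n \<Longrightarrow> lagden n lvar i \<in> mpolys UNIV (lvars n)"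
  unfolding lagden_def by (intro mpolys_closed(9) mpolys_closed(5) mvar_mpolys subring_set_UNIV) (auto simp: lvars_def)

lemma phi_den_in: "phi_den n \<in> mpolys UNIV (lvars n)"
  unfolding phi_den_def by (intro mpolys_closed(9) lagden_lvar_in subring_set_UNIV) auto

lemma phi_num_in:
  assumes "s < n" "t < n"
  shows "phi_num n d A s t \<in> mpolys UNIV (yvars d \<union> lvars n \<union> zvars n)"
proof -
  let ?T = "mpolys (UNIV :: real set) (yvars d \<union> lvars n \<union> zvars n)"
  have T: "subring_set ?T" by simp
  have pow: "(pencil n d A ^\<^sub>m r) $$ (s, t) \<in> ?T" if "t < n" for r t
    using that
  proof (induct r arbitrary: t)
    case 0
    then show ?case using assms carrier_matD(1)[OF pencil_carrier[of n d A]] by (auto simp: mpolys_closed)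
  next
    case (Suc r)
    have "(pencil n d A ^\<^sub>m Suc r) $$ (s, t) = (\<Sum>k<n. (pencil n d A ^\<^sub>m r) $$ (s, k) * pencil n d A $$ (k, t))"
      using mat_mult_entry[of "pencil n d A ^\<^sub>m r" n "pencil n d A" s t] assms Suc.prems by simp
    also have "\<dots> \<in> ?T"
      by (intro mpolys_closed(8) mpolys_closed(6) subring_set_UNIV Suc.hyps pencil_entry_in) (use Suc.prems in auto)
    finally show ?case .
  qed
  have lag: "coeff (lag n lvar i) k \<in> ?T" for i k
    unfolding lag_def by (intro coeff_prod_in coeff_linear_in T mvar_mpolys subring_set_UNIV) (auto simp: lvars_def)
  have "ent (pencil n d A) s t (lag n lvar i) \<in> ?T" for i
    unfolding ent_def by (intro mpolys_closed(8) mpolys_closed(6) subring_set_UNIV lag pow assms)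
  then show ?thesis
    unfolding phi_num_def
    by (intro mpolys_closed(8) mpolys_closed(6) mpolys_closed(9) subring_set_UNIV mvar_mpolys mpolys_mono[OF lagden_lvar_in])
       (auto simp: zvars_def)
qed

lemma D_in: "D \<in> mpolys UNIV (lvars n)"
proof -
  obtain k where k: "phi_den n = D * k" using D_dvd by (rule dvdE)
  then have "D * k \<noteq> 0" using phi_den_nonzero[of n] by metis
  then have "mvars D \<subseteq> mvars (phi_den n)" unfolding k by (rule mvars_factor)
  then show ?thesis using phi_den_in by (auto simp: mpolys_iff)
qed

text \<open>\<open>D\<close> divides a product of differences of eigenvalues; hence powers of
  \<open>D\<close>, and with them the saturation, can be undone at the points.\<close>

lemma D_at_point:
  assumes "a \<in> points"
  shows "meval a D \<noteq> 0"
proof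
  assume "meval a D = 0"
  moreover obtain k where "phi_den n = D * k" using D_dvd by (rule dvdE)
  ultimately have "meval a (phi_den n) = 0" by (simp add: meval.hom_mult)
  moreover have "meval a (lagden n lvar i) \<noteq> 0" if "i < n" for i
  proof -
    have "meval a (lagden n lvar i) = lagden n (\<lambda>i. a (Lv i)) i"
      by (simp add: lagden_def meval.hom_prod meval.hom_minus)
    then show ?thesis using lagden_nonzero[of "\<lambda>i. a (Lv i)" n i] assms that by (simp add: pts_def)
  qed
  ultimately show False by (simp add: phi_den_def meval.hom_prod)
qed

text \<open>\<open>D\<close> is known only through divisibility. Multiplication by the explicit
  denominator \<open>phi_den\<close> gives an identity between polynomials.\<close>

lemma E2_iff:
  "p \<in> E2 n d A D \<longleftrightarrow> (\<exists>s<n. \<exists>t<n. phi_den n * p = D * (phi_num n d A s t - phi_den n * mvar (Xv (min s t) (max s t))))"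
proof -
  let ?m = "\<phi> n d A - map_mat to_fract (X_mat n)"
  have "to_fract p = to_fract D * ?m $$ (s, t) \<longleftrightarrow>
      phi_den n * p = D * (phi_num n d A s t - phi_den n * mvar (Xv (min s t) (max s t)))"
    if "s < n" "t < n" for s t
  proof -
    have "to_fract p = to_fract D * ?m $$ (s, t) \<longleftrightarrow>
       to_fract (phi_den n) * to_fract p = to_fract (phi_den n) * (to_fract D * ?m $$ (s, t))"
      using phi_den_nonzero by simp
    also have "to_fract (phi_den n) * (to_fract D * ?m $$ (s, t)) =
       to_fract (D * (phi_num n d A s t - phi_den n * mvar (Xv (min s t) (max s t))))"
      unfolding to_fract_mult[of D] phi_X_entry[OF that, symmetric] by (simp only: ac_simps)
    finally show ?thesis by (simp only: to_fract_mult[symmetric] to_fract_eq_iff)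
  qed
  then show ?thesis
    unfolding E2_def phi_X_entries by blast
qed

lemma ex_E2:
  assumes "s < n" "t < n"
  shows "\<exists>p\<in>E2 n d A D. phi_den n * p = D * (phi_num n d A s t - phi_den n * mvar (Xv (min s t) (max s t)))"
proof -
  have "(\<phi> n d A - map_mat to_fract (X_mat n)) $$ (s, t) \<in> \<phi>_minus_X_entries n d A"
    using assms unfolding phi_X_entries by blast
  then obtain p where "to_fract D * (\<phi> n d A - map_mat to_fract (X_mat n)) $$ (s, t) = to_fract p"
    using D by (auto simp: least_common_denominator_def common_denominator_def)
  then have "to_fract (phi_den n * p) = to_fract D * (to_fract (phi_den n) * (\<phi> n d A - map_mat to_fract (X_mat n)) $$ (s, t))"
    by (simp add: ac_simps)
  also have "\<dots> = to_fract (D * (phi_num n d A s t - phi_den n * mvar (Xv (min s t) (max s t))))"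
    unfolding phi_X_entry[OF assms] by simp
  finally show ?thesis using E2_iff assms by (metis to_fract_eq_iff)
qed

text \<open>Determines the variables of elements that are known only after multiplication by
  \<open>phi_den\<close>.\<close>

lemma factor_of_phi_den:
  assumes "phi_den n * p = q" "q \<in> mpolys UNIV V"
  shows "p \<in> mpolys UNIV V"
proof (cases "p = 0")
  case False
  then have "mvars p \<subseteq> mvars (p * phi_den n)" using mvars_factor[of p "phi_den n"] phi_den_nonzero by simp
  then show ?thesis using assms by (auto simp: mpolys_iff mult.commute)
qed (simp add: mpolys_closed)

lemma X_in: "s < n \<Longrightarrow> t < n \<Longrightarrow> (mvar (Xv (min s t) (max s t)) :: rpoly) \<in> mpolys UNIV (xvars n)"
  by (rule mvar_mpolys) (auto simp: xvars_def)

lemma in_S: "p \<in> mpolys K V \<Longrightarrow> V \<subseteq> yvars d \<union> lvars n \<union> zvars n \<union> xvars n \<Longrightarrow> p \<in> S"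
  by (rule mpolys_mono) auto

lemma E2_in: "E2 n d A D \<subseteq> S"
proof
  fix p assume "p \<in> E2 n d A D"
  then obtain s t where st: "s < n" "t < n"
    and p: "phi_den n * p = D * (phi_num n d A s t - phi_den n * mvar (Xv (min s t) (max s t)))"
    by (auto simp: E2_iff)
  have "D * (phi_num n d A s t - phi_den n * mvar (Xv (min s t) (max s t))) \<in> S"
    by (intro mpolys_closed(6) mpolys_closed(5) subring_set_UNIV in_S[OF D_in] in_S[OF phi_den_in] in_S[OF phi_num_in[OF st]]
        in_S[OF X_in[OF st]]) auto
  then show "p \<in> S" by (rule factor_of_phi_den[OF p])
qed

lemma E3_in: "E3 n P \<subseteq> S"
proof
  fix p assume "p \<in> E3 n P"
  then obtain \<alpha> \<beta> where p: "p = (\<Prod>i<n. mvar (Zv i) ^ \<alpha> i) - (\<Prod>i<n. mvar (Zv i) ^ \<beta> i)" by (auto simp: E3_def)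
  show "p \<in> S" unfolding p
    by (intro mpolys_closed(5) mpolys_closed(9) mpolys_closed(7) mvar_mpolys subring_set_UNIV) (auto simp: zvars_def)
qed

lemma E1_in: "E1 \<subseteq> S"
proof
  fix e assume "e \<in> E1"
  then have "e \<in> SQ" using E1 by blast
  then show "e \<in> S" by (rule in_S) auto
qed

lemma ideal_I_eq:
  "ideal_I n d A E1 D = {f \<in> S. \<exists>k. D ^ k * f \<in> idl S (E1 \<union> E2 n d A D \<union> E3 n P)}"
  unfolding ideal_I_def saturation_def
  by (subst genideal_mpoly_ring[OF subring_set_UNIV]) (use E1_in E2_in E3_in in auto)

text \<open>The point \<open>(y, \<lambda>, exp (c \<lambda>), exp (c A(y)))\<close>.\<close>

definition exp_point :: "real \<Rightarrow> (var \<Rightarrow> real) \<Rightarrow> var \<Rightarrow> real" where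
  "exp_point c a v = (case v of Zv i \<Rightarrow> exp (c * a (Lv i)) | Xv s t \<Rightarrow> xval n d A a (\<lambda>i. exp (c * a (Lv i))) (Xv s t) | _ \<Rightarrow> a v)"

lemma exp_point_simps [simp]:
  "exp_point c a (Yv i) = a (Yv i)" "exp_point c a (Lv i) = a (Lv i)" "exp_point c a (Zv i) = exp (c * a (Lv i))"
  "exp_point c a (Xv s t) = xval n d A a (\<lambda>i. exp (c * a (Lv i))) (Xv s t)"
  by (simp_all add: exp_point_def)

lemma exp_point_YL: "p \<in> mpolys K (yvars d \<union> lvars n) \<Longrightarrow> meval (exp_point c a) p = meval a p"
  by (rule meval_cong) (auto simp: mpolys_iff yvars_def lvars_def dest!: subsetD)

text \<open>The variables x exist on and above the diagonal only, so an equation for an entry below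
  it involves the mirrored variable.\<close>

lemma xval_symmetric:
  assumes a: "a \<in> points" and st: "s < n" "t < n"
  shows "xval n d A a (\<lambda>i. exp (c * a (Lv i))) (Xv s t) = xval n d A a (\<lambda>i. exp (c * a (Lv i))) (Xv t s)"
proof -
  have "mat_exp (mat_lincomb n d A (\<lambda>i. c * a (Yv i))) \<in> sym_mats n"
    by (rule mat_exp_symmetric[OF mat_lincomb_symmetric[OF A_sym]])
  then show ?thesis using mat_exp_at[OF a] st by (simp add: sym_mats_iff xval_def)
qed

lemma E2_vanish:
  assumes a: "a \<in> points" and p: "p \<in> E2 n d A D"
  shows "meval (exp_point c a) p = 0"
proof -
  obtain s t where st: "s < n" "t < n"
    and p: "phi_den n * p = D * (phi_num n d A s t - phi_den n * mvar (Xv (min s t) (max s t)))"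
    using p by (auto simp: E2_iff)
  let ?l = "\<lambda>i. a (Lv i)" and ?e = "exp_point c a"
  have ld: "meval ?e (lagden n lvar i) = lagden n ?l i" for i
    by (simp add: lagden_def meval.hom_prod meval.hom_minus)
  have nz: "lagden n ?l i \<noteq> 0" if "i < n" for i
    using lagden_nonzero[of ?l n i] a that by (simp add: pts_def)
  have den: "meval ?e (phi_den n) = (\<Prod>i<n. lagden n ?l i)" by (simp add: phi_den_def meval.hom_prod ld)
  then have den0: "meval ?e (phi_den n) \<noteq> 0" using nz by simp
  have ent: "meval ?e (ent (pencil n d A) s t (lag n lvar i)) = ent (mat_at n d A a) s t (lag n ?l i)" if "i < n" for i
  proof -
    have m: "map_mat (meval ?e) (pencil n d A) = mat_at n d A a" by (simp add: meval_pencil mat_at_def)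
    have pw: "meval ?e ((pencil n d A ^\<^sub>m r) $$ (s, t)) = (mat_at n d A a ^\<^sub>m r) $$ (s, t)" for r
      using meval.mat_hom_pow[OF pencil_carrier, of ?e n d A r] st pow_carrier_mat[OF pencil_carrier[of n d A], of r]
      by (metis index_map_mat(1) carrier_matD m)
    have lg: "map_poly (meval ?e) (lag n lvar i) = lag n ?l i"
      by (simp add: lag_def mp_meval.hom_prod meval.map_poly_pCons_hom meval.hom_uminus)
    have "degree (lag n lvar i) \<le> n" "degree (lag n ?l i) \<le> n"
      using degree_lag[OF that, of lvar] degree_lag[OF that, of ?l] by auto
    then show ?thesis
      using arg_cong[OF lg, of "\<lambda>q. coeff q _"]
      by (simp add: ent_superset[where N = n] meval.hom_sum meval.hom_mult pw)
  qed
  have cof: "(\<Prod>j\<in>{..<n} - {i}. lagden n ?l j) = (\<Prod>i<n. lagden n ?l i) / lagden n ?l i" if "i < n" for i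
    using nz[OF that] that by (subst prod.remove[of "{..<n}" i]) auto
  have "meval ?e (phi_num n d A s t) = (\<Sum>i<n. exp (c * ?l i) * (\<Prod>j\<in>{..<n} - {i}. lagden n ?l j) * ent (mat_at n d A a) s t (lag n ?l i))"
    unfolding phi_num_def meval.hom_sum
    by (rule sum.cong) (auto simp: meval.hom_mult meval.hom_prod ld ent)
  also have "\<dots> = meval ?e (phi_den n) * xval n d A a (\<lambda>i. exp (c * ?l i)) (Xv s t)"
    unfolding den xval_def by (simp add: sum_distrib_left, rule sum.cong) (auto simp: cof proj_at_def proj_def)
  also have "xval n d A a (\<lambda>i. exp (c * ?l i)) (Xv s t) = ?e (Xv (min s t) (max s t))"
    using xval_symmetric[OF a st] by (auto simp: min_def max_def)
  finally have "meval ?e (phi_den n * p) = 0" unfolding p by (simp add: meval.hom_mult meval.hom_minus)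
  then show ?thesis using den0 by (simp add: meval.hom_mult)
qed

lemma relation_in: "(\<Sum>i<n. of_nat (\<alpha> i) * lvar i) - (\<Sum>j<n. of_nat (\<beta> j) * lvar j) \<in> SQ"
  by (intro mpolys_closed(5) mpolys_closed(8) mpolys_closed(6) mpolys_closed(10) mvar_mpolys subring_set_Rats)
     (auto simp: lvars_def)

text \<open>An additive relation in \<open>P\<close> between the eigenvalues becomes a
  multiplicative one between their exponentials.\<close>

lemma E13_vanish:
  assumes a: "a \<in> points" "meval a f0 \<noteq> 0"
  shows "p \<in> E1 \<Longrightarrow> meval (exp_point c a) p = 0" "p \<in> E3 n P \<Longrightarrow> meval (exp_point c a) p = 0"
proof -
  assume p: "p \<in> E1"
  then have "p \<in> P" unfolding P_idl by (intro idl_incl) simp_all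
  then show "meval (exp_point c a) p = 0" using P_vanish[OF _ a] exp_point_YL[of p \<rat>] p E1 by auto
next
  assume "p \<in> E3 n P"
  then obtain \<alpha> \<beta> :: "nat \<Rightarrow> nat" where p: "p = (\<Prod>i<n. mvar (Zv i) ^ \<alpha> i) - (\<Prod>i<n. mvar (Zv i) ^ \<beta> i)"
    and r: "(\<Sum>i<n. of_nat (\<alpha> i) * lvar i) - (\<Sum>j<n. of_nat (\<beta> j) * lvar j) \<in> P" by (auto simp: E3_def)
  have "(\<Sum>i<n. \<alpha> i * a (Lv i)) = (\<Sum>i<n. \<beta> i * a (Lv i))"
    using P_vanish[OF r a] by (simp add: meval.hom_minus meval.hom_sum meval.hom_mult meval.hom_of_nat)
  moreover have "(\<Prod>i<n. exp (c * a (Lv i)) ^ \<alpha> i) = exp (c * (\<Sum>i<n. \<alpha> i * a (Lv i)))" for \<alpha> :: "nat \<Rightarrow> nat"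
    by (simp add: exp_sum sum_distrib_left exp_of_nat_mult[symmetric] ac_simps)
  ultimately show "meval (exp_point c a) p = 0"
    by (simp add: p meval.hom_minus meval.hom_prod meval.hom_power)
qed

lemma eval_real_exp:
  assumes a: "a \<in> points" and f: "f \<in> mpolys UNIV (xvars n)"
  shows "eval_at_mat (cmat (mat_exp (mat_lincomb n d A (\<lambda>i. c * a (Yv i))))) (Poly_Mapping.map complex_of_real f) =
    of_real (meval (exp_point c a) f)"
proof -
  have "meval (exp_point c a) f = meval (xval n d A a (\<lambda>i. exp (c * a (Lv i)))) f"
    by (rule meval_cong) (use f in \<open>auto simp: mpolys_iff xvars_def dest!: subsetD\<close>)
  then show ?thesis
    by (simp add: eval_exp_at[OF a map_of_real_in[OF f]] meval_map_of_real of_real_meval)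
qed

section \<open>The two inclusions between \<open>J\<close> and the ideal of the Gibbs
  variety\<close>

lemma in_real_ideal_iff:
  "f \<in> real_ideal_of n (zariski_closure n (exp_image n d A)) \<longleftrightarrow>
    f \<in> mpolys UNIV (xvars n) \<and> (\<forall>M\<in>exp_image n d A. eval_at_mat M (Poly_Mapping.map complex_of_real f) = 0)"
  using vanishing_on_closure[OF exp_image_symmetric[OF A_sym] map_of_real_in] closure_superset[of "exp_image n d A" n]
  unfolding real_ideal_of_def by blast

text \<open>The generators are known to vanish at exponential points whose ordering has
  \<open>f0\<close> nonzero. The exponential of A(y) does not depend on the ordering, and for
  generic y a good ordering exists; continuity covers the remaining y.\<close>

lemma ideal_J_subset:
  assumes f: "f \<in> ideal_J n d A E1 D"
  shows "f \<in> real_ideal_of n (zariski_closure n (exp_image n d A))"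
proof -
  obtain k where fX: "f \<in> mpolys UNIV (xvars n)" and k: "D ^ k * f \<in> idl S (E1 \<union> E2 n d A D \<union> E3 n P)"
    using f by (auto simp: ideal_J_def ideal_I_eq)
  have van: "meval (exp_point 1 a) f = 0" if a: "a \<in> points" "meval a f0 \<noteq> 0" for a
  proof -
    have "meval (exp_point 1 a) (D ^ k * f) = 0"
      by (rule idl_hom_zero[OF comm_ring_hom_meval _ k]) (use E13_vanish[OF a] E2_vanish[OF a(1)] in auto)
    moreover have "meval (exp_point 1 a) D = meval a D"
      by (rule exp_point_YL[OF mpolys_mono[OF D_in]]) auto
    ultimately show ?thesis using D_at_point[OF a(1)] by (simp add: meval.hom_mult meval.hom_power)
  qed
  obtain c where c: "c \<in> mpolys UNIV (yvars d)" "c \<noteq> 0"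
    "\<And>a. a \<in> points \<Longrightarrow> meval a c \<noteq> 0 \<Longrightarrow> \<exists>\<sigma>. \<sigma> permutes {..<n} \<and> reorder \<sigma> a \<in> points \<and> meval (reorder \<sigma> a) f0 \<noteq> 0"
    using generic_ordering by blast
  have hc: "h * c \<noteq> 0" using h0 c(2) by simp
  have "eval_at_mat (cmat (mat_exp (mat_lincomb n d A y))) (Poly_Mapping.map complex_of_real f) = 0" for y
  proof (rule vanishing_extends[OF hc map_of_real_in[OF fX]])
    fix a assume "meval a (h * c) \<noteq> 0"
    then have ha: "meval a h \<noteq> 0" "meval a c \<noteq> 0" by (auto simp: meval.hom_mult)
    then obtain b where b: "b \<in> points" "\<And>v. v \<notin> lvars n \<Longrightarrow> b v = a v" using R.ex_point by blast
    have "meval b c \<noteq> 0" using ha(2) R.meval_agree[OF c(1) yvars_lvars b(2)] by simp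
    then obtain \<sigma> where \<sigma>: "\<sigma> permutes {..<n}" "reorder \<sigma> b \<in> points" "meval (reorder \<sigma> b) f0 \<noteq> 0"
      using c(3)[OF b(1)] by blast
    have "a (Yv i) = 1 * reorder \<sigma> b (Yv i)" for i using b(2)[of "Yv i"] by (simp add: lvars_def image_iff)
    then have "(\<lambda>i. a (Yv i)) = (\<lambda>i. 1 * reorder \<sigma> b (Yv i))" by blast
    then show "eval_at_mat (cmat (mat_exp (mat_lincomb n d A (\<lambda>i. a (Yv i))))) (Poly_Mapping.map complex_of_real f) = 0"
      using eval_real_exp[OF \<sigma>(2) fX, of 1] van[OF \<sigma>(2,3)] by (simp only: of_real_0)
  qed
  then show ?thesis using fX by (subst in_real_ideal_iff) (auto simp: exp_image_def)
qed

text \<open>Modulo \<open>E2\<close> every x is a fraction in the other variables with denominator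
  \<open>D\<close>. The power of \<open>D\<close> that clears these fractions is removed later by
  the saturation.\<close>

lemma eliminate_X:
  assumes f: "f \<in> mpolys UNIV (xvars n)"
  shows "\<exists>m. \<exists>F\<in>mpolys UNIV (yvars d \<union> lvars n \<union> zvars n). D ^ m * f - F \<in> idl S (E2 n d A D)"
proof -
  let ?T = "mpolys (UNIV :: real set) (yvars d \<union> lvars n \<union> zvars n)" and ?I = "idl S (E2 n d A D)"
  have I: "ideal_set S ?I" by (rule idl_ideal_set) simp
  note T = mpolys_closed[OF subring_set_UNIV, where V = "yvars d \<union> lvars n \<union> zvars n"]
  have DT: "D ^ m \<in> ?T" for m by (intro T(7) mpolys_mono[OF D_in]) auto
  have TS: "F \<in> ?T \<Longrightarrow> F \<in> S" for F by (rule in_S) auto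
  have DS: "D ^ m \<in> S" for m by (rule TS[OF DT])
  show ?thesis using f subring_set_UNIV
  proof (induct rule: mpolys_induct)
    case (const c)
    show ?case by (intro exI[of _ 0] bexI[of _ "mconst c"]) (auto simp: idl.zero)
  next
    case (var v)
    then obtain s t where st: "v = Xv s t" "s \<le> t" "t < n" by (auto simp: xvars_def)
    then have sn: "s < n" by simp
    obtain p where p: "p \<in> E2 n d A D" "phi_den n * p = D * (phi_num n d A s t - phi_den n * mvar (Xv (min s t) (max s t)))"
      using ex_E2[OF sn st(3)] by blast
    have "phi_den n * (p + D * mvar v) = D * phi_num n d A s t"
      using p(2) st(1,2) by (simp add: distrib_left right_diff_distrib min_absorb1 max_absorb2 ac_simps)
    moreover have "D * phi_num n d A s t \<in> ?T" using DT[of 1] phi_num_in[OF sn st(3)] by (intro T(6)) auto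
    ultimately have "p + D * mvar v \<in> ?T" by (rule factor_of_phi_den)
    moreover have "- p \<in> ?I" by (rule ideal_set_diff(1)[OF I _ idl_incl idl_incl]) (use p(1) in auto)
    ultimately show ?case by (intro exI[of _ 1] bexI[of _ "p + D * mvar v"]) auto
  next
    case (add f g)
    then obtain k F l G where F: "F \<in> ?T" "D ^ k * f - F \<in> ?I" and G: "G \<in> ?T" "D ^ l * g - G \<in> ?I" by blast
    have "D ^ (k + l) * (f + g) - (D ^ l * F + D ^ k * G) = D ^ l * (D ^ k * f - F) + D ^ k * (D ^ l * g - G)"
      by (simp add: algebra_simps power_add)
    also have "\<dots> \<in> ?I" by (intro ideal_setD(2,3)[OF I] DS F G)
    finally show ?case by (intro exI[of _ "k + l"] bexI[of _ "D ^ l * F + D ^ k * G"]) (auto intro: T F G DT)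
  next
    case (mult f g)
    then obtain k F l G where F: "F \<in> ?T" "D ^ k * f - F \<in> ?I" and G: "G \<in> ?T" "D ^ l * g - G \<in> ?I" by blast
    have gS: "g \<in> S" by (rule in_S[OF mult(2)]) auto
    have "D ^ (k + l) * (f * g) - F * G = (D ^ l * g) * (D ^ k * f - F) + F * (D ^ l * g - G)"
      by (simp add: algebra_simps power_add)
    also have "\<dots> \<in> ?I"
      by (intro ideal_setD(2,3)[OF I] F G TS mpolys_closed(6) subring_set_UNIV DS gS)
    finally show ?case by (intro exI[of _ "k + l"] bexI[of _ "F * G"]) (auto intro: T F G)
  qed
qed

text \<open>The colon condition is available over \<real>, while \<open>P\<close> is defined by it
  over \<rat>; coordinates in a Hamel basis bridge the two.\<close>

lemma colon_R:
  assumes "g \<in> SR" "g * f0 \<in> idl SR (E1' n d A)"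
  shows "g \<in> idl S E1"
proof -
  have "g \<in> idl SR P"
    by (rule rational_colon_descent[OF E1'_in f0 assms]) (simp add: P_iff)
  moreover have "idl SR P \<subseteq> idl S E1"
  proof -
    have I: "ideal_set S (idl S E1)" by (rule idl_ideal_set) simp
    have "ideal_set SQ (idl S E1)" "ideal_set SR (idl S E1)"
      using I in_S[of _ \<rat> "yvars d \<union> lvars n"] in_S[of _ UNIV "yvars d \<union> lvars n"] unfolding ideal_set_def by blast+
    moreover have "E1 \<subseteq> idl S E1" by (auto intro: idl_incl)
    ultimately show ?thesis using idl_least[of SQ "idl S E1" E1] idl_least[of SR "idl S E1" P] unfolding P_idl by blast
  qed
  ultimately show ?thesis by blast
qed

text \<open>After elimination of X there remains a combination \<open>F\<close> of monomials in z.
  They are grouped by the relations behind \<open>E3\<close>: within a group they are congruent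
  modulo \<open>E3\<close>, and the sum \<open>G\<close> of the coefficients of a group vanishes at
  generic points with \<open>f0\<close> nonzero, by independence of exponentials. So
  \<open>G\<close> lies in the ideal of \<open>E1\<close>.\<close>

lemma subset_ideal_J:
  assumes "f \<in> real_ideal_of n (zariski_closure n (exp_image n d A))"
  shows "f \<in> ideal_J n d A E1 D"
proof -
  have f: "f \<in> mpolys UNIV (xvars n)"
    and van: "\<And>M. M \<in> exp_image n d A \<Longrightarrow> eval_at_mat M (Poly_Mapping.map complex_of_real f) = 0"
    using assms by (auto simp: in_real_ideal_iff)
  obtain m F where F: "F \<in> mpolys UNIV (yvars d \<union> lvars n \<union> zvars n)" "D ^ m * f - F \<in> idl S (E2 n d A D)"
    using eliminate_X[OF f] by blast
  obtain Z :: "(nat \<Rightarrow> nat) set" and c where Z: "finite Z" "\<And>\<alpha>. \<alpha> \<in> Z \<Longrightarrow> c \<alpha> \<in> SR"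
    "F = (\<Sum>\<alpha>\<in>Z. c \<alpha> * (\<Prod>i<n. mvar (Zv i) ^ \<alpha> i))"
    using poly_in_z[OF F(1) subring_set_UNIV] by blast
  define rel where "rel \<alpha> \<beta> \<longleftrightarrow> (\<Sum>i<n. of_nat (\<alpha> i) * lvar i) - (\<Sum>j<n. of_nat (\<beta> j) * lvar j) \<in> P" for \<alpha> \<beta> :: "nat \<Rightarrow> nat"
  have rel_refl: "rel \<alpha> \<alpha>" for \<alpha> by (simp add: rel_def ideal_setD(1)[OF P_ideal])
  have rel_sym: "rel \<beta> \<alpha>" if "rel \<alpha> \<beta>" for \<alpha> \<beta>
    using ideal_set_diff(1)[OF P_ideal _ that[unfolded rel_def] that[unfolded rel_def]] by (simp add: rel_def)
  have rel_trans: "rel \<alpha> \<gamma>" if "rel \<alpha> \<beta>" "rel \<beta> \<gamma>" for \<alpha> \<beta> \<gamma>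
    using ideal_setD(2)[OF P_ideal that[unfolded rel_def]] by (simp add: rel_def)
  \<comment> \<open>The choice depends on the class alone, by \<open>rep_eq\<close>; the
    representative may lie outside \<open>Z\<close>.\<close>
  define rep where "rep \<alpha> = (SOME \<beta>. rel \<alpha> \<beta>)" for \<alpha>
  have rel_rep: "rel \<alpha> (rep \<alpha>)" for \<alpha> unfolding rep_def by (rule someI[of _ \<alpha>]) (rule rel_refl)
  have rep_eq: "rep \<alpha> = rep \<beta>" if "rel \<alpha> \<beta>" for \<alpha> \<beta>
  proof -
    have "rel \<alpha> = rel \<beta>" using that rel_sym rel_trans by blast
    then show ?thesis by (simp add: rep_def)
  qed
  let ?m = "\<lambda>\<alpha>. \<Prod>i<n. mvar (Zv i) ^ \<alpha> i :: rpoly"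
  \<comment> \<open>For each of these finitely many pairs the frequencies differ off some polynomial
    in y; off the product \<open>w0\<close>, equal frequencies mean related exponents.\<close>
  define W where "W = {p \<in> Z \<times> Z. \<not> rel (fst p) (snd p)}"
  define H where "H p w \<longleftrightarrow> w \<in> mpolys UNIV (yvars d) \<and> w \<noteq> 0 \<and> (\<forall>a\<in>points. meval a w \<noteq> 0 \<longrightarrow> meval a f0 \<noteq> 0 \<longrightarrow>
      (\<Sum>i<n. real (fst p i) * a (Lv i)) \<noteq> (\<Sum>i<n. real (snd p i) * a (Lv i)))"
    for p :: "(nat \<Rightarrow> nat) \<times> (nat \<Rightarrow> nat)" and w
  have "\<exists>w. H p w" if "p \<in> W" for p
    using generic_relation[OF relation_in, of "fst p" "snd p"] that
    by (auto simp: W_def rel_def H_def meval.hom_minus meval.hom_sum meval.hom_mult meval.hom_of_nat)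
  then have "\<forall>p\<in>W. \<exists>w. H p w" by blast
  from bchoice[OF this] obtain w where "\<And>p. p \<in> W \<Longrightarrow> H p (w p)" by blast
  then have w: "\<And>p. p \<in> W \<Longrightarrow> w p \<in> mpolys UNIV (yvars d)" "\<And>p. p \<in> W \<Longrightarrow> w p \<noteq> 0"
    "\<And>p a. p \<in> W \<Longrightarrow> a \<in> points \<Longrightarrow> meval a (w p) \<noteq> 0 \<Longrightarrow> meval a f0 \<noteq> 0 \<Longrightarrow>
      (\<Sum>i<n. real (fst p i) * a (Lv i)) \<noteq> (\<Sum>i<n. real (snd p i) * a (Lv i))"
    unfolding H_def by blast+
  have finW: "finite W" unfolding W_def using Z(1) by simp
  define w0 where "w0 = (\<Prod>p\<in>W. w p)"
  have w0: "w0 \<noteq> 0" "w0 \<in> mpolys UNIV (yvars d)"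
    using w(2) finW by (simp add: w0_def) (auto simp: w0_def intro!: mpolys_closed(9) w(1))
  define G where "G \<gamma> = (\<Sum>\<alpha>\<in>{\<alpha> \<in> Z. rep \<alpha> = \<gamma>}. c \<alpha>)" for \<gamma>
  have G_SR: "G \<gamma> \<in> SR" for \<gamma> unfolding G_def by (intro mpolys_closed(8) subring_set_UNIV Z(2)) simp
  have "meval a (G \<gamma>) = 0" if a: "a \<in> points" "meval a f0 \<noteq> 0" "meval a w0 \<noteq> 0" for a \<gamma>
  proof -
    have "meval (exp_point k a) F = 0" for k :: nat
    proof -
      have "cmat (mat_exp (mat_lincomb n d A (\<lambda>i. k * a (Yv i)))) \<in> exp_image n d A"
        by (auto simp: exp_image_def)
      then have "meval (exp_point k a) f = 0" using van eval_real_exp[OF a(1) f, of k] by simp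
      moreover have "meval (exp_point k a) (D ^ m * f - F) = 0"
        by (rule idl_hom_zero[OF comm_ring_hom_meval _ F(2)]) (rule E2_vanish[OF a(1)])
      ultimately show ?thesis by (simp add: meval.hom_minus meval.hom_mult)
    qed
    then have Fk: "(\<Sum>\<alpha>\<in>Z. meval a (c \<alpha>) * (\<Prod>i<n. exp (k * a (Lv i)) ^ \<alpha> i)) = 0" for k :: nat
      by (simp add: Z(3) meval.hom_sum meval.hom_mult meval.hom_prod meval.hom_power exp_point_YL[OF Z(2)] cong: sum.cong)
    \<comment> \<open>The weights are the indicator of the group \<gamma>. It is constant on
      exponents of equal frequency, because these are related.\<close>
    have "(\<Sum>\<alpha>\<in>Z. complex_of_real (meval a (c \<alpha>)) * (if rep \<alpha> = \<gamma> then 1 else 0)) = 0"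
    proof (rule frequency_sums_vanish[OF Z(1), where l = "\<lambda>i. a (Lv i)" and n = n])
      fix k :: nat
      show "(\<Sum>\<alpha>\<in>Z. complex_of_real (meval a (c \<alpha>)) * of_real (\<Prod>i<n. exp (k * a (Lv i)) ^ \<alpha> i)) = 0"
        using arg_cong[OF Fk[of k], of complex_of_real] by simp
    next
      fix \<alpha> \<beta> assume ab: "\<alpha> \<in> Z" "\<beta> \<in> Z" "(\<Sum>i<n. \<alpha> i * a (Lv i)) = (\<Sum>i<n. \<beta> i * a (Lv i))"
      have "rel \<alpha> \<beta>"
      proof (rule ccontr)
        assume "\<not> rel \<alpha> \<beta>"
        then have p: "(\<alpha>, \<beta>) \<in> W" using ab by (simp add: W_def)
        then have "meval a (w (\<alpha>, \<beta>)) \<noteq> 0" using a(3) finW by (auto simp: w0_def meval.hom_prod)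
        from w(3)[OF p a(1) this a(2)] ab(3) show False by simp
      qed
      then show "(if rep \<alpha> = \<gamma> then 1 else 0 :: complex) = (if rep \<beta> = \<gamma> then 1 else 0)" by (simp add: rep_eq)
    qed
    then have "complex_of_real (\<Sum>\<alpha>\<in>Z. if rep \<alpha> = \<gamma> then meval a (c \<alpha>) else 0) = 0"
      by (simp add: if_distrib[of "\<lambda>x. _ * x"] if_distrib[of complex_of_real] cong: if_cong)
    then have "(\<Sum>\<alpha>\<in>Z. if rep \<alpha> = \<gamma> then meval a (c \<alpha>) else 0) = 0"
      by (simp only: of_real_eq_0_iff)
    then show ?thesis
      by (simp add: G_def meval.hom_sum sum.inter_filter Z(1) if_distrib[of "meval a"] cong: if_cong)
  qed
  then have "G \<gamma> * f0 \<in> idl SR (E1' n d A)" for \<gamma>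
    by (intro vanishing_R[OF w0]) (auto intro!: mpolys_closed(6) G_SR mpolys_mono[OF f0] simp: meval.hom_mult)
  then have G1: "G \<gamma> \<in> idl S E1" for \<gamma> by (rule colon_R[OF G_SR])
  let ?E = "E1 \<union> E2 n d A D \<union> E3 n P"
  have I: "ideal_set S (idl S ?E)" by (rule idl_ideal_set) simp
  have mono: "x \<in> idl S ?E" if "x \<in> idl S E" "E \<subseteq> ?E" for x E
    by (rule idl_least[OF I _ that(1)]) (use that(2) in \<open>auto intro!: idl_incl\<close>)
  have mS: "?m \<alpha> \<in> S" for \<alpha>
    by (intro mpolys_closed(9) mpolys_closed(7) mvar_mpolys subring_set_UNIV) (auto simp: zvars_def)
  have "F = (\<Sum>\<alpha>\<in>Z. c \<alpha> * (?m \<alpha> - ?m (rep \<alpha>))) + (\<Sum>\<alpha>\<in>Z. c \<alpha> * ?m (rep \<alpha>))"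
    unfolding Z(3) by (simp add: right_diff_distrib sum_subtractf)
  also have "(\<Sum>\<alpha>\<in>Z. c \<alpha> * ?m (rep \<alpha>)) = (\<Sum>\<gamma>\<in>rep ` Z. \<Sum>\<alpha>\<in>{\<alpha> \<in> Z. rep \<alpha> = \<gamma>}. c \<alpha> * ?m (rep \<alpha>))"
    by (rule sum.image_gen[OF Z(1)])
  also have "\<dots> = (\<Sum>\<gamma>\<in>rep ` Z. G \<gamma> * ?m \<gamma>)"
    unfolding G_def sum_distrib_right by (intro sum.cong refl) auto
  finally have FG: "F = (\<Sum>\<alpha>\<in>Z. c \<alpha> * (?m \<alpha> - ?m (rep \<alpha>))) + (\<Sum>\<gamma>\<in>rep ` Z. G \<gamma> * ?m \<gamma>)" .
  have e3: "?m \<alpha> - ?m (rep \<alpha>) \<in> E3 n P" for \<alpha>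
    using rel_rep[of \<alpha>] unfolding rel_def E3_def by blast
  have "F \<in> idl S ?E"
    unfolding FG
  proof (intro ideal_setD(2)[OF I] ideal_setD(5)[OF I])
    fix \<alpha> assume "\<alpha> \<in> Z"
    then have "c \<alpha> \<in> S" by (intro in_S[OF Z(2)]) auto
    then show "c \<alpha> * (?m \<alpha> - ?m (rep \<alpha>)) \<in> idl S ?E"
      by (intro ideal_setD(3)[OF I] idl_incl) (use e3 in auto)
  next
    fix \<gamma>
    show "G \<gamma> * ?m \<gamma> \<in> idl S ?E" by (intro ideal_setD(4)[OF I] mono[OF G1] mS) auto
  qed
  moreover have "D ^ m * f - F \<in> idl S ?E" by (rule mono[OF F(2)]) auto
  ultimately have "D ^ m * f \<in> idl S ?E" using ideal_setD(2)[OF I, of "D ^ m * f - F" F] by simp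
  moreover have "f \<in> S" by (rule in_S[OF f]) auto
  ultimately show ?thesis using f by (auto simp: ideal_J_def ideal_I_eq)
qed

end

theorem theorem3p6:
  fixes n d :: nat and A :: "nat \<Rightarrow> real mat"
  assumes "\<forall>i<d. A i \<in> sym_mats n"
    and "mat_lin_indep n d A"
    and "distinct_eigenvalues n d A"
  shows "irreducible_variety n (gibbs_variety n (mat_span n d A)) \<and>
    unirational n (gibbs_variety n (mat_span n d A)) \<and>
    ((\<forall>i<d. elements_mat (A i) \<subseteq> \<rat>) \<longrightarrow>
      (\<forall>E1 D. implicitization_choice n d A E1 D \<longrightarrow>
        primeideal (ideal_J n d A E1 D) (RX n) \<and>
        ideal_J n d A E1 D = real_ideal_of n (gibbs_variety n (mat_span n d A))))"
proof -
  obtain h where h: "h \<noteq> 0" "mvars h \<subseteq> yvars d" "\<And>a. meval a h \<noteq> 0 \<Longrightarrow>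
    \<exists>l. inj_on l {..<n} \<and> map_poly (meval a) (char_poly (pencil n d A)) = (\<Prod>i<n. [:- l i, 1:])"
    using ex_discriminant[OF assms(1,3)] by blast
  have pf: "pencil_family n d A h"
    by unfold_locales (use assms(1) h in auto)
  have iu: "irreducible_variety n (zariski_closure n (exp_image n d A)) \<and> unirational n (zariski_closure n (exp_image n d A))"
    by (rule pencil_family.irreducible_and_unirational[OF pf])
  have J: "ideal_J n d A E1 D = real_ideal_of n (zariski_closure n (exp_image n d A))"
    if rat: "\<forall>i<d. elements_mat (A i) \<subseteq> \<rat>" and choice: "implicitization_choice n d A E1 D" for E1 D
  proof -
    obtain f0 where f0: "f0 \<in> carrier (Qyl n d)"
      "Idl\<^bsub>Qyl n d\<^esub> E1 = {g \<in> carrier (Qyl n d). g * f0 \<in> Idl\<^bsub>Qyl n d\<^esub> (E1' n d A)}"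
      using choice by (auto simp: implicitization_choice_def associated_prime_def)
    have "A i $$ (s, t) \<in> \<rat>" if "i < d" "s < n" "t < n" for i s t
    proof -
      have "A i \<in> carrier_mat n n" using assms(1) that(1) by (simp add: sym_mats_def)
      then have "A i $$ (s, t) \<in> elements_mat (A i)" using that by (auto simp: elements_mat_carrier)
      then show ?thesis using rat that(1) by blast
    qed
    then have "implicitization n d A h E1 D f0"
      using pf choice f0
      by (auto simp: implicitization_def implicitization_axioms_def implicitization_choice_def associated_prime_def)
    then interpret implicitization n d A h E1 D f0 .
    show ?thesis using ideal_J_subset subset_ideal_J by blast
  qed
  \<comment> \<open>Primality of \<open>J\<close> is inherited from irreducibility through the
    equality of ideals.\<close>
  show ?thesis
    using iu J real_ideal_prime[OF conjunct1[OF iu]] by (simp add: gibbs_variety_eq)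
qed

end
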